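(* Let $N\ge1$, $k\ge1$, let $B=(\beta_{ij})_{i,j=1}^k$ be a real symmetric positive semidefinite matrix, and let $\omega_1,\dots,\omega_k\in\mathbb{R}$. Let $(u_1,\dots,u_k)\in H$ be a positive solution of $$-\Delta u_i+|x|^2u_i+u_i\sum_{j=1}^k\beta_{ij}u_j^2=\omega_iu_i\quad\text{in }\mathbb{R}^N,\qquad i=1,\dots,k.$$ Then, for every $i=1,\dots,k$, $$u_i(x)\sim|x|^{\frac{\omega_i-N}{2}}e^{-\frac12|x|^2}\quad\text{as }|x|\to\infty.$$
   Context: $H=\{u\in(H^1(\mathbb{R}^N)\cap L^4(\mathbb{R}^N))^k:\int_{\mathbb{R}^N}u_i^2|x|^2\,dx<\infty\text{ for all }i\}$. Solutions are weak solutions. $(u_1,\dots,u_k)$ is positive if $u_i>0$ in $\mathbb{R}^N$ for every $i$. The notation $a(x)\sim b(x)$ as $|x|\to\infty$ means that there exist $C_1,C_2>0$ such that $C_1b(x)\le a(x)\le C_2b(x)$ for all sufficiently large $|x|$. *)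

theory Defs
  imports "HOL-Analysis.Analysis"
begin

definition gradient :: "(real ^ 'n \<Rightarrow> real) \<Rightarrow> real ^ 'n \<Rightarrow> real ^ 'n" where
  "gradient f x = (\<chi> j. frechet_derivative f (at x) (axis j 1))"

primrec Ck :: "nat \<Rightarrow> (real ^ 'n \<Rightarrow> real) \<Rightarrow> bool" where
  "Ck 0 f \<longleftrightarrow> continuous_on UNIV f"
| "Ck (Suc m) f \<longleftrightarrow> (\<forall>x. f differentiable (at x)) \<and> (\<forall>j. Ck m (\<lambda>x. gradient f x $ j))"

definition test_functions :: "(real ^ 'n \<Rightarrow> real) set" where
  "test_functions = {\<phi>. (\<forall>m. Ck m \<phi>) \<and> compact (closure {x. \<phi> x \<noteq> 0})}"

text \<open>Elements of function spaces are represented by arbitrary Lebesgue measurable functions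
  rather than by classes modulo null sets; all notions below are invariant under modification on
  a null set.\<close>

definition Lp :: "nat \<Rightarrow> (real ^ 'n \<Rightarrow> 'b::euclidean_space) set" where
  "Lp p = {f \<in> borel_measurable lebesgue. integrable lebesgue (\<lambda>x. norm (f x) ^ p)}"

definition has_H1_gradient :: "(real ^ 'n \<Rightarrow> real) \<Rightarrow> (real ^ 'n \<Rightarrow> real ^ 'n) \<Rightarrow> bool" where
  "has_H1_gradient f G \<longleftrightarrow> f \<in> Lp 2 \<and> G \<in> Lp 2 \<and>
     (\<forall>\<phi>\<in>test_functions.
        (\<integral>x. f x *\<^sub>R gradient \<phi> x \<partial>lebesgue) = - (\<integral>x. \<phi> x *\<^sub>R G x \<partial>lebesgue))"

definition H1 :: "(real ^ 'n \<Rightarrow> real) set" where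
  "H1 = {f. \<exists>G. has_H1_gradient f G}"

definition energy_space :: "('k::finite \<Rightarrow> real ^ 'n \<Rightarrow> real) set" where
  "energy_space = {u. \<forall>i. u i \<in> H1 \<inter> Lp 4 \<and>
     integrable lebesgue (\<lambda>x. (u i x)\<^sup>2 * (norm x)\<^sup>2)}"

definition positive_semidefinite :: "real ^ 'k ^ 'k \<Rightarrow> bool" where
  "positive_semidefinite B \<longleftrightarrow> (\<forall>v. 0 \<le> v \<bullet> (B *v v))"

text \<open>The weak gradient \<open>G\<close> of \<open>u i\<close> is unique up to null sets, so the existential quantifier
  below merely names it. Every integrand is integrable when \<open>u\<close> is in the energy space; testing
  with compactly supported smooth functions is, by density, the same as testing with all
  components of elements of the energy space.\<close>

definition weak_solution ::
    "real ^ 'k ^ 'k \<Rightarrow> ('k::finite \<Rightarrow> real) \<Rightarrow> ('k \<Rightarrow> real ^ 'n \<Rightarrow> real) \<Rightarrow> bool" where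
  "weak_solution B \<omega> u \<longleftrightarrow> (\<forall>i. \<exists>G. has_H1_gradient (u i) G \<and>
     (\<forall>\<phi>\<in>test_functions.
        (\<integral>x. G x \<bullet> gradient \<phi> x + (norm x)\<^sup>2 * u i x * \<phi> x
              + u i x * (\<Sum>j\<in>UNIV. B $ i $ j * (u j x)\<^sup>2) * \<phi> x \<partial>lebesgue)
        = (\<integral>x. \<omega> i * u i x * \<phi> x \<partial>lebesgue)))"

text \<open>Two-sided comparability as \<open>|x|\<close> tends to infinity. Pointwise bounds on a Sobolev
  function make sense almost everywhere; for a continuous representative they then hold at every
  point, as the lemma after the definition shows.\<close>

definition comparable_at_infinity ::
    "(real ^ 'n \<Rightarrow> real) \<Rightarrow> (real ^ 'n \<Rightarrow> real) \<Rightarrow> bool" where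
  "comparable_at_infinity a b \<longleftrightarrow> (\<exists>C1>0. \<exists>C2>0. \<exists>R.
     AE x in lebesgue. R \<le> norm x \<longrightarrow> C1 * b x \<le> a x \<and> a x \<le> C2 * b x)"

lemma comparable_at_infinity_continuous_iff:
  fixes a b :: "real ^ 'n \<Rightarrow> real"
  assumes a: "continuous_on (- {0}) a" and b: "continuous_on (- {0}) b"
  shows "comparable_at_infinity a b \<longleftrightarrow> (\<exists>C1>0. \<exists>C2>0. \<exists>R. \<forall>x.
     R \<le> norm x \<longrightarrow> C1 * b x \<le> a x \<and> a x \<le> C2 * b x)"
proof
  assume "comparable_at_infinity a b"
  then obtain C1 C2 R where C: "C1 > 0" "C2 > 0"
    and ae: "AE x in lebesgue. R \<le> norm x \<longrightarrow> C1 * b x \<le> a x \<and> a x \<le> C2 * b x"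
    unfolding comparable_at_infinity_def by blast
  define S where "S = - cball (0 :: real ^ 'n) (max R 0)"
  define U where "U = (\<lambda>x. min (a x - C1 * b x) (C2 * b x - a x)) -` {..<0} \<inter> S"
  have "open S" "S \<subseteq> - {0}"
    by (auto simp: S_def)
  then have "continuous_on S (\<lambda>x. min (a x - C1 * b x) (C2 * b x - a x))"
    by (intro continuous_intros continuous_on_subset[OF a] continuous_on_subset[OF b])
  then have "open U"
    unfolding U_def using \<open>open S\<close> continuous_on_open_vimage open_lessThan by blast
  have "AE x in lebesgue. x \<notin> U"
    using ae by eventually_elim (auto simp: U_def S_def min_def split: if_splits)
  then have "negligible U"
    by (simp add: AE_iff_null_sets negligible_iff_null_sets \<open>open U\<close> borel_open)
  then have "U = {}"
    using open_not_negligible[OF \<open>open U\<close>] by blast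
  then have "C1 * b x \<le> a x \<and> a x \<le> C2 * b x" if "max R 0 + 1 \<le> norm x" for x
  proof -
    have "x \<in> S" "x \<notin> U"
      using that \<open>U = {}\<close> by (auto simp: S_def)
    then have "\<not> min (a x - C1 * b x) (C2 * b x - a x) < 0"
      by (simp add: U_def)
    then show ?thesis
      by (simp add: not_less)
  qed
  with C show "\<exists>C1>0. \<exists>C2>0. \<exists>R. \<forall>x. R \<le> norm x \<longrightarrow> C1 * b x \<le> a x \<and> a x \<le> C2 * b x"
    by blast
next
  assume "\<exists>C1>0. \<exists>C2>0. \<exists>R. \<forall>x. R \<le> norm x \<longrightarrow> C1 * b x \<le> a x \<and> a x \<le> C2 * b x"
  then obtain C1 C2 R where "C1 > 0" "C2 > 0"
    and "\<And>x. R \<le> norm x \<Longrightarrow> C1 * b x \<le> a x \<and> a x \<le> C2 * b x"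
    by blast
  then show "comparable_at_infinity a b"
    unfolding comparable_at_infinity_def by (intro exI[of _ C1] exI[of _ C2] exI[of _ R] conjI) auto
qed

end

theory Submission
  imports Defs
begin

text \<open>
  The Euclidean norm \<open>w\<close> of the solution vector satisfies \<open>\<Delta> w \<ge> (|x|\<^sup>2 - max \<omega>) w\<close> by Kato's
  inequality, because positive semidefiniteness makes the interaction terms drop out. The mean
  value inequality for subsolutions and the finiteness of the second moments then give
  \<open>w = O(1 / |x|)\<close>, so each component solves a linear equation whose potential is
  \<open>|x|\<^sup>2 - \<omega> i + O(1 / |x|\<^sup>2)\<close>. Writing \<open>a = (\<omega> i - N) / 2\<close>, the functions
  \<open>(1 + |x|\<^sup>2) powr (a / 2) * exp (- |x|\<^sup>2 / 2 \<plusminus> 1 / sqrt (1 + |x|\<^sup>2))\<close> are a sub- and a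
  supersolution of that equation outside a large ball. Inside the ball the component is bounded
  above and, by the mean value inequality for positive supersolutions, bounded away from 0, so it
  can be compared there with multiples of the two barriers. The positive part of each
  difference is a nonnegative subsolution of \<open>\<Delta> z \<ge> z\<close> of polynomial growth, hence vanishes.

  Everything is done with distributional Laplacians of locally integrable functions; no regularity
  of the solution is needed. The mean value inequalities and Kato's inequality come from one
  family of radial mollifiers whose derivative with respect to the scale is the Laplacian of a
  nonnegative test function.
\<close>

subsection \<open>A smooth bump function\<close>

text \<open>The interaction term of a single component has no sign. Contracting the system with u_i
  / |u| turns all interactions into the quadratic form of B at (u_1^2, ..., u_k^2), divided by |u|;
  this is why the Euclidean norm comes first. The decay 1 / |x| obtained from it is just strong
  enough: it makes the interactions smaller than the margin of order 1 / |x| that the factors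
  exp(+-1 / sqrt(1 + |x|^2)) create, and these factors tend to 1, so they do not affect the
  asymptotics. The exponent a is forced: the Laplacian of |x|^a exp(-|x|^2 / 2) is |x|^2 - 2 a - N +
  O(|x|^-2) times that function, and 2 a + N has to equal \<omega>_i.

  Near the origin the potential |x|^2 - \<omega>_i + ... may be negative, so comparison is possible
  only where it is at least 1. Functions known up to null sets have no values on a sphere |x| = R.
  The sign of the difference is therefore arranged on the whole ball, and its positive part is
  treated as a subsolution on the whole space.\<close>

definition bump :: "real poly \<Rightarrow> real \<Rightarrow> real" where
  "bump P t = (if t < 1 then poly P (1 / (1 - t)) * exp (- (1 / (1 - t))) else 0)"

text \<open>With r = 1 / (1 - t) one has dr/dt = r^2, so P(r) exp(-r) differentiates to r^2 (P'(r) -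
  P(r)) exp(-r). Carrying the polynomial as a parameter closes the family under differentiation, and
  smoothness reduces to one derivative formula.\<close>

definition bump_deriv :: "real poly \<Rightarrow> real poly" where
  "bump_deriv P = monom 1 2 * (pderiv P - P)"

lemma poly_times_exp_minus_tendsto_0:
  fixes P :: "real poly"
  shows "((\<lambda>r. poly P r * exp (- r)) \<longlongrightarrow> 0) at_top"
proof -
  have "((\<lambda>r. \<Sum>i\<le>degree P. coeff P i * (r ^ i / exp r)) \<longlongrightarrow> (\<Sum>i\<le>degree P. coeff P i * 0)) at_top"
    by (intro tendsto_sum tendsto_mult tendsto_const tendsto_power_div_exp_0)
  then show ?thesis
    by (simp add: poly_altdef exp_minus field_simps sum_divide_distrib)
qed

lemma bump_tendsto_0_left: "((\<lambda>t. poly P (1 / (1 - t)) * exp (- (1 / (1 - t)))) \<longlongrightarrow> (0::real)) (at_left 1)"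
proof -
  have "((\<lambda>t::real. 1 - t) \<longlongrightarrow> 1 - 1) (at_left 1)"
    by (intro tendsto_intros)
  then have "filterlim (\<lambda>t::real. 1 - t) (at_right 0) (at_left 1)"
    by (auto simp: filterlim_at eventually_at_filter)
  then have "filterlim (\<lambda>t::real. inverse (1 - t)) at_top (at_left 1)"
    by (rule filterlim_compose[OF filterlim_inverse_at_top_right])
  then show ?thesis
    using filterlim_compose[OF poly_times_exp_minus_tendsto_0[of P]] by (simp add: inverse_eq_divide)
qed

lemma DERIV_bump: "(bump P has_real_derivative bump (bump_deriv P) t) (at t)"
proof (cases t "1 :: real" rule: linorder_cases)
  case less
  have "((\<lambda>t. poly P (1 / (1 - t)) * exp (- (1 / (1 - t)))) has_real_derivative
      bump (bump_deriv P) t) (at t)"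
    using less unfolding bump_def bump_deriv_def
    by (auto intro!: derivative_eq_intros poly_DERIV[THEN DERIV_chain2] simp: poly_monom power2_eq_square diff_divide_distrib left_diff_distrib)
  moreover have "eventually (\<lambda>s. s < 1) (nhds t)"
    using less eventually_nhds_in_open[of "{..<1}" t] by auto
  then have "eventually (\<lambda>s. bump P s = poly P (1 / (1 - s)) * exp (- (1 / (1 - s)))) (nhds t)"
    by eventually_elim (simp add: bump_def)
  ultimately show ?thesis
    using DERIV_cong_ev[OF refl _ refl, of "bump P"] by simp
next
  case equal
  \<comment> \<open>As \<open>bump P 1\<close> is 0, the left difference quotient is -r P(r) exp(-r)
    with r = 1 / (1 - s). This is again of bump form, with the polynomial multiplied by its
    variable.\<close>
  have "((\<lambda>s. - (poly (monom 1 1 * P) (1 / (1 - s)) * exp (- (1 / (1 - s))))) \<longlongrightarrow> - 0) (at_left 1)"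
    by (intro tendsto_minus bump_tendsto_0_left)
  moreover have "eventually (\<lambda>s. - (poly (monom 1 1 * P) (1 / (1 - s)) * exp (- (1 / (1 - s))))
      = (bump P s - bump P 1) / (s - 1)) (at_left (1::real))"
    by (auto simp: bump_def poly_monom eventually_at_filter field_simps intro!: always_eventually)
  ultimately have "((\<lambda>s. (bump P s - bump P 1) / (s - 1)) \<longlongrightarrow> - 0) (at_left 1)"
    by (rule Lim_transform_eventually)
  then have "((\<lambda>s. (bump P s - bump P 1) / (s - 1)) \<longlongrightarrow> 0) (at_left 1)"
    by simp
  moreover have "((\<lambda>s. (bump P s - bump P 1) / (s - 1)) \<longlongrightarrow> 0) (at_right 1)"
    by (rule Lim_transform_eventually[OF tendsto_const])
      (auto simp: bump_def eventually_at_filter intro!: always_eventually)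
  ultimately have "((\<lambda>s. (bump P s - bump P 1) / (s - 1)) \<longlongrightarrow> 0) (at 1)"
    by (simp add: filterlim_split_at)
  then show ?thesis
    using equal by (simp add: has_field_derivative_iff bump_def[of "bump_deriv P"])
next
  case greater
  have "eventually (\<lambda>s. s > 1) (nhds t)"
    using greater eventually_nhds_in_open[of "{1<..}" t] by auto
  then have "eventually (\<lambda>s. bump P s = 0) (nhds t)"
    by eventually_elim (simp add: bump_def)
  then have "(bump P has_real_derivative 0) (at t)"
    using DERIV_cong_ev[OF refl _ refl, of "bump P" "\<lambda>_. 0"] by simp
  then show ?thesis
    using greater by (simp add: bump_def[of "bump_deriv P"])
qed

lemma bump_eq_0: "t \<ge> 1 \<Longrightarrow> bump P t = 0"
  by (simp add: bump_def)

lemma continuous_on_bump: "continuous_on S (bump P)"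
  using DERIV_bump DERIV_continuous_on has_field_derivative_at_within by blast

lemma bump_1_nonneg: "bump 1 t \<ge> 0"
  by (simp add: bump_def)

text \<open>Minus the derivative of exp(-r) is r^2 exp(-r), and r = 1 / (1 - t) is at least 1 for t
  in [0, 1). The inequality later bounds averages against \<open>kernel 1\<close> by averages
  against \<open>kernel rho\<close>, so that zero-order terms can be absorbed by a Gronwall argument
  in the scale.\<close>

lemma bump_1_le:
  assumes "t \<ge> 0"
  shows "bump 1 t \<le> - bump (bump_deriv 1) t"
proof (cases "t < 1")
  case True
  with assms have "1 \<le> (1 / (1 - t))\<^sup>2"
    by (simp add: field_simps power_le_one)
  with True show ?thesis
    by (simp add: bump_def bump_deriv_def poly_monom)
qed (simp add: bump_def)

subsection \<open>Smooth functions of several variables\<close>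

lemma gradient_nth:
  assumes "(f has_derivative f') (at x)"
  shows "gradient f x $ j = f' (axis j 1)"
  using frechet_derivative_at[OF assms] by (simp add: gradient_def)

lemma Ck_SucI:
  assumes "\<And>x. (f has_derivative f' x) (at x)" "\<And>j. Ck m (\<lambda>x. f' x (axis j 1))"
  shows "Ck (Suc m) f"
  using assms by (auto simp: gradient_nth[OF assms(1)] differentiable_def)

lemma Ck_Suc_has_derivative:
  assumes "Ck (Suc m) f"
  shows "(f has_derivative frechet_derivative f (at x)) (at x)"
  using assms by (simp add: frechet_derivative_works)

lemma Ck_Suc_imp: "Ck (Suc m) f \<Longrightarrow> Ck m f"
proof (induction m arbitrary: f)
  case 0
  then show ?case
    by (auto intro!: differentiable_imp_continuous_on simp: differentiable_on_def differentiable_at_withinI)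
qed auto

lemma Ck_le: "m \<le> n \<Longrightarrow> Ck n f \<Longrightarrow> Ck m f"
  by (induction n rule: dec_induct) (blast dest: Ck_Suc_imp)+

lemma Ck_continuous: "Ck m f \<Longrightarrow> continuous_on UNIV f"
  using Ck_le[of 0 m f] by simp

lemma Ck_const: "Ck m (\<lambda>_. c)"
proof (induction m arbitrary: c)
  case (Suc m)
  show ?case
    by (rule Ck_SucI[where f' = "\<lambda>_ _. 0"]) (use Suc in auto)
qed simp

lemma Ck_nth: "Ck m (\<lambda>x. x $ i)"
proof (cases m)
  case 0
  then show ?thesis
    by (auto intro!: continuous_intros)
next
  case (Suc m)
  show ?thesis
    unfolding Suc
    by (rule Ck_SucI[where f' = "\<lambda>_ v. v $ i"]) (auto intro!: Ck_const bounded_linear_imp_has_derivative bounded_linear_vec_nth)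
qed

lemma Ck_add: "Ck m f \<Longrightarrow> Ck m g \<Longrightarrow> Ck m (\<lambda>x. f x + g x)"
proof (induction m arbitrary: f g)
  case (Suc m)
  show ?case
    by (rule Ck_SucI[OF has_derivative_add[OF Ck_Suc_has_derivative[OF Suc.prems(1)] Ck_Suc_has_derivative[OF Suc.prems(2)]]])
      (use Suc in \<open>auto simp: gradient_def\<close>)
qed (auto intro!: continuous_intros)

lemma Ck_mult: "Ck m f \<Longrightarrow> Ck m g \<Longrightarrow> Ck m (\<lambda>x. f x * g x)"
proof (induction m arbitrary: f g)
  case (Suc m)
  have *: "Ck m f" "Ck m g"
    using Suc.prems Ck_Suc_imp by blast+
  show ?case
    by (rule Ck_SucI[OF has_derivative_mult[OF Ck_Suc_has_derivative[OF Suc.prems(1)] Ck_Suc_has_derivative[OF Suc.prems(2)]]])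
      (intro Ck_add Suc.IH *; use Suc.prems in \<open>simp add: gradient_def\<close>)
qed (auto intro!: continuous_intros)

lemma Ck_sum: "finite I \<Longrightarrow> (\<And>i. i \<in> I \<Longrightarrow> Ck m (f i)) \<Longrightarrow> Ck m (\<lambda>x. \<Sum>i\<in>I. f i x)"
  by (induction I rule: finite_induct) (auto intro!: Ck_const Ck_add)

text \<open>\<open>G i\<close> stands for the i-th derivative of the outer function and is
  constrained only at values of \<open>h\<close>. Outer functions controlled only for nonnegative
  arguments can thus be composed with |x|^2, as the barriers require.\<close>

lemma Ck_compose:
  assumes "\<And>i x. i < m \<Longrightarrow> (G i has_real_derivative G (Suc i) (h x)) (at (h x))"
    and "continuous_on UNIV (\<lambda>x. G m (h x))" and "Ck m h"
  shows "Ck m (\<lambda>x. G 0 (h x))"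
  using assms
proof (induction m arbitrary: G)
  case (Suc m)
  have d: "((\<lambda>x. G 0 (h x)) has_derivative (\<lambda>v. G 1 (h x) * frechet_derivative h (at x) v)) (at x)" for x
    using has_derivative_compose[OF Ck_Suc_has_derivative[OF Suc.prems(3)], of "G 0"] Suc.prems(1)[of 0 x]
    by (simp add: has_field_derivative_def mult.commute)
  have "Ck m (\<lambda>x. G (Suc 0) (h x))"
    using Suc.prems(1,2) by (intro Suc.IH[of "\<lambda>i. G (Suc i)"] Ck_Suc_imp[OF Suc.prems(3)]) auto
  moreover have "Ck m (\<lambda>x. frechet_derivative h (at x) (axis j 1))" for j
    using Suc.prems(3) by (simp add: gradient_def)
  ultimately show ?case
    by (intro Ck_SucI[OF d] Ck_mult) auto
qed simp

lemma norm_diff_sq_vec: "(norm (x - a :: real ^ 'n))\<^sup>2 = (\<Sum>i\<in>UNIV. (x $ i + (- a $ i)) * (x $ i + (- a $ i)))"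
  by (simp add: power2_norm_eq_inner inner_vec_def)

lemma Ck_norm_diff_sq: "Ck m (\<lambda>x :: real ^ 'n. c * (norm (x - a))\<^sup>2)"
  unfolding norm_diff_sq_vec
  by (intro Ck_mult Ck_const Ck_sum Ck_add Ck_nth) auto

definition laplacian :: "(real ^ 'n \<Rightarrow> real) \<Rightarrow> real ^ 'n \<Rightarrow> real" where
  "laplacian f x = (\<Sum>j\<in>UNIV. gradient (\<lambda>y. gradient f y $ j) x $ j)"

text \<open>The chain rule, with |grad h|^2 = 4 c h and the Laplacian of h equal to 2 c N.\<close>

lemma laplacian_radial:
  fixes a x :: "real ^ 'n" and c :: real
  defines "h \<equiv> \<lambda>x. c * (norm (x - a))\<^sup>2"
  assumes G: "\<And>x. (G has_real_derivative G' (h x)) (at (h x))"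
    and G': "\<And>x. (G' has_real_derivative G'' (h x)) (at (h x))"
  shows "laplacian (\<lambda>x. K * G (h x)) x = K * (2 * c * CARD('n) * G' (h x) + 4 * c * h x * G'' (h x))"
proof -
  have h: "(h has_derivative (\<lambda>v. 2 * c * ((x - a) \<bullet> v))) (at x)" for x
    unfolding h_def by (auto intro!: derivative_eq_intros simp: power2_norm_eq_inner fun_eq_iff inner_commute)
  have GGh: "((\<lambda>x. G (h x)) has_derivative (\<lambda>v. (2 * c * ((x - a) \<bullet> v)) * G' (h x))) (at x)" for x
    using has_derivative_compose[OF h, of G] G[of x] by (simp add: has_field_derivative_def mult.commute)
  have GGh': "((\<lambda>x. G' (h x)) has_derivative (\<lambda>v. (2 * c * ((x - a) \<bullet> v)) * G'' (h x))) (at x)" for x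
    using has_derivative_compose[OF h, of G'] G'[of x] by (simp add: has_field_derivative_def mult.commute)
  have 1: "gradient (\<lambda>x. K * G (h x)) x $ j = 2 * K * c * (x - a) $ j * G' (h x)" for x j
    by (subst gradient_nth[OF has_derivative_mult_right[OF GGh]]) (simp add: inner_axis)
  have nth: "((\<lambda>x. 2 * K * c * (x - a) $ j) has_derivative (\<lambda>v. 2 * K * c * v $ j)) (at x)" for j x
    by (auto intro!: derivative_eq_intros bounded_linear_imp_has_derivative bounded_linear_vec_nth)
  have 2: "gradient (\<lambda>y. gradient (\<lambda>x. K * G (h x)) y $ j) x $ j
      = 4 * K * c * c * ((x - a) $ j * (x - a) $ j) * G'' (h x) + 2 * K * c * G' (h x)" for j
    unfolding 1 by (subst gradient_nth[OF has_derivative_mult[OF nth GGh']]) (simp add: inner_axis algebra_simps)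
  have "laplacian (\<lambda>x. K * G (h x)) x = (\<Sum>j\<in>UNIV. 4 * K * c * c * ((x - a) $ j * (x - a) $ j) * G'' (h x)) + 2 * K * c * CARD('n) * G' (h x)"
    unfolding laplacian_def 2 sum.distrib by simp
  also have "(\<Sum>j\<in>UNIV. 4 * K * c * c * ((x - a) $ j * (x - a) $ j) * G'' (h x)) = 4 * K * c * h x * G'' (h x)"
    unfolding h_def power2_norm_eq_inner inner_vec_def
    by (simp add: sum_distrib_left sum_distrib_right algebra_simps)
  finally show ?thesis
    by (simp add: algebra_simps)
qed

lemma Ck_bump: "Ck m (\<lambda>x. K * bump P (c * (norm (x - a :: real ^ 'n))\<^sup>2))"
proof (intro Ck_mult Ck_const)
  let ?G = "\<lambda>i. bump ((bump_deriv ^^ i) P)"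
  have deriv: "(?G i has_real_derivative ?G (Suc i) (c * (norm (x - a))\<^sup>2)) (at (c * (norm (x - a))\<^sup>2))" for i x
    using DERIV_bump[of "(bump_deriv ^^ i) P"] by simp
  have cont: "continuous_on UNIV (\<lambda>x. ?G m (c * (norm (x - a))\<^sup>2))"
    by (rule continuous_on_compose2[OF continuous_on_bump Ck_continuous[OF Ck_norm_diff_sq] subset_UNIV])
  show "Ck m (\<lambda>x. bump P (c * (norm (x - a))\<^sup>2))"
    using Ck_compose[of m ?G "\<lambda>x. c * (norm (x - a))\<^sup>2", OF deriv cont Ck_norm_diff_sq]
    by simp
qed

lemma bump_in_test_functions:
  assumes "c > 0"
  shows "(\<lambda>x. K * bump P (c * (norm (x - a :: real ^ 'n))\<^sup>2)) \<in> test_functions"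
proof -
  have "{x. K * bump P (c * (norm (x - a))\<^sup>2) \<noteq> 0} \<subseteq> cball a (1 / sqrt c)"
  proof
    fix x assume "x \<in> {x. K * bump P (c * (norm (x - a))\<^sup>2) \<noteq> 0}"
    then have "bump P (c * (norm (x - a))\<^sup>2) \<noteq> 0"
      by auto
    then have "c * (norm (x - a))\<^sup>2 < 1"
      by (meson bump_eq_0 not_le)
    then have "(norm (x - a))\<^sup>2 \<le> (1 / sqrt c)\<^sup>2"
      using assms by (simp add: power_divide pos_le_divide_eq mult.commute)
    then have "norm (x - a) \<le> 1 / sqrt c"
      by (rule power2_le_imp_le) (use assms in simp)
    then show "x \<in> cball a (1 / sqrt c)"
      by (simp only: mem_cball dist_norm norm_minus_commute[of a x])
  qed
  then have "bounded {x. K * bump P (c * (norm (x - a))\<^sup>2) \<noteq> 0}"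
    by (rule bounded_subset[OF bounded_cball])
  then show ?thesis
    unfolding test_functions_def compact_closure mem_Collect_eq using Ck_bump by blast
qed

lemma laplacian_bump:
  fixes a x :: "real ^ 'n" and c :: real
  defines "t \<equiv> c * (norm (x - a))\<^sup>2"
  shows "laplacian (\<lambda>x. K * bump P (c * (norm (x - a))\<^sup>2)) x
    = K * (2 * c * CARD('n) * bump (bump_deriv P) t + 4 * c * t * bump (bump_deriv (bump_deriv P)) t)"
  unfolding t_def
  by (rule laplacian_radial[where G = "bump P" and G' = "bump (bump_deriv P)"]) (rule DERIV_bump)+

subsection \<open>Locally integrable functions and the weak Laplacian\<close>

lemma integrable_indicator_cball: "integrable lborel (\<lambda>x. indicator (cball (a :: 'a::euclidean_space) r) x :: real)"
  using emeasure_lborel_cball_finite[of a r] by (intro integrable_real_indicator) auto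

text \<open>Borel rather than Lebesgue measurability, so that Fubini and affine substitutions for
  \<open>lborel\<close> apply directly. The solution is replaced by a Borel representative before
  these notions are used on it.\<close>

definition loc_integrable :: "('a::euclidean_space \<Rightarrow> real) \<Rightarrow> bool" where
  "loc_integrable f \<longleftrightarrow> f \<in> borel_measurable borel \<and>
     (\<forall>R. integrable lborel (\<lambda>x. indicator (cball 0 R) x * f x))"

text \<open>The weights against which mollifications converge. They may be discontinuous, because
  the arguments below use subgradients and indicators of level sets as weights.\<close>

definition bounded_support :: "('a::euclidean_space \<Rightarrow> real) \<Rightarrow> bool" where
  "bounded_support q \<longleftrightarrow> q \<in> borel_measurable borel \<and>
     (\<exists>R M. \<forall>x. \<bar>q x\<bar> \<le> M * indicator (cball 0 R) x)"

lemma loc_integrable_measurable [measurable_dest]: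
  "loc_integrable f \<Longrightarrow> f \<in> borel_measurable borel"
  by (simp add: loc_integrable_def)

lemma bounded_support_measurable [measurable_dest]:
  "bounded_support q \<Longrightarrow> q \<in> borel_measurable borel"
  by (simp add: bounded_support_def)

lemma bounded_supportE:
  assumes "bounded_support q"
  obtains R M where "R > 0" "M > 0" "\<And>x. \<bar>q x\<bar> \<le> M * indicator (cball 0 R) x"
proof -
  obtain R M where *: "\<And>x. \<bar>q x\<bar> \<le> M * indicator (cball 0 R) x"
    using assms unfolding bounded_support_def by blast
  have "\<bar>q x\<bar> \<le> (\<bar>M\<bar> + 1) * indicator (cball 0 (\<bar>R\<bar> + 1)) x" for x
  proof (cases "norm x \<le> R")
    case True
    then show ?thesis
      using *[of x] by simp
  next
    case False
    then have "q x = 0"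
      using *[of x] by simp
    then show ?thesis
      by simp
  qed
  then show ?thesis
    by (intro that[of "\<bar>R\<bar> + 1" "\<bar>M\<bar> + 1"]) auto
qed

lemma bounded_supportI:
  assumes "q \<in> borel_measurable borel" "\<And>x. norm x \<le> R \<Longrightarrow> \<bar>q x\<bar> \<le> M" "\<And>x. norm x > R \<Longrightarrow> q x = 0"
  shows "bounded_support q"
proof -
  have "\<bar>q x\<bar> \<le> M * indicator (cball 0 R) x" for x
    using assms(2)[of x] assms(3)[of x] by (cases "norm x \<le> R") (auto simp: indicator_def)
  then show ?thesis
    using assms(1) unfolding bounded_support_def by blast
qed

lemma integrable_supp_mult:
  assumes "bounded_support q" "loc_integrable f"
  shows "integrable lborel (\<lambda>x. q x * f x)"
proof -
  note [measurable] = assms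
  obtain R M where M: "M > 0" "\<And>x. \<bar>q x\<bar> \<le> M * indicator (cball 0 R) x"
    using bounded_supportE[OF assms(1)] by metis
  have "integrable lborel (\<lambda>x. M * (indicator (cball 0 R) x * f x))"
    using assms(2) by (auto simp: loc_integrable_def)
  then show ?thesis
  proof (rule Bochner_Integration.integrable_bound)
    show "AE x in lborel. norm (q x * f x) \<le> norm (M * (indicator (cball 0 R) x * f x))"
      using M by (intro AE_I2) (auto simp: abs_mult mult.assoc[symmetric] intro!: mult_right_mono)
  qed measurable
qed

lemma loc_integrable_bound:
  assumes "loc_integrable g" "f \<in> borel_measurable borel"
    and "\<And>R. \<exists>M. \<forall>x. norm x \<le> R \<longrightarrow> \<bar>f x\<bar> \<le> M * \<bar>g x\<bar>"
  shows "loc_integrable f"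
  unfolding loc_integrable_def
proof (intro conjI allI)
  fix R
  note [measurable] = assms(1,2)
  obtain M where M: "\<And>x. norm x \<le> R \<Longrightarrow> \<bar>f x\<bar> \<le> M * \<bar>g x\<bar>"
    using assms(3) by blast
  have "integrable lborel (\<lambda>x. \<bar>M\<bar> * (indicator (cball 0 R) x * g x))"
    using assms(1) by (auto simp: loc_integrable_def)
  then show "integrable lborel (\<lambda>x. indicator (cball 0 R) x * f x)"
  proof (rule Bochner_Integration.integrable_bound)
    show "(\<lambda>x. indicator (cball 0 R) x * f x) \<in> borel_measurable lborel"
      by (intro borel_measurable_times borel_measurable_indicator) (use assms(2) in auto)
    have "\<bar>f x\<bar> \<le> \<bar>M\<bar> * \<bar>g x\<bar>" if "norm x \<le> R" for x
      using M[OF that] by (meson abs_ge_self abs_ge_zero mult_right_mono order_trans)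
    then show "AE x in lborel. norm (indicator (cball 0 R) x * f x) \<le> norm (\<bar>M\<bar> * (indicator (cball 0 R) x * g x))"
      by (intro AE_I2) (auto simp: abs_mult indicator_def)
  qed
qed (fact assms(2))

lemma loc_integrable_abs: "loc_integrable f \<Longrightarrow> loc_integrable (\<lambda>x. \<bar>f x\<bar>)"
  by (rule loc_integrable_bound) (auto intro!: exI[of _ 1])

lemma continuous_bounded_on_ball:
  fixes f :: "'a::euclidean_space \<Rightarrow> real"
  assumes "continuous_on UNIV f"
  shows "\<exists>M. \<forall>x. norm x \<le> R \<longrightarrow> \<bar>f x\<bar> \<le> M"
proof -
  have "compact (f ` cball 0 R)"
    by (intro compact_continuous_image continuous_on_subset[OF assms]) auto
  from compact_imp_bounded[OF this] show ?thesis
    unfolding bounded_iff by (metis imageI mem_cball_0 real_norm_def)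
qed

lemma loc_integrable_1: "loc_integrable (\<lambda>_. 1 :: real)"
  by (simp add: loc_integrable_def integrable_indicator_cball)

lemma loc_integrable_continuous:
  assumes "continuous_on UNIV f"
  shows "loc_integrable f"
  using continuous_bounded_on_ball[OF assms]
  by (intro loc_integrable_bound[OF loc_integrable_1 borel_measurable_continuous_onI[OF assms]]) auto

lemma loc_integrable_mult:
  assumes "c \<in> borel_measurable borel" "\<And>R. \<exists>M. \<forall>x. norm x \<le> R \<longrightarrow> \<bar>c x\<bar> \<le> M" "loc_integrable f"
  shows "loc_integrable (\<lambda>x. c x * f x)"
proof (rule loc_integrable_bound[OF assms(3)])
  show "(\<lambda>x. c x * f x) \<in> borel_measurable borel"
    using assms(1,3) by measurable
  show "\<exists>M. \<forall>x. norm x \<le> R \<longrightarrow> \<bar>c x * f x\<bar> \<le> M * \<bar>f x\<bar>" for R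
    using assms(2)[of R] by (metis abs_ge_zero abs_mult mult_right_mono)
qed

lemma loc_integrable_continuous_mult:
  "continuous_on UNIV c \<Longrightarrow> loc_integrable f \<Longrightarrow> loc_integrable (\<lambda>x. c x * f x)"
  by (intro loc_integrable_mult borel_measurable_continuous_onI continuous_bounded_on_ball)

lemma loc_integrable_add:
  "loc_integrable f \<Longrightarrow> loc_integrable g \<Longrightarrow> loc_integrable (\<lambda>x. f x + g x)"
  unfolding loc_integrable_def by (auto simp: distrib_left)

lemma loc_integrable_cmult: "loc_integrable f \<Longrightarrow> loc_integrable (\<lambda>x. c * f x)"
  by (rule loc_integrable_continuous_mult) auto

lemma loc_integrable_sum:
  "(\<And>i. i \<in> I \<Longrightarrow> loc_integrable (f i)) \<Longrightarrow> loc_integrable (\<lambda>x. \<Sum>i\<in>I. f i x)"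
  by (induction I rule: infinite_finite_induct)
    (simp_all add: loc_integrable_add loc_integrable_continuous)

lemma integrable_loc_integrable:
  assumes "integrable lborel f"
  shows "loc_integrable f"
  unfolding loc_integrable_def
  using assms by (auto intro!: integrable_real_mult_indicator simp: mult.commute)

lemma bounded_support_continuous:
  assumes "continuous_on UNIV f" "\<And>x. norm x > R \<Longrightarrow> f x = 0"
  shows "bounded_support f"
  using continuous_bounded_on_ball[OF assms(1), of R] assms(2)
  by (metis bounded_supportI borel_measurable_continuous_onI[OF assms(1)])

lemma bounded_support_mult:
  assumes "c \<in> borel_measurable borel" "\<And>x. \<bar>c x\<bar> \<le> K" "bounded_support q"
  shows "bounded_support (\<lambda>x. c x * q x)"
proof -
  note [measurable] = assms(1,3)
  obtain R M where M: "M > 0" "\<And>x. \<bar>q x\<bar> \<le> M * indicator (cball 0 R) x"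
    using bounded_supportE[OF assms(3)] by metis
  have "\<bar>c x * q x\<bar> \<le> (K * M) * indicator (cball 0 R) x" for x
    using mult_mono[OF assms(2)[of x] M(2)[of x]] assms(2)[of x] by (auto simp: abs_mult mult.assoc)
  moreover have "(\<lambda>x. c x * q x) \<in> borel_measurable borel"
    by measurable
  ultimately show ?thesis
    unfolding bounded_support_def by blast
qed

lemma gradient_eq_0:
  assumes "open S" "x \<in> S" "\<And>y. y \<in> S \<Longrightarrow> f y = 0"
  shows "gradient f x $ j = 0"
proof -
  have "((\<lambda>_. 0) has_derivative (\<lambda>_. 0)) (at x)"
    by simp
  moreover have "eventually (\<lambda>y. y \<in> S) (at x)"
    using assms by (intro eventually_at_in_open') auto
  then have "eventually (\<lambda>y. 0 = f y) (at x)"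
    by eventually_elim (simp add: assms)
  ultimately have "(f has_derivative (\<lambda>_. 0)) (at x)"
    by (rule has_derivative_transform_eventually) (simp_all add: assms)
  then show ?thesis
    by (simp add: gradient_nth)
qed

lemma test_functionsD:
  assumes "\<phi> \<in> test_functions"
  shows "Ck m \<phi>" "continuous_on UNIV \<phi>" "(\<lambda>x. gradient \<phi> x $ j) \<in> test_functions"
    "bounded_support \<phi>" "\<exists>R. \<forall>x. norm x > R \<longrightarrow> \<phi> x = 0"
proof -
  define S where "S = closure {x. \<phi> x \<noteq> 0}"
  have Ck: "Ck m \<phi>" for m
    using assms by (auto simp: test_functions_def)
  have S: "compact S"
    using assms by (auto simp: test_functions_def S_def)
  show "Ck m \<phi>" "continuous_on UNIV \<phi>"
    using Ck Ck_continuous by blast+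
  obtain R where R: "\<And>x. x \<in> S \<Longrightarrow> norm x \<le> R"
    using compact_imp_bounded[OF S] by (auto simp: bounded_iff)
  have 0: "\<phi> x = 0" if "x \<notin> S" for x
    using that closure_subset[of "{x. \<phi> x \<noteq> 0}"] by (auto simp: S_def)
  show "\<exists>R. \<forall>x. norm x > R \<longrightarrow> \<phi> x = 0"
    using 0 R by (meson not_le)
  then show "bounded_support \<phi>"
    using bounded_support_continuous[OF \<open>continuous_on UNIV \<phi>\<close>] by blast
  have "gradient \<phi> x $ j = 0" if "x \<notin> S" for x
    using that compact_imp_closed[OF S] 0 by (intro gradient_eq_0[of "- S"]) auto
  then have "closure {x. gradient \<phi> x $ j \<noteq> 0} \<subseteq> S"
    using compact_imp_closed[OF S] by (intro closure_minimal) auto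
  then have "compact (closure {x. gradient \<phi> x $ j \<noteq> 0})"
    using S by (metis closed_closure compact_Int_closed inf.absorb_iff2)
  moreover have "Ck m (\<lambda>x. gradient \<phi> x $ j)" for m
    using Ck[of "Suc m"] by simp
  ultimately show "(\<lambda>x. gradient \<phi> x $ j) \<in> test_functions"
    by (simp add: test_functions_def)
qed

lemma continuous_laplacian: "Ck 2 f \<Longrightarrow> continuous_on UNIV (laplacian f)"
  unfolding laplacian_def[abs_def] by (auto simp: numeral_2_eq_2 intro!: continuous_on_sum)

lemma bounded_support_laplacian:
  assumes "\<phi> \<in> test_functions"
  shows "bounded_support (laplacian \<phi>)"
proof -
  have *: "\<exists>R. \<forall>x. norm x > R \<longrightarrow> gradient (\<lambda>y. gradient \<phi> y $ j) x $ j = 0" for j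
    using assms by (intro test_functionsD)
  then obtain R where "\<And>j x. norm x > R j \<Longrightarrow> gradient (\<lambda>y. gradient \<phi> y $ j) x $ j = 0"
    by metis
  then have "laplacian \<phi> x = 0" if "norm x > Max (range R)" for x
    using that by (auto simp: laplacian_def intro!: sum.neutral)
  then show ?thesis
    using bounded_support_continuous[OF continuous_laplacian[OF test_functionsD(1)[OF assms]]] by blast
qed

section \<open>Differentiation under the integral sign and integration by parts\<close>

lemma has_real_derivative_integral:
  fixes k :: "real \<Rightarrow> 'a \<Rightarrow> real"
  assumes s0: "a < s0" "s0 < b"
    and int: "\<And>s. a < s \<Longrightarrow> s < b \<Longrightarrow> integrable M (k s)"
    and deriv: "\<And>s x. a < s \<Longrightarrow> s < b \<Longrightarrow> ((\<lambda>s. k s x) has_real_derivative k' s x) (at s)"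
    and bound: "\<And>s x. a < s \<Longrightarrow> s < b \<Longrightarrow> \<bar>k' s x\<bar> \<le> w x"
    and w: "integrable M w" and meas: "k' s0 \<in> borel_measurable M"
  shows "((\<lambda>s. integral\<^sup>L M (k s)) has_real_derivative integral\<^sup>L M (k' s0)) (at s0)"
proof -
  have at: "at s0 = at s0 within {a<..<b}"
    using s0 at_within_open[of s0 "{a<..<b}"] by simp
  show ?thesis
    unfolding has_field_derivative_iff unfolding at tendsto_at_iff_sequentially
  proof (intro allI impI)
    fix X assume X: "\<forall>i. X i \<in> {a<..<b} - {s0}" "X \<longlonglongrightarrow> s0"
    have "(\<lambda>i. LINT x|M. (k (X i) x - k s0 x) / (X i - s0)) \<longlonglongrightarrow> integral\<^sup>L M (k' s0)"
    proof (rule integral_dominated_convergence[OF meas _ w])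
      show "(\<lambda>x. (k (X i) x - k s0 x) / (X i - s0)) \<in> borel_measurable M" for i
        using int[of "X i"] int[of s0] X(1) s0 by (intro borel_measurable_divide borel_measurable_diff) auto
      have "(\<lambda>i. (k (X i) x - k s0 x) / (X i - s0)) \<longlonglongrightarrow> k' s0 x" for x
        using deriv[OF s0, of x, unfolded has_field_derivative_iff, unfolded at tendsto_at_iff_sequentially] X
        by (simp add: o_def)
      then show "AE x in M. (\<lambda>i. (k (X i) x - k s0 x) / (X i - s0)) \<longlonglongrightarrow> k' s0 x"
        by simp
      show "AE x in M. norm ((k (X i) x - k s0 x) / (X i - s0)) \<le> w x" for i
      proof (intro AE_I2)
        fix x
        have "norm (k (X i) x - k s0 x) \<le> w x * norm (X i - s0)"
          using X(1) s0 deriv bound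
          by (intro field_differentiable_bound[of "{a<..<b}" "\<lambda>s. k s x" "\<lambda>s. k' s x"])
            (auto intro: has_field_derivative_at_within)
        moreover have "X i - s0 \<noteq> 0"
          using X(1) by auto
        ultimately show "norm ((k (X i) x - k s0 x) / (X i - s0)) \<le> w x"
          by (simp add: divide_le_eq)
      qed
    qed
    moreover have "(LINT x|M. (k (X i) x - k s0 x) / (X i - s0)) = (integral\<^sup>L M (k (X i)) - integral\<^sup>L M (k s0)) / (X i - s0)" for i
      using int[of "X i"] int[of s0] X(1) s0
      by (simp only: integral_divide_zero) (subst Bochner_Integration.integral_diff, auto)
    ultimately show "((\<lambda>s. (integral\<^sup>L M (k s) - integral\<^sup>L M (k s0)) / (s - s0)) \<circ> X) \<longlonglongrightarrow> integral\<^sup>L M (k' s0)"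
      by (simp only: o_def)
  qed
qed

lemma lborel_integral_translate:
  fixes f :: "'a::euclidean_space \<Rightarrow> real"
  assumes [measurable]: "f \<in> borel_measurable borel"
  shows "(LBINT x. f (c + x)) = (LBINT x. f x)"
proof -
  have "(LBINT x. f x) = (LINT x|distr lborel borel ((+) c). f x)"
    by (simp add: lborel_distr_plus)
  also have "\<dots> = (LBINT x. f (c + x))"
    by (rule integral_distr) auto
  finally show ?thesis ..
qed

lemma lborel_integrable_translate:
  fixes f :: "'a::euclidean_space \<Rightarrow> real"
  assumes "integrable lborel f"
  shows "integrable lborel (\<lambda>x. f (c + x))"
proof -
  have "integrable (distr lborel borel ((+) c)) f"
    using assms by (simp add: lborel_distr_plus)
  then show ?thesis
    by (subst (asm) integrable_distr_eq) (use assms in auto)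
qed

text \<open>The integral of f(s e_j + x) over x does not depend on s by translation invariance,
  while its derivative at s = 0 is the integral of the j-th partial derivative.\<close>

lemma integral_gradient_eq_0:
  fixes f :: "real ^ 'n \<Rightarrow> real"
  assumes "Ck 1 f" "\<And>x. norm x > R \<Longrightarrow> f x = 0"
  shows "(LBINT x. gradient f x $ j) = 0"
proof -
  let ?e = "axis j 1 :: real ^ 'n"
  have d: "((\<lambda>s. f (s *\<^sub>R ?e + x)) has_real_derivative gradient f (s *\<^sub>R ?e + x) $ j) (at s)" for s x
  proof -
    have "((\<lambda>s. s *\<^sub>R ?e + x) has_derivative (\<lambda>h. h *\<^sub>R ?e)) (at s)"
      by (auto intro!: derivative_eq_intros)
    from has_derivative_compose[OF this Ck_Suc_has_derivative[of 0 f]] assms(1)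
    have "((\<lambda>s. f (s *\<^sub>R ?e + x)) has_derivative (\<lambda>h. frechet_derivative f (at (s *\<^sub>R ?e + x)) (h *\<^sub>R ?e))) (at s)"
      by simp
    moreover have "linear (frechet_derivative f (at y))" for y
      using assms(1) by (simp add: linear_frechet_derivative)
    ultimately show ?thesis
      by (simp add: has_field_derivative_def gradient_def linear_cmul mult_commute_abs)
  qed
  have cont: "continuous_on UNIV (\<lambda>x. gradient f x $ j)"
    using assms(1) by simp
  have [measurable]: "f \<in> borel_measurable borel" "(\<lambda>x. gradient f x $ j) \<in> borel_measurable borel"
    using borel_measurable_continuous_onI[OF cont] borel_measurable_continuous_onI[OF Ck_continuous[OF assms(1)]] by auto
  have 0: "gradient f x $ j = 0" if "norm x > R" for x
    using that assms(2) by (intro gradient_eq_0[of "- cball 0 R"]) auto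
  obtain M where M: "\<And>x. norm x \<le> R \<Longrightarrow> \<bar>gradient f x $ j\<bar> \<le> M"
    using continuous_bounded_on_ball[OF cont] by blast
  have "((\<lambda>s. LBINT x. f (s *\<^sub>R ?e + x)) has_real_derivative (LBINT x. gradient f (0 *\<^sub>R ?e + x) $ j)) (at 0)"
  proof (rule has_real_derivative_integral[of "-1" _ 1])
    have "bounded_support f"
      using bounded_support_continuous[OF Ck_continuous[OF assms(1)] assms(2)] by blast
    from integrable_supp_mult[OF this loc_integrable_1]
    have "integrable lborel f"
      by simp
    then show "integrable lborel (\<lambda>x. f (s *\<^sub>R ?e + x))" for s
      by (rule lborel_integrable_translate)
    show "integrable lborel (\<lambda>x. \<bar>M\<bar> * indicator (cball 0 (R + 1) :: (real ^ 'n) set) x)"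
      by (simp add: integrable_indicator_cball)
    \<comment> \<open>Shifts by less than 1 keep the support inside the ball of radius R + 1, which
      gives a dominating function independent of s.\<close>
    show "\<bar>gradient f (s *\<^sub>R ?e + x) $ j\<bar> \<le> \<bar>M\<bar> * indicator (cball 0 (R + 1)) x" if "-1 < s" "s < 1" for s x
    proof (cases "norm (s *\<^sub>R ?e + x) \<le> R")
      case True
      have "norm x \<le> norm (s *\<^sub>R ?e + x) + norm (s *\<^sub>R ?e)"
        using norm_triangle_ineq4[of "s *\<^sub>R ?e + x" "s *\<^sub>R ?e"] by simp
      with True that have "norm x \<le> R + 1"
        by (simp add: norm_axis_1)
      then show ?thesis
        using M[OF True] by (simp add: indicator_def)
    qed (simp add: 0 indicator_def)
  qed (auto intro: d)
  moreover have "(LBINT x. f (s *\<^sub>R ?e + x)) = (LBINT x. f x)" for s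
    by (rule lborel_integral_translate) measurable
  ultimately have "((\<lambda>s::real. LBINT x. f x) has_real_derivative (LBINT x. gradient f x $ j)) (at 0)"
    by simp
  then show ?thesis
    using DERIV_unique[OF _ DERIV_const] by blast
qed

lemma integral_gradient_by_parts:
  fixes f :: "real ^ 'n \<Rightarrow> real"
  assumes f: "Ck 1 f" and \<phi>: "\<phi> \<in> test_functions"
  shows "(LBINT x. gradient f x $ j * \<phi> x) = - (LBINT x. f x * gradient \<phi> x $ j)"
proof -
  obtain R where R: "\<And>x. norm x > R \<Longrightarrow> \<phi> x = 0"
    using test_functionsD(5)[OF \<phi>] by blast
  have Ck: "Ck 1 \<phi>"
    using test_functionsD(1)[OF \<phi>] .
  have "gradient (\<lambda>x. f x * \<phi> x) x $ j = f x * gradient \<phi> x $ j + gradient f x $ j * \<phi> x" for x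
    using gradient_nth[OF has_derivative_mult[OF Ck_Suc_has_derivative[of 0 f] Ck_Suc_has_derivative[of 0 \<phi>]], of x j] f Ck
    by (simp add: gradient_def)
  then have "0 = (LBINT x. f x * gradient \<phi> x $ j + gradient f x $ j * \<phi> x)"
    using integral_gradient_eq_0[OF Ck_mult[OF f Ck], of R j] R by simp
  also have "\<dots> = (LBINT x. f x * gradient \<phi> x $ j) + (LBINT x. gradient f x $ j * \<phi> x)"
  proof (rule Bochner_Integration.integral_add)
    show "integrable lborel (\<lambda>x. f x * gradient \<phi> x $ j)"
      using integrable_supp_mult[OF test_functionsD(4)[OF test_functionsD(3)[OF \<phi>, of j]]
          loc_integrable_continuous[OF Ck_continuous[OF f]]] by (simp add: mult.commute)
    show "integrable lborel (\<lambda>x. gradient f x $ j * \<phi> x)"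
      using integrable_supp_mult[OF test_functionsD(4)[OF \<phi>]
          loc_integrable_continuous[of "\<lambda>x. gradient f x $ j"]] f by (simp add: mult.commute)
  qed
  finally show ?thesis
    by simp
qed

definition weak_laplacian :: "(real ^ 'n \<Rightarrow> real) \<Rightarrow> (real ^ 'n \<Rightarrow> real) \<Rightarrow> bool" where
  "weak_laplacian v f \<longleftrightarrow> loc_integrable v \<and> loc_integrable f \<and>
     (\<forall>\<phi>\<in>test_functions. (LBINT x. laplacian \<phi> x * v x) = (LBINT x. \<phi> x * f x))"

definition weak_laplacian_ge :: "(real ^ 'n \<Rightarrow> real) \<Rightarrow> (real ^ 'n \<Rightarrow> real) \<Rightarrow> bool" where
  "weak_laplacian_ge v f \<longleftrightarrow> loc_integrable v \<and> loc_integrable f \<and>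
     (\<forall>\<phi>\<in>test_functions. (\<forall>x. \<phi> x \<ge> 0) \<longrightarrow>
        (LBINT x. laplacian \<phi> x * v x) \<ge> (LBINT x. \<phi> x * f x))"

text \<open>Needed twice: for the barriers, and for the test functions themselves, where it moves
  the Laplacian from a mollifier to the test function.\<close>

lemma weak_laplacian_classical:
  fixes f :: "real ^ 'n \<Rightarrow> real"
  assumes "Ck 2 f"
  shows "weak_laplacian f (laplacian f)"
  unfolding weak_laplacian_def
proof (intro conjI ballI)
  show "loc_integrable f" "loc_integrable (laplacian f)"
    by (intro loc_integrable_continuous Ck_continuous[OF assms] continuous_laplacian[OF assms])+
  fix \<phi> :: "real ^ 'n \<Rightarrow> real" assume \<phi>: "\<phi> \<in> test_functions"
  have f1: "Ck 1 f" and f2: "Ck 1 (\<lambda>x. gradient f x $ j)" for j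
    using assms Ck_le[of 1 2 f] by (auto simp: numeral_2_eq_2)
  have \<phi>1: "(\<lambda>x. gradient \<phi> x $ j) \<in> test_functions" for j
    using \<phi> by (rule test_functionsD)
  have "(LBINT x. laplacian \<phi> x * f x)
      = (\<Sum>j\<in>UNIV. LBINT x. f x * gradient (\<lambda>y. gradient \<phi> y $ j) x $ j)"
    unfolding laplacian_def sum_distrib_right
    using integrable_supp_mult[OF test_functionsD(4)[OF test_functionsD(3)[OF \<phi>1]] loc_integrable_continuous[OF Ck_continuous[OF assms]]]
    by (subst Bochner_Integration.integral_sum) (auto simp: mult.commute)
  also have "\<dots> = (\<Sum>j\<in>UNIV. LBINT x. gradient (\<lambda>y. gradient f y $ j) x $ j * \<phi> x)"
    using integral_gradient_by_parts[OF f1 \<phi>1] integral_gradient_by_parts[OF f2 \<phi>] by simp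
  also have "\<dots> = (LBINT x. \<phi> x * laplacian f x)"
    unfolding laplacian_def sum_distrib_left
    using integrable_supp_mult[OF test_functionsD(4)[OF \<phi>] loc_integrable_continuous[OF Ck_continuous[of 0 "\<lambda>x. gradient (\<lambda>y. gradient f y $ j) x $ j" for j]]] f2
    by (subst Bochner_Integration.integral_sum) (auto simp: mult.commute)
  finally show "(LBINT x. laplacian \<phi> x * f x) = (LBINT x. \<phi> x * laplacian f x)" .
qed

lemma weak_laplacian_linear:
  assumes "weak_laplacian v f" "weak_laplacian w g"
  shows "weak_laplacian (\<lambda>x. a * v x + b * w x) (\<lambda>x. a * f x + b * g x)"
  unfolding weak_laplacian_def
proof (intro conjI ballI)
  have li: "loc_integrable v" "loc_integrable f" "loc_integrable w" "loc_integrable g"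
    using assms by (auto simp: weak_laplacian_def)
  then show "loc_integrable (\<lambda>x. a * v x + b * w x)" "loc_integrable (\<lambda>x. a * f x + b * g x)"
    by (auto intro!: loc_integrable_add loc_integrable_cmult)
  fix \<phi> :: "real ^ 'a \<Rightarrow> real" assume \<phi>: "\<phi> \<in> test_functions"
  have "(LBINT x. laplacian \<phi> x * (a * v x + b * w x)) = a * (LBINT x. laplacian \<phi> x * v x) + b * (LBINT x. laplacian \<phi> x * w x)"
    using integrable_supp_mult[OF bounded_support_laplacian[OF \<phi>] li(1)]
      integrable_supp_mult[OF bounded_support_laplacian[OF \<phi>] li(3)]
    by (simp add: distrib_left mult.left_commute)
  also have "\<dots> = a * (LBINT x. \<phi> x * f x) + b * (LBINT x. \<phi> x * g x)"
    using assms \<phi> by (simp add: weak_laplacian_def)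
  also have "\<dots> = (LBINT x. \<phi> x * (a * f x + b * g x))"
    using integrable_supp_mult[OF test_functionsD(4)[OF \<phi>] li(2)]
      integrable_supp_mult[OF test_functionsD(4)[OF \<phi>] li(4)]
    by (simp add: distrib_left mult.left_commute)
  finally show "(LBINT x. laplacian \<phi> x * (a * v x + b * w x)) = (LBINT x. \<phi> x * (a * f x + b * g x))" .
qed

subsection \<open>Mollification at variable scale\<close>

lemma translation_L1_approximate:
  fixes f :: "'a::euclidean_space \<Rightarrow> real"
  assumes f: "integrable lborel f"
    and approx: "\<And>e. e > 0 \<Longrightarrow> \<exists>g. integrable lborel g \<and> (LBINT x. \<bar>f x - g x\<bar>) < e \<and>
        ((\<lambda>h. LBINT x. \<bar>g (h + x) - g x\<bar>) \<longlongrightarrow> 0) (at 0)"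
  shows "((\<lambda>h. LBINT x. \<bar>f (h + x) - f x\<bar>) \<longlongrightarrow> 0) (at 0)"
proof (rule tendstoI)
  fix e :: real assume "e > 0"
  then obtain g where g: "integrable lborel g" "(LBINT x. \<bar>f x - g x\<bar>) < e / 3"
    and lim: "((\<lambda>h. LBINT x. \<bar>g (h + x) - g x\<bar>) \<longlongrightarrow> 0) (at 0)"
    using approx[of "e / 3"] by auto
  have "eventually (\<lambda>h. dist (LBINT x. \<bar>g (h + x) - g x\<bar>) 0 < e / 3) (at 0)"
    using \<open>e > 0\<close> by (intro tendstoD[OF lim]) auto
  then show "eventually (\<lambda>h. dist (LBINT x. \<bar>f (h + x) - f x\<bar>) 0 < e) (at 0)"
  proof eventually_elim
    fix h assume h: "dist (LBINT x. \<bar>g (h + x) - g x\<bar>) 0 < e / 3"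
    have fg: "integrable lborel (\<lambda>x. \<bar>f x - g x\<bar>)"
      using f g by auto
    have [simp]: "integrable lborel (\<lambda>x. f (h + x))" "integrable lborel (\<lambda>x. g (h + x))"
      by (rule lborel_integrable_translate, fact)+
    have [measurable]: "f \<in> borel_measurable borel" "g \<in> borel_measurable borel"
      using f g by auto
    have "(LBINT x. \<bar>f (h + x) - f x\<bar>) \<le>
        (LBINT x. \<bar>f (h + x) - g (h + x)\<bar> + \<bar>g (h + x) - g x\<bar> + \<bar>f x - g x\<bar>)"
      using f g by (intro integral_mono) auto
    also have "\<dots> = (LBINT x. \<bar>f (h + x) - g (h + x)\<bar>) + (LBINT x. \<bar>g (h + x) - g x\<bar>)
        + (LBINT x. \<bar>f x - g x\<bar>)"
      using f g by simp
    also have "(LBINT x. \<bar>f (h + x) - g (h + x)\<bar>) = (LBINT x. \<bar>f x - g x\<bar>)"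
      by (rule lborel_integral_translate[of "\<lambda>x. \<bar>f x - g x\<bar>"]) measurable
    finally have "(LBINT x. \<bar>f (h + x) - f x\<bar>) < e"
      using g h by auto
    then show "dist (LBINT x. \<bar>f (h + x) - f x\<bar>) 0 < e"
      by simp
  qed
qed

text \<open>For open U dominated convergence applies: the part of U lost by a small shift tends to 0
  pointwise and is dominated by the indicator of U. The part gained has no common dominating
  function, but it has the same integral as the part lost by translation invariance, whence the
  factor 2 in \<open>eq\<close>.\<close>

lemma translation_L1_open:
  fixes U :: "'a::euclidean_space set"
  assumes "open U" "emeasure lborel U < \<infinity>"
  shows "((\<lambda>h. LBINT x. \<bar>indicator U (h + x) - indicator U x\<bar>) \<longlongrightarrow> (0::real)) (at 0)"
  unfolding tendsto_at_iff_sequentially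
proof (intro allI impI)
  fix X :: "nat \<Rightarrow> 'a" assume X: "X \<longlonglongrightarrow> 0"
  have [measurable]: "U \<in> sets borel"
    using assms by auto
  have int: "integrable lborel (indicator U :: 'a \<Rightarrow> real)"
    using assms by (intro integrable_real_indicator) auto
  have int': "integrable lborel (\<lambda>x. indicator U (h + x) :: real)" for h
    by (rule lborel_integrable_translate[OF int])
  have eq: "(LBINT x. \<bar>indicator U (h + x) - indicator U x\<bar>)
      = 2 * (LBINT x. max (indicator U x - indicator U (h + x)) (0::real))" for h
  proof -
    have "(LBINT x. \<bar>indicator U (h + x) - indicator U x :: real\<bar>)
        = (LBINT x. 2 * max (indicator U x - indicator U (h + x)) 0 + (indicator U (h + x) - indicator U x))"
      by (intro Bochner_Integration.integral_cong) (auto simp: indicator_def)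
    also have "\<dots> = 2 * (LBINT x. max (indicator U x - indicator U (h + x)) 0)
        + ((LBINT x. indicator U (h + x)) - (LBINT x. indicator U x))"
      using int int' by (simp add: Bochner_Integration.integrable_diff)
    also have "(LBINT x. indicator U (h + x) :: real) = (LBINT x. indicator U x)"
      by (rule lborel_integral_translate) measurable
    finally show ?thesis
      by simp
  qed
  have "(\<lambda>n. LBINT x. max (indicator U x - indicator U (X n + x)) (0::real)) \<longlonglongrightarrow> (LINT x|(lborel :: 'a measure). 0)"
  proof (rule integral_dominated_convergence[OF _ _ int])
    show "AE x in lborel. (\<lambda>n. max (indicator U x - indicator U (X n + x)) (0::real)) \<longlonglongrightarrow> 0"
    proof (intro AE_I2)
      fix x
      show "(\<lambda>n. max (indicator U x - indicator U (X n + x)) (0::real)) \<longlonglongrightarrow> 0"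
      proof (cases "x \<in> U")
        case True
        have "(\<lambda>n. X n + x) \<longlonglongrightarrow> 0 + x"
          using X by (intro tendsto_intros)
        then have "eventually (\<lambda>n. X n + x \<in> U) sequentially"
          using assms True by (auto dest: topological_tendstoD)
        then have "eventually (\<lambda>n. 0 = max (indicator U x - indicator U (X n + x)) (0::real)) sequentially"
          by eventually_elim (auto simp: indicator_def)
        then show ?thesis
          by (rule Lim_transform_eventually[OF tendsto_const])
      qed (auto simp: indicator_def)
    qed
    show "AE x in lborel. norm (max (indicator U x - indicator U (X n + x)) (0::real)) \<le> indicator U x" for n
      by (intro AE_I2) (auto simp: indicator_def)
  qed measurable
  then show "((\<lambda>h. LBINT x. \<bar>indicator U (h + x) - indicator U x :: real\<bar>) \<circ> X) \<longlonglongrightarrow> 0"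
    unfolding o_def eq by (auto intro: tendsto_mult_right_zero)
qed

text \<open>Outer regularity reduces measurable sets of finite measure to open ones. The remaining
  induction steps are linearity and approximation in L^1.\<close>

lemma translation_L1_continuous:
  fixes f :: "'a::euclidean_space \<Rightarrow> real"
  assumes "integrable lborel f"
  shows "((\<lambda>h. LBINT x. \<bar>f (h + x) - f x\<bar>) \<longlongrightarrow> 0) (at 0)"
  using assms
proof (induction f rule: integrable_induct)
  case (base A c)
  have [measurable]: "A \<in> sets borel"
    using base by simp
  have intA: "integrable lborel (indicator A :: 'a \<Rightarrow> real)"
    using base by (intro integrable_real_indicator) auto
  have "((\<lambda>h. LBINT x. \<bar>indicator A (h + x) - indicator A x :: real\<bar>) \<longlongrightarrow> 0) (at 0)"
  proof (rule translation_L1_approximate[OF intA])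
    fix e :: real assume "e > 0"
    obtain U where U: "open U" "A \<subseteq> U" "emeasure lborel (U - A) < e"
      using outer_regular_lborel[of A e] \<open>e > 0\<close> by auto
    have [measurable]: "U \<in> sets borel"
      using U by auto
    have "emeasure lborel U = emeasure lborel A + emeasure lborel (U - A)"
      using U by (subst plus_emeasure) (auto simp: Un_absorb1)
    also have "\<dots> < \<infinity>"
      using base U by (simp add: less_top[symmetric]) (metis ennreal_less_top infinity_ennreal_def order_less_trans not_less_iff_gr_or_eq)
    finally have fin: "emeasure lborel U < \<infinity>" .
    have "(LBINT x. \<bar>indicator A x - indicator U x :: real\<bar>) = (LBINT x. indicator (U - A) x)"
      using U by (intro Bochner_Integration.integral_cong) (auto simp: indicator_def)
    also have "\<dots> = measure lborel (U - A)"
      by simp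
    also have "\<dots> < e"
      using U(3) by (metis Sigma_Algebra.measure_def enn2real_less_iff \<open>e > 0\<close> ennreal_enn2real ennreal_less_top order_less_trans enn2real_nonneg ennreal_less_iff)
    finally show "\<exists>g. integrable lborel g \<and> (LBINT x. \<bar>indicator A x - g x\<bar>) < e \<and>
        ((\<lambda>h. LBINT x. \<bar>g (h + x) - g x\<bar>) \<longlongrightarrow> 0) (at 0)"
      using translation_L1_open[OF U(1) fin] fin
      by (intro exI[of _ "indicator U"]) (auto intro!: integrable_real_indicator)
  qed
  then have "((\<lambda>h. \<bar>c\<bar> * (LBINT x. \<bar>indicator A (h + x) - indicator A x :: real\<bar>)) \<longlongrightarrow> 0) (at 0)"
    by (rule tendsto_mult_right_zero)
  moreover have "(LBINT x. \<bar>indicator A (h + x) *\<^sub>R c - indicator A x *\<^sub>R c\<bar>)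
      = \<bar>c\<bar> * (LBINT x. \<bar>indicator A (h + x) - indicator A x :: real\<bar>)" for h
    by (simp add: left_diff_distrib[symmetric] abs_mult mult.commute[of _ "\<bar>c\<bar>"])
  ultimately show ?case
    by simp
next
  case (add f g)
  have "((\<lambda>h. (LBINT x. \<bar>f (h + x) - f x\<bar>) + (LBINT x. \<bar>g (h + x) - g x\<bar>)) \<longlongrightarrow> 0) (at 0)"
    using add by (auto intro: tendsto_add_zero)
  then show ?case
  proof (rule Lim_null_comparison[rotated], intro always_eventually allI)
    fix h
    have "integrable lborel (\<lambda>x. f (h + x))" "integrable lborel (\<lambda>x. g (h + x))"
      by (rule lborel_integrable_translate, fact)+
    then have fg: "integrable lborel (\<lambda>x. \<bar>f (h + x) - f x\<bar>)" "integrable lborel (\<lambda>x. \<bar>g (h + x) - g x\<bar>)"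
      "integrable lborel (\<lambda>x. \<bar>f (h + x) + g (h + x) - (f x + g x)\<bar>)"
      using add by auto
    have "(LBINT x. \<bar>f (h + x) + g (h + x) - (f x + g x)\<bar>) \<le> (LBINT x. \<bar>f (h + x) - f x\<bar> + \<bar>g (h + x) - g x\<bar>)"
      using fg by (intro integral_mono) auto
    with fg show "norm (LBINT x. \<bar>f (h + x) + g (h + x) - (f x + g x)\<bar>)
        \<le> (LBINT x. \<bar>f (h + x) - f x\<bar>) + (LBINT x. \<bar>g (h + x) - g x\<bar>)"
      by simp
  qed
next
  case (lim f s)
  show ?case
  proof (rule translation_L1_approximate[OF \<open>integrable lborel f\<close>])
    fix e :: real assume "e > 0"
    have "(\<lambda>i. LBINT x. \<bar>f x - s i x\<bar>) \<longlonglongrightarrow> (LINT x|(lborel :: 'a measure). 0)"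
    proof (rule integral_dominated_convergence)
      show "integrable lborel (\<lambda>x. 3 * norm (f x))"
        using lim by auto
      show "AE x in lborel. (\<lambda>i. \<bar>f x - s i x\<bar>) \<longlonglongrightarrow> 0"
      proof (intro AE_I2)
        fix x
        have "(\<lambda>i. \<bar>f x - s i x\<bar>) \<longlonglongrightarrow> \<bar>f x - f x\<bar>"
          using lim(2)[of x] by (intro tendsto_intros) auto
        then show "(\<lambda>i. \<bar>f x - s i x\<bar>) \<longlonglongrightarrow> 0"
          by simp
      qed
      show "AE x in lborel. norm \<bar>f x - s i x\<bar> \<le> 3 * norm (f x)" for i
      proof (intro AE_I2)
        fix x
        show "norm \<bar>f x - s i x\<bar> \<le> 3 * norm (f x)"
          using lim(3)[of x i] by simp
      qed
      show "(\<lambda>x. \<bar>f x - s i x\<bar>) \<in> borel_measurable lborel" for i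
        using lim(1)[of i] lim(4) by auto
    qed simp
    then have "eventually (\<lambda>i. (LBINT x. \<bar>f x - s i x\<bar>) < e) sequentially"
      using \<open>e > 0\<close> by (auto dest: order_tendstoD)
    then obtain i where "(LBINT x. \<bar>f x - s i x\<bar>) < e"
      by (auto simp: eventually_sequentially)
    then show "\<exists>g. integrable lborel g \<and> (LBINT x. \<bar>f x - g x\<bar>) < e \<and>
        ((\<lambda>h. LBINT x. \<bar>g (h + x) - g x\<bar>) \<longlongrightarrow> 0) (at 0)"
      using lim by blast
  qed
qed

section \<open>Integral operators with bounded kernels of finite range\<close>

definition local_kernel :: "('a::euclidean_space \<Rightarrow> 'a \<Rightarrow> real) \<Rightarrow> real \<Rightarrow> real \<Rightarrow> bool" where
  "local_kernel K C s \<longleftrightarrow> case_prod K \<in> borel_measurable (borel \<Otimes>\<^sub>M borel) \<and> s \<ge> 0 \<and> C \<ge> 0 \<and>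
     (\<forall>x z. \<bar>K x z\<bar> \<le> C) \<and> (\<forall>x z. norm (z - x) > s \<longrightarrow> K x z = 0)"

lemma local_kernel_bounded_support:
  assumes K: "local_kernel K C s"
  shows "bounded_support (K x)" "bounded_support (\<lambda>z. K z x)"
proof -
  have [measurable]: "case_prod K \<in> borel_measurable (borel \<Otimes>\<^sub>M borel)"
    using K by (auto simp: local_kernel_def)
  have "K x \<in> borel_measurable borel" "(\<lambda>z. K z x) \<in> borel_measurable borel"
    by measurable
  moreover have "norm (z - x) > s" "norm (x - z) > s" if "norm z > norm x + s" for z
    using norm_triangle_ineq2[of z x] norm_triangle_ineq2[of z x] that by (auto simp: norm_minus_commute)
  ultimately show "bounded_support (K x)" "bounded_support (\<lambda>z. K z x)"
    using K by (auto intro!: bounded_supportI[of _ "norm x + s" C] simp: local_kernel_def)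
qed

lemma local_kernel_integral_bound:
  assumes K: "local_kernel K C s" and f: "loc_integrable f" and x: "norm x \<le> R"
  shows "\<bar>LBINT z. K x z * f z\<bar> \<le> C * (LBINT z. indicator (cball 0 (R + s)) z * \<bar>f z\<bar>)"
proof -
  have int: "integrable lborel (\<lambda>z. K x z * f z)"
    by (rule integrable_supp_mult[OF local_kernel_bounded_support(1)[OF K] f])
  have "integrable lborel (\<lambda>z. \<bar>indicator (cball 0 (R + s)) z * f z\<bar>)"
    using f by (auto simp: loc_integrable_def)
  then have int': "integrable lborel (\<lambda>z. indicator (cball 0 (R + s)) z * \<bar>f z\<bar>)"
    by (simp add: abs_mult)
  have "\<bar>LBINT z. K x z * f z\<bar> \<le> (LBINT z. \<bar>K x z * f z\<bar>)"
    by (rule integral_abs_bound)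
  also have "\<dots> \<le> (LBINT z. C * (indicator (cball 0 (R + s)) z * \<bar>f z\<bar>))"
  proof (rule integral_mono)
    fix z
    have "\<bar>K x z\<bar> \<le> C * indicator (cball 0 (R + s)) z"
    proof (cases "norm z \<le> R + s")
      case False
      then have "norm (z - x) > s"
        using norm_triangle_ineq2[of z x] x by simp
      then show ?thesis
        using K by (simp add: local_kernel_def)
    qed (use K in \<open>simp add: local_kernel_def\<close>)
    then show "\<bar>K x z * f z\<bar> \<le> C * (indicator (cball 0 (R + s)) z * \<bar>f z\<bar>)"
      by (simp add: abs_mult mult.assoc[symmetric] mult_right_mono)
  qed (use int int' in auto)
  finally show ?thesis
    by simp
qed

lemma local_kernel_measurable:
  assumes K: "local_kernel K C s" and f: "loc_integrable f"
  shows "(\<lambda>x. LBINT z. K x z * f z) \<in> borel_measurable borel"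
proof -
  have [measurable]: "case_prod K \<in> borel_measurable (borel \<Otimes>\<^sub>M borel)" "f \<in> borel_measurable borel"
    using K f by (auto simp: local_kernel_def loc_integrable_def)
  have "(\<lambda>x. LBINT z. K x z * f z) \<in> borel_measurable lborel"
    by (rule lborel.borel_measurable_lebesgue_integral) measurable
  then show ?thesis
    by simp
qed

lemma local_kernel_loc_integrable:
  assumes K: "local_kernel K C s" and f: "loc_integrable f"
  shows "loc_integrable (\<lambda>x. LBINT z. K x z * f z)"
proof (rule loc_integrable_bound[OF loc_integrable_1 local_kernel_measurable[OF K f]])
  show "\<exists>M. \<forall>x. norm x \<le> R \<longrightarrow> \<bar>LBINT z. K x z * f z\<bar> \<le> M * \<bar>1\<bar>" for R
    using local_kernel_integral_bound[OF K f, of _ R] by auto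
qed

lemma local_kernel_Fubini:
  assumes K: "local_kernel K C s" and f: "loc_integrable f" and q: "bounded_support q"
  shows "(LBINT x. q x * (LBINT z. K x z * f z)) = (LBINT z. (LBINT x. K x z * q x) * f z)"
proof -
  have [measurable]: "q \<in> borel_measurable borel" "f \<in> borel_measurable borel"
    using f q by measurable
  have [measurable]: "case_prod K \<in> borel_measurable (borel \<Otimes>\<^sub>M borel)"
    using K by (auto simp: local_kernel_def)
  obtain R M where M: "R > 0" "M > 0" "\<And>x. \<bar>q x\<bar> \<le> M * indicator (cball 0 R) x"
    using bounded_supportE[OF q] by metis
  have int: "integrable lborel (\<lambda>z. K x z * f z)" for x
    by (rule integrable_supp_mult[OF local_kernel_bounded_support(1)[OF K] f])
  have K_abs: "local_kernel (\<lambda>x z. \<bar>K x z\<bar>) C s"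
    using K by (auto simp: local_kernel_def)
  have q_abs: "bounded_support (\<lambda>x. \<bar>q x\<bar>)"
    using q by (auto simp: bounded_support_def)
  have "integrable (lborel \<Otimes>\<^sub>M lborel) (\<lambda>(x, z). q x * (K x z * f z))"
  proof (rule lborel_pair.Fubini_integrable)
    show "(\<lambda>(x, z). q x * (K x z * f z)) \<in> borel_measurable (lborel \<Otimes>\<^sub>M lborel)"
      by measurable
    show "AE x in lborel. integrable lborel (\<lambda>z. (\<lambda>(x, z). q x * (K x z * f z)) (x, z))"
      using int by auto
    have "integrable lborel (\<lambda>x. \<bar>q x\<bar> * (LBINT z. \<bar>K x z\<bar> * \<bar>f z\<bar>))"
      by (intro integrable_supp_mult q_abs local_kernel_loc_integrable[OF K_abs loc_integrable_abs[OF f]])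
    then show "integrable lborel (\<lambda>x. LBINT z. norm ((\<lambda>(x, z). q x * (K x z * f z)) (x, z)))"
      by (simp add: abs_mult)
  qed
  then have "(LBINT z. LBINT x. q x * (K x z * f z)) = (LBINT x. LBINT z. q x * (K x z * f z))"
    by (rule lborel_pair.Fubini_integral)
  moreover have "(LBINT z. LBINT x. q x * (K x z * f z)) = (LBINT z. (LBINT x. K x z * q x) * f z)"
    unfolding integral_mult_left_zero[symmetric] by (simp add: mult_ac)
  moreover have "(LBINT x. LBINT z. q x * (K x z * f z)) = (LBINT x. q x * (LBINT z. K x z * f z))"
    by simp
  ultimately show ?thesis
    by simp
qed

section \<open>Rescaled bump kernels and their limit at scale 0\<close>

lemma lborel_integral_affine:
  fixes g :: "'a::euclidean_space \<Rightarrow> real"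
  assumes [measurable]: "g \<in> borel_measurable borel" and s: "s > 0"
  shows "(LBINT z. g z) = s ^ DIM('a) * (LBINT y. g (x + s *\<^sub>R y))"
proof -
  have "(LBINT z. g z) = (LINT z|density (distr lborel borel (\<lambda>y. x + s *\<^sub>R y)) (\<lambda>_. ennreal (s ^ DIM('a))). g z)"
    using lborel_affine[of s x] s by simp
  also have "\<dots> = (LINT z|distr lborel borel (\<lambda>y. x + s *\<^sub>R y). s ^ DIM('a) * g z)"
    using s by (subst integral_density) auto
  also have "\<dots> = (LBINT y. s ^ DIM('a) * g (x + s *\<^sub>R y))"
    by (rule integral_distr) auto
  finally show ?thesis
    by simp
qed

lemma lborel_integrable_affine:
  fixes g :: "'a::euclidean_space \<Rightarrow> real"
  assumes g: "integrable lborel g" and s: "s > 0"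
  shows "integrable lborel (\<lambda>y. g (x + s *\<^sub>R y))"
proof -
  have [measurable]: "g \<in> borel_measurable borel"
    using g by auto
  have "integrable (density (distr lborel borel (\<lambda>y. x + s *\<^sub>R y)) (\<lambda>_. ennreal (s ^ DIM('a)))) g"
    using g lborel_affine[of s x] s by simp
  then have "integrable (distr lborel borel (\<lambda>y. x + s *\<^sub>R y)) (\<lambda>z. s ^ DIM('a) *\<^sub>R g z)"
    using s by (subst (asm) integrable_density) auto
  then have "integrable lborel (\<lambda>y. s ^ DIM('a) *\<^sub>R g (x + s *\<^sub>R y))"
    by (subst (asm) integrable_distr_eq) auto
  then show ?thesis
    using s by simp
qed

text \<open>The profile depends on the squared distance, which makes the kernel smooth at its
  centre. The factor s^-N makes the mass independent of s; it is not normalised to 1, so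
  \<open>bump_mass\<close> appears as a factor in every limit.\<close>

definition kernel :: "real poly \<Rightarrow> real \<Rightarrow> real ^ 'n \<Rightarrow> real ^ 'n \<Rightarrow> real" where
  "kernel P s a z = 1 / s ^ CARD('n) * bump P (1 / s\<^sup>2 * (norm (z - a))\<^sup>2)"

definition mollify :: "real poly \<Rightarrow> real \<Rightarrow> (real ^ 'n \<Rightarrow> real) \<Rightarrow> real ^ 'n \<Rightarrow> real" where
  "mollify P s f x = (LBINT z. kernel P s x z * f z)"

lemma bump_bounded: "\<exists>M>0. \<forall>t\<ge>0. \<bar>bump P t\<bar> \<le> M"
proof -
  obtain M where M: "\<And>t. norm t \<le> 1 \<Longrightarrow> \<bar>bump P t\<bar> \<le> M"
    using continuous_bounded_on_ball[OF continuous_on_bump, of 1 P] by blast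
  then have "\<bar>bump P t\<bar> \<le> \<bar>M\<bar> + 1" if "t \<ge> 0" for t
  proof (cases "t \<le> 1")
    case True
    then show ?thesis
      using that M[of t] by simp
  qed (simp add: bump_eq_0)
  then show ?thesis
    by (intro exI[of _ "\<bar>M\<bar> + 1"]) auto
qed

lemma bump_measurable [measurable]: "bump P \<in> borel_measurable borel"
  by (intro borel_measurable_continuous_onI continuous_on_bump)

lemma kernel_commute: "kernel P s a z = kernel P s z a"
  by (simp add: kernel_def norm_minus_commute)

lemma scaled_dist_ge_1:
  assumes "s > 0" "norm (z - a) \<ge> s"
  shows "1 / s\<^sup>2 * (norm (z - a))\<^sup>2 \<ge> 1"
  using assms power_mono[of s "norm (z - a)" 2] by (simp add: field_simps)

lemma local_kernel_kernel:
  assumes "s > 0"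
  shows "\<exists>C. local_kernel (kernel P s :: real ^ 'n \<Rightarrow> _) C s"
proof -
  obtain M where M: "M > 0" "\<And>t. t \<ge> 0 \<Longrightarrow> \<bar>bump P t\<bar> \<le> M"
    using bump_bounded by blast
  have "\<bar>kernel P s x z\<bar> \<le> M / s ^ CARD('n)" for x z :: "real ^ 'n"
    using assms M(2)[of "1 / s\<^sup>2 * (norm (z - x))\<^sup>2"] by (simp add: kernel_def abs_mult divide_right_mono)
  moreover have "kernel P s x z = 0" if "norm (z - x) > s" for x z :: "real ^ 'n"
    using scaled_dist_ge_1[OF assms, of z x] that by (simp add: kernel_def bump_eq_0)
  moreover have "case_prod (kernel P s :: real ^ 'n \<Rightarrow> _) \<in> borel_measurable (borel \<Otimes>\<^sub>M borel)"
    unfolding kernel_def[abs_def] by measurable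
  ultimately have "local_kernel (kernel P s :: real ^ 'n \<Rightarrow> _) (M / s ^ CARD('n)) s"
    using assms M unfolding local_kernel_def by auto
  then show ?thesis ..
qed

lemma kernel_nonneg: "s > 0 \<Longrightarrow> (\<And>t. t \<ge> 0 \<Longrightarrow> bump P t \<ge> 0) \<Longrightarrow> kernel P s a z \<ge> 0"
  by (simp add: kernel_def)

lemma kernel_in_test_functions: "s > 0 \<Longrightarrow> (\<lambda>z. K * kernel P s a z) \<in> test_functions"
  using bump_in_test_functions[of "1 / s\<^sup>2" "K / s ^ CARD('a)" P a] by (simp add: kernel_def[abs_def])

lemma integrable_kernel_mult:
  assumes "s > 0" "loc_integrable f"
  shows "integrable lborel (\<lambda>z. kernel P s x z * f z)"
  using local_kernel_kernel[OF assms(1)] local_kernel_bounded_support(1) assms(2)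
    integrable_supp_mult by blast

lemma loc_integrable_mollify:
  assumes "s > 0" "loc_integrable f"
  shows "loc_integrable (mollify P s f)"
  using local_kernel_kernel[OF assms(1)] local_kernel_loc_integrable[OF _ assms(2)]
  unfolding mollify_def[abs_def] by blast

definition bump_mass :: "'n::finite itself \<Rightarrow> real poly \<Rightarrow> real" where
  "bump_mass _ P = (LINT y|(lborel :: (real ^ 'n) measure). bump P ((norm y)\<^sup>2))"

lemma mollify_rescale:
  fixes f :: "real ^ 'n \<Rightarrow> real"
  assumes s: "s > 0" and f: "loc_integrable f"
  shows "mollify P s f x = (LBINT y. bump P ((norm y)\<^sup>2) * f (x + s *\<^sub>R y))"
proof -
  note [measurable] = f
  have "mollify P s f x = s ^ CARD('n) * (LBINT y. kernel P s x (x + s *\<^sub>R y) * f (x + s *\<^sub>R y))"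
    unfolding mollify_def kernel_def
    using lborel_integral_affine[OF _ s, of "\<lambda>z. kernel P s x z * f z" x, unfolded kernel_def] by simp
  also have "\<dots> = (LBINT y. s ^ CARD('n) * (kernel P s x (x + s *\<^sub>R y) * f (x + s *\<^sub>R y)))"
    by simp
  also have "\<dots> = (LBINT y. bump P ((norm y)\<^sup>2) * f (x + s *\<^sub>R y))"
    using s by (intro Bochner_Integration.integral_cong) (auto simp: kernel_def power_mult_distrib)
  finally show ?thesis .
qed

lemma bump_norm_bounded_support:
  "bounded_support (\<lambda>y :: real ^ 'n. bump P ((norm y)\<^sup>2))"
proof -
  obtain C where "local_kernel (kernel P 1 :: real ^ 'n \<Rightarrow> _) C 1"
    using local_kernel_kernel[of 1 P] by auto
  from local_kernel_bounded_support(1)[OF this, of 0] show ?thesis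
    by (simp add: kernel_def[abs_def])
qed

lemma integrable_bump_norm: "integrable lborel (\<lambda>y :: real ^ 'n. bump P ((norm y)\<^sup>2))"
  using integrable_supp_mult[OF bump_norm_bounded_support loc_integrable_1] by simp

text \<open>After the substitution z = x + s y the error is the double integral of q(x) b(y) (f(x +
  s y) - f(x)). Integrating over x first leaves a translation modulus in L^1, which is uniformly
  small for |y| at most 1.\<close>

lemma mollify_tendsto_weakly:
  fixes f :: "real ^ 'n \<Rightarrow> real"
  assumes f: "loc_integrable f" and q: "bounded_support q"
  shows "((\<lambda>s. LBINT x. q x * mollify P s f x) \<longlongrightarrow> bump_mass TYPE('n) P * (LBINT x. q x * f x)) (at_right 0)"
proof (rule tendstoI)
  have [measurable]: "q \<in> borel_measurable borel" "f \<in> borel_measurable borel"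
    using f q by measurable
  fix e :: real assume e: "e > 0"
  define c where "c = bump_mass TYPE('n) P"
  obtain R M where M: "R > 0" "M > 0" "\<And>x. \<bar>q x\<bar> \<le> M * indicator (cball 0 R) x"
    using bounded_supportE[OF q] by metis
  define b where "b = (\<lambda>y :: real ^ 'n. bump P ((norm y)\<^sup>2))"
  have [measurable]: "b \<in> borel_measurable borel"
    unfolding b_def by measurable
  have int_b: "integrable lborel b"
    unfolding b_def by (rule integrable_bump_norm)
  define B where "B = (LBINT y. \<bar>b y\<bar>)"
  have "B \<ge> 0"
    unfolding B_def by simp
  \<comment> \<open>Cutting \<open>f\<close> off at radius R + 1 loses nothing: \<open>q\<close>
    lives in the ball of radius R, and the shifts s y have length at most 1 where \<open>b\<close>
    is nonzero.\<close>
  define F where "F = (\<lambda>x. indicator (cball 0 (R + 1)) x * f x)"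
  have F: "integrable lborel F"
    using f by (auto simp: loc_integrable_def F_def)
  have [measurable]: "F \<in> borel_measurable borel"
    using F by auto
  \<comment> \<open>Chosen so that M * e' * B is below e; B + 1 in place of B avoids a zero
    denominator.\<close>
  define e' where "e' = e / (2 * M * (B + 1))"
  have "e' > 0"
    using e M \<open>B \<ge> 0\<close> by (simp add: e'_def)
  have "eventually (\<lambda>h. dist (LBINT x. \<bar>F (h + x) - F x\<bar>) 0 < e') (at 0)"
    using \<open>e' > 0\<close> by (rule tendstoD[OF translation_L1_continuous[OF F]])
  then obtain d where d: "d > 0" "\<And>h. h \<noteq> 0 \<Longrightarrow> norm h < d \<Longrightarrow> (LBINT x. \<bar>F (h + x) - F x\<bar>) < e'"
    by (auto simp: eventually_at)
  have "eventually (\<lambda>s. 0 < s \<and> s < min d 1) (at_right (0::real))"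
    using d eventually_at_right[of 0 "1::real" "\<lambda>s. 0 < s \<and> s < min d 1"] by (auto intro!: exI[of _ "min d 1"])
  then show "eventually (\<lambda>s. dist (LBINT x. q x * mollify P s f x) (bump_mass TYPE('n) P * (LBINT x. q x * f x)) < e) (at_right 0)"
    unfolding c_def[symmetric]
  proof eventually_elim
    fix s assume "0 < s \<and> s < min d 1"
    then have s: "0 < s" "s < d" "s < 1"
      by auto
    have int1: "integrable lborel (\<lambda>x. q x * mollify P s f x)"
      by (intro integrable_supp_mult q loc_integrable_mollify s f)
    have int2: "integrable lborel (\<lambda>x. q x * f x)"
      by (intro integrable_supp_mult q f)
    have int3: "integrable lborel (\<lambda>y. b y * f (x + s *\<^sub>R y))" for x
    proof -
      have "integrable lborel (\<lambda>y. s ^ CARD('n) * (kernel P s x (x + s *\<^sub>R y) * f (x + s *\<^sub>R y)))"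
        by (intro integrable_mult_right integrable_kernel_mult s(1) f
            lborel_integrable_affine[OF _ s(1), of "\<lambda>z. kernel P s x z * f z"])
      then show ?thesis
        using s by (simp add: kernel_def b_def power_mult_distrib)
    qed
    define D where "D x = mollify P s f x - c * f x" for x
    have diff: "D x = (LBINT y. b y * (f (x + s *\<^sub>R y) - f x))" for x
      using int3[of x] int_b unfolding D_def mollify_rescale[OF s(1) f] b_def[symmetric] c_def bump_mass_def
      by (simp add: right_diff_distrib b_def)
    \<comment> \<open>The factor |b y| disposes of |y| > 1. The case y = 0 is separate because the
      limit of translations excludes the zero shift; there the integrand vanishes.\<close>
    have inner: "(\<integral>\<^sup>+x. ennreal (\<bar>q x\<bar> * \<bar>f (x + s *\<^sub>R y) - f x\<bar>) \<partial>lborel) * ennreal \<bar>b y\<bar> \<le> ennreal (M * e') * ennreal \<bar>b y\<bar>" for y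
    proof (cases "norm y \<le> 1 \<and> y \<noteq> 0")
      case True
      then have y: "norm y \<le> 1" "y \<noteq> 0"
        by auto
      have sy: "norm (s *\<^sub>R y) < d" "norm (s *\<^sub>R y) \<le> 1"
      proof -
        have "norm (s *\<^sub>R y) \<le> s"
          using s y by simp
        then show "norm (s *\<^sub>R y) < d" "norm (s *\<^sub>R y) \<le> 1"
          using s by linarith+
      qed
      have intF: "integrable lborel (\<lambda>x. \<bar>F (s *\<^sub>R y + x) - F x\<bar>)"
        using F lborel_integrable_translate[OF F] by auto
      have "(\<integral>\<^sup>+x. ennreal (\<bar>q x\<bar> * \<bar>f (x + s *\<^sub>R y) - f x\<bar>) \<partial>lborel)
          \<le> (\<integral>\<^sup>+x. ennreal (M * \<bar>F (s *\<^sub>R y + x) - F x\<bar>) \<partial>lborel)"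
      proof (intro nn_integral_mono ennreal_leI)
        fix x
        show "\<bar>q x\<bar> * \<bar>f (x + s *\<^sub>R y) - f x\<bar> \<le> M * \<bar>F (s *\<^sub>R y + x) - F x\<bar>"
        proof (cases "norm x \<le> R")
          case True
          then have "norm (s *\<^sub>R y + x) \<le> R + 1"
            using norm_triangle_ineq[of "s *\<^sub>R y" x] sy by linarith
          then have "F (s *\<^sub>R y + x) - F x = f (x + s *\<^sub>R y) - f x"
            using True by (simp add: F_def add.commute)
          then show ?thesis
            using M(3)[of x] True by (auto intro!: mult_right_mono)
        qed (use M(2) M(3)[of x] in auto)
      qed
      also have "\<dots> = ennreal (LBINT x. M * \<bar>F (s *\<^sub>R y + x) - F x\<bar>)"
        using M intF by (intro nn_integral_eq_integral) auto
      also have "\<dots> \<le> ennreal (M * e')"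
        using d(2)[of "s *\<^sub>R y"] sy s y M by (intro ennreal_leI) auto
      finally show ?thesis
        by (rule mult_right_mono) simp
    next
      case False
      then consider "y = 0" | "norm y > 1"
        by fastforce
      then show ?thesis
      proof cases
        case 2
        then have "b y = 0"
          by (auto simp: b_def intro!: bump_eq_0)
        then show ?thesis
          by simp
      qed simp
    qed
    have "\<bar>(LBINT x. q x * mollify P s f x) - c * (LBINT x. q x * f x)\<bar>
        = \<bar>LBINT x. q x * D x\<bar>"
      using int1 int2 by (simp add: D_def right_diff_distrib mult.left_commute[of _ c])
    also have "ennreal \<dots> \<le> (\<integral>\<^sup>+x. ennreal \<bar>q x * D x\<bar> \<partial>lborel)"
      using integral_norm_bound_ennreal[of lborel "\<lambda>x. q x * D x"] int1 int2
      by (simp add: D_def right_diff_distrib mult.left_commute[of _ c])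
    also have "\<dots> \<le> (\<integral>\<^sup>+x. (\<integral>\<^sup>+y. ennreal (\<bar>q x\<bar> * \<bar>f (x + s *\<^sub>R y) - f x\<bar>) * ennreal \<bar>b y\<bar> \<partial>lborel) \<partial>lborel)"
    proof (rule nn_integral_mono)
      fix x
      have "ennreal \<bar>q x * D x\<bar> = ennreal \<bar>q x\<bar> * ennreal \<bar>LBINT y. b y * (f (x + s *\<^sub>R y) - f x)\<bar>"
        by (simp add: diff abs_mult ennreal_mult)
      also have "\<dots> \<le> ennreal \<bar>q x\<bar> * (\<integral>\<^sup>+y. ennreal \<bar>b y * (f (x + s *\<^sub>R y) - f x)\<bar> \<partial>lborel)"
        using integral_norm_bound_ennreal[of lborel "\<lambda>y. b y * (f (x + s *\<^sub>R y) - f x)"] int3[of x] int_b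
        by (intro mult_left_mono) (auto simp: right_diff_distrib)
      also have "\<dots> = (\<integral>\<^sup>+y. ennreal (\<bar>q x\<bar> * \<bar>f (x + s *\<^sub>R y) - f x\<bar>) * ennreal \<bar>b y\<bar> \<partial>lborel)"
        by (subst nn_integral_cmult[symmetric]) (auto simp: abs_mult ennreal_mult mult_ac)
      finally show "ennreal \<bar>q x * D x\<bar> \<le> \<dots>" .
    qed
    also have "\<dots> = (\<integral>\<^sup>+y. (\<integral>\<^sup>+x. ennreal (\<bar>q x\<bar> * \<bar>f (x + s *\<^sub>R y) - f x\<bar>) * ennreal \<bar>b y\<bar> \<partial>lborel) \<partial>lborel)"
      by (rule lborel_pair.Fubini'[symmetric]) measurable
    also have "\<dots> \<le> (\<integral>\<^sup>+y. ennreal (M * e') * ennreal \<bar>b y\<bar> \<partial>lborel)"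
      using inner by (intro nn_integral_mono) (simp add: nn_integral_multc)
    also have "\<dots> = ennreal (M * e') * ennreal B"
      using int_b by (simp add: nn_integral_cmult B_def nn_integral_eq_integral)
    also have "\<dots> = ennreal (M * e' * B)"
      using M \<open>e' > 0\<close> \<open>B \<ge> 0\<close> by (simp add: ennreal_mult)
    finally have "\<bar>(LBINT x. q x * mollify P s f x) - c * (LBINT x. q x * f x)\<bar> \<le> M * e' * B"
      using M \<open>e' > 0\<close> \<open>B \<ge> 0\<close> by (simp add: ennreal_le_iff)
    also have "\<dots> < e"
    proof -
      have "M * e' * B = e * (B / (2 * (B + 1)))"
        using M by (simp add: e'_def)
      also have "\<dots> < e * 1"
        using e \<open>B \<ge> 0\<close> by (intro mult_strict_left_mono) (simp_all add: field_simps)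
      finally show ?thesis
        by simp
    qed
    finally show "dist (LBINT x. q x * mollify P s f x) (c * (LBINT x. q x * f x)) < e"
      by (simp add: dist_real_def)
  qed
qed

section \<open>The scale derivative of the mollifiers is a Laplacian\<close>

abbreviation "bump1' \<equiv> bump (bump_deriv 1)"

abbreviation "bump1'' \<equiv> bump (bump_deriv (bump_deriv 1))"

text \<open>If \<eta> denotes the profile \<open>bump 1\<close>, then \<open>rho\<close> encodes -2
  \<eta>'. This profile is nonnegative on [0, \<infinity>), and the gradient in z of s^(1-N)
  \<eta>(|z - x|^2 / s^2) is -(z - x) / s times \<open>kernel rho s x z\<close>.\<close>

definition rho :: "real poly" where
  "rho = smult (- 2) (bump_deriv 1)"

lemma bump_smult: "bump (smult c P) t = c * bump P t"
  by (simp add: bump_def)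

lemma bump_rho: "bump rho t = - 2 * bump1' t"
  unfolding rho_def bump_smult ..

lemma bump_1_le_rho: "t \<ge> 0 \<Longrightarrow> bump 1 t \<le> bump rho t / 2"
  using bump_1_le[of t] by (simp add: bump_rho)

lemma bump_rho_nonneg: "t \<ge> 0 \<Longrightarrow> bump rho t \<ge> 0"
  using bump_1_le_rho[of t] bump_1_nonneg[of t] by simp

definition kernel_lap :: "real \<Rightarrow> real ^ 'n \<Rightarrow> real ^ 'n \<Rightarrow> real" where
  "kernel_lap s x = laplacian (\<lambda>z. s * kernel 1 s x z)"

lemma kernel_lap_eq:
  fixes x z :: "real ^ 'n"
  assumes "s > 0"
  defines "t \<equiv> 1 / s\<^sup>2 * (norm (z - x))\<^sup>2"
  shows "kernel_lap s x z = 1 / s ^ (CARD('n) + 1) *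
    (2 * CARD('n) * bump1' t + 4 * t * bump1'' t)"
proof -
  have "kernel_lap s x = laplacian (\<lambda>z. s / s ^ CARD('n) * bump 1 (1 / s\<^sup>2 * (norm (z - x))\<^sup>2))"
    by (simp add: kernel_lap_def kernel_def[abs_def])
  then have "kernel_lap s x z = s / s ^ CARD('n) * (2 * (1 / s\<^sup>2) * CARD('n) * bump1' t
      + 4 * (1 / s\<^sup>2) * t * bump1'' t)"
    unfolding t_def using laplacian_bump[of "s / s ^ CARD('n)" 1 "1 / s\<^sup>2" x z] by simp
  also have "\<dots> = 1 / s ^ (CARD('n) + 1) *
    (2 * CARD('n) * bump1' t + 4 * t * bump1'' t)"
    using assms(1) by (simp add: field_simps power2_eq_square)
  finally show ?thesis .
qed

lemma kernel_lap_commute: "s > 0 \<Longrightarrow> kernel_lap s x z = kernel_lap s z x"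
  by (simp add: kernel_lap_eq norm_minus_commute)

text \<open>Both sides are the divergence in z of -((z - x) / s) \<open>kernel rho s x z\<close>:
  the left one by scaling of a mass-preserving family, the right one because this field is the
  gradient of s \<open>kernel 1 s x\<close>. The proof checks the resulting formulas
  directly.\<close>

lemma DERIV_kernel_scale:
  fixes x z :: "real ^ 'n"
  assumes s: "s > 0"
  shows "((\<lambda>s. kernel rho s x z) has_real_derivative kernel_lap s x z) (at s)"
proof -
  obtain m where m: "CARD('n) = Suc m"
    using gr0_implies_Suc[of "CARD('n)"] zero_less_card_finite by blast
  define D where "D = (norm (z - x))\<^sup>2"
  define t where "t = 1 / s\<^sup>2 * D"
  have inner: "((\<lambda>s. 1 / s\<^sup>2 * D) has_real_derivative - 2 * t / s) (at s)"
    using s by (auto intro!: derivative_eq_intros simp: t_def power2_eq_square field_simps)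
  have b: "((\<lambda>s. bump1' (1 / s\<^sup>2 * D)) has_real_derivative
      bump1'' t * (- 2 * t / s)) (at s)"
    using DERIV_chain2[OF _ inner, of "bump1'"] DERIV_bump unfolding t_def by blast
  have p: "((\<lambda>s. 1 / s ^ CARD('n)) has_real_derivative - CARD('n) / s ^ (CARD('n) + 1)) (at s)"
  proof -
    have "((\<lambda>s. 1 / s ^ CARD('n)) has_real_derivative - (CARD('n) * s ^ (CARD('n) - 1)) / (s ^ CARD('n))\<^sup>2) (at s)"
      using s by (auto intro!: derivative_eq_intros simp: power2_eq_square)
    also have "- (CARD('n) * s ^ (CARD('n) - 1)) / (s ^ CARD('n))\<^sup>2 = - CARD('n) / s ^ (CARD('n) + 1)"
      using s unfolding m by (simp add: field_simps power2_eq_square)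
    finally show ?thesis .
  qed
  have "((\<lambda>s. 1 / s ^ CARD('n) * (- 2 * bump1' (1 / s\<^sup>2 * D))) has_real_derivative
      (- CARD('n) / s ^ (CARD('n) + 1)) * (- 2 * bump1' (1 / s\<^sup>2 * D))
      + (- 2 * (bump1'' t * (- 2 * t / s))) * (1 / s ^ CARD('n))) (at s)"
    by (intro DERIV_mult p DERIV_cmult b)
  moreover have "(- CARD('n) / s ^ (CARD('n) + 1)) * (- 2 * bump1' (1 / s\<^sup>2 * D))
      + (- 2 * (bump1'' t * (- 2 * t / s))) * (1 / s ^ CARD('n)) = kernel_lap s x z"
    unfolding kernel_lap_eq[OF s] D_def[symmetric] t_def[symmetric]
    using s by (simp add: field_simps)
  ultimately show ?thesis
    by (simp add: kernel_def bump_rho D_def)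
qed

lemma kernel_lap_eq_0:
  assumes "s > 0" "norm (z - x) > s"
  shows "kernel_lap s x z = 0"
  using scaled_dist_ge_1[of s z x] assms by (simp add: kernel_lap_eq bump_eq_0)

lemma kernel_lap_bound:
  "\<exists>C>0. \<forall>s x z. s > 0 \<longrightarrow> \<bar>kernel_lap s (x :: real ^ 'n) z\<bar> \<le> C / s ^ (CARD('n) + 1)"
proof -
  obtain M1 where M1: "M1 > 0" "\<And>t. t \<ge> 0 \<Longrightarrow> \<bar>bump1' t\<bar> \<le> M1"
    using bump_bounded by blast
  obtain M2 where M2: "M2 > 0" "\<And>t. t \<ge> 0 \<Longrightarrow> \<bar>bump1'' t\<bar> \<le> M2"
    using bump_bounded by blast
  have "\<bar>kernel_lap s x z\<bar> \<le> (2 * CARD('n) * M1 + 4 * M2) / s ^ (CARD('n) + 1)"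
    if s: "s > 0" for s and x z :: "real ^ 'n"
  proof -
    define t where "t = 1 / s\<^sup>2 * (norm (z - x))\<^sup>2"
    have t: "t \<ge> 0"
      by (simp add: t_def)
    have "\<bar>t * bump1'' t\<bar> \<le> M2"
    proof (cases "t \<le> 1")
      case True
      then show ?thesis
        using mult_mono[of t 1 "\<bar>bump1'' t\<bar>" M2] M2 t by (simp add: abs_mult)
    qed (use M2 in \<open>simp add: bump_eq_0\<close>)
    moreover have "\<bar>CARD('n) * bump1' t\<bar> \<le> CARD('n) * M1"
      using M1(2)[OF t] by (simp add: abs_mult)
    ultimately have "\<bar>2 * CARD('n) * bump1' t + 4 * t * bump1'' t\<bar> \<le> 2 * CARD('n) * M1 + 4 * M2"
      by (simp only: abs_le_iff mult.assoc) linarith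
    then show ?thesis
      unfolding kernel_lap_eq[OF s] t_def[symmetric] using s by (simp add: abs_mult divide_right_mono)
  qed
  then show ?thesis
    using M1 M2 by (intro exI[of _ "2 * CARD('n) * M1 + 4 * M2"]) (auto intro!: add_nonneg_pos)
qed

text \<open>The bound and the range are uniform for scales in (a, b), which supplies the domination
  needed to differentiate in the scale.\<close>

lemma local_kernel_kernel_lap:
  assumes a: "a > 0"
  shows "\<exists>C. \<forall>s. a < s \<longrightarrow> s < b \<longrightarrow> local_kernel (kernel_lap s :: real ^ 'n \<Rightarrow> _) C b"
proof -
  obtain C where C: "C > 0" "\<And>s x z. s > 0 \<Longrightarrow> \<bar>kernel_lap s (x :: real ^ 'n) z\<bar> \<le> C / s ^ (CARD('n) + 1)"
    using kernel_lap_bound by blast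
  have "local_kernel (kernel_lap s :: real ^ 'n \<Rightarrow> _) (C / a ^ (CARD('n) + 1)) b" if s: "a < s" "s < b" for s
  proof -
    have s0: "s > 0"
      using s a by simp
    have "\<bar>kernel_lap s x z\<bar> \<le> C / a ^ (CARD('n) + 1)" for x z :: "real ^ 'n"
    proof (rule order_trans[OF C(2)[OF s0]])
      show "C / s ^ (CARD('n) + 1) \<le> C / a ^ (CARD('n) + 1)"
        using s a C(1) by (intro divide_left_mono power_mono) auto
    qed
    moreover have "case_prod (kernel_lap s :: real ^ 'n \<Rightarrow> _) \<in> borel_measurable (borel \<Otimes>\<^sub>M borel)"
      unfolding kernel_lap_eq[OF s0, abs_def] by measurable
    moreover have "kernel_lap s x z = 0" if "norm (z - x) > b" for x z :: "real ^ 'n"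
      using kernel_lap_eq_0[OF s0, of z x] that s by simp
    ultimately show ?thesis
      using s s0 a C(1) unfolding local_kernel_def by auto
  qed
  then show ?thesis
    by blast
qed

lemma local_kernel_kernel_lap':
  assumes "s > 0"
  shows "\<exists>C b. local_kernel (kernel_lap s :: real ^ 'n \<Rightarrow> _) C b"
proof -
  have "s / 2 > 0" "s / 2 < s" "s < 2 * s"
    using assms by auto
  then show ?thesis
    using local_kernel_kernel_lap[of "s / 2" "2 * s", where ?'n = 'n] by blast
qed

lemma DERIV_mollify_scale:
  fixes v :: "real ^ 'n \<Rightarrow> real"
  assumes s: "s > 0" and v: "loc_integrable v"
  shows "((\<lambda>s. mollify rho s v x) has_real_derivative (LBINT z. kernel_lap s x z * v z)) (at s)"
proof -
  obtain C where C: "\<And>t. s / 2 < t \<Longrightarrow> t < 2 * s \<Longrightarrow> local_kernel (kernel_lap t :: real ^ 'n \<Rightarrow> _) C (2 * s)"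
    using local_kernel_kernel_lap[of "s / 2" "2 * s", where ?'n = 'n] s by auto
  show ?thesis
    unfolding mollify_def
  proof (rule has_real_derivative_integral[of "s / 2" s "2 * s"])
    have "bounded_support (\<lambda>z. C * indicator (cball x (2 * s)) z)"
    proof (rule bounded_supportI[of _ "norm x + 2 * s" "\<bar>C\<bar>"])
      fix z :: "real ^ 'n" assume "norm x + 2 * s < norm z"
      then have "z \<notin> cball x (2 * s)"
        using norm_triangle_ineq2[of z x] by (auto simp: dist_norm norm_minus_commute)
      then show "C * indicator (cball x (2 * s)) z = 0"
        by simp
    qed (auto simp: indicator_def)
    then show "integrable lborel (\<lambda>z. (C * indicator (cball x (2 * s)) z) * \<bar>v z\<bar>)"
      by (rule integrable_supp_mult[OF _ loc_integrable_abs[OF v]])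
    show "integrable lborel (\<lambda>z. kernel rho t x z * v z)" if "s / 2 < t" "t < 2 * s" for t
      using that s by (intro integrable_kernel_mult v) auto
    show "((\<lambda>t. kernel rho t x z * v z) has_real_derivative kernel_lap t x z * v z) (at t)"
      if "s / 2 < t" "t < 2 * s" for t z
      using that s by (intro DERIV_cmult_right DERIV_kernel_scale) auto
    show "\<bar>kernel_lap t x z * v z\<bar> \<le> (C * indicator (cball x (2 * s)) z) * \<bar>v z\<bar>"
      if "s / 2 < t" "t < 2 * s" for t z
    proof -
      have "\<bar>kernel_lap t x z\<bar> \<le> C * indicator (cball x (2 * s)) z"
        using C[OF that] by (auto simp: local_kernel_def indicator_def dist_norm norm_minus_commute)
      then show ?thesis
        by (simp add: abs_mult mult_right_mono)
    qed
    have "local_kernel (kernel_lap s :: real ^ 'n \<Rightarrow> _) C (2 * s)"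
      using C s by auto
    then have "integrable lborel (\<lambda>z. kernel_lap s x z * v z)"
      by (intro integrable_supp_mult[OF _ v] local_kernel_bounded_support)
    then show "(\<lambda>z. kernel_lap s x z * v z) \<in> borel_measurable lborel"
      by auto
  qed (use s in auto)
qed

lemma DERIV_integral_mollify_scale:
  fixes v :: "real ^ 'n \<Rightarrow> real"
  assumes s: "s > 0" and v: "loc_integrable v" and q: "bounded_support q"
  shows "((\<lambda>s. LBINT x. q x * mollify rho s v x) has_real_derivative
    (LBINT x. q x * (LBINT z. kernel_lap s x z * v z))) (at s)"
proof -
  obtain C where C: "\<And>t. s / 2 < t \<Longrightarrow> t < 2 * s \<Longrightarrow> local_kernel (kernel_lap t :: real ^ 'n \<Rightarrow> _) C (2 * s)"
    using local_kernel_kernel_lap[of "s / 2" "2 * s", where ?'n = 'n] s by auto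
  obtain R M where M: "R > 0" "M > 0" "\<And>x. \<bar>q x\<bar> \<le> M * indicator (cball 0 R) x"
    using bounded_supportE[OF q] by metis
  have q_abs: "integrable lborel (\<lambda>x. \<bar>q x\<bar>)"
    using integrable_supp_mult[OF q loc_integrable_1] by auto
  define B where "B = C * (LBINT z. indicator (cball 0 (R + 2 * s)) z * \<bar>v z\<bar>)"
  show ?thesis
  proof (rule has_real_derivative_integral[of "s / 2" s "2 * s"])
    show "integrable lborel (\<lambda>x. \<bar>q x\<bar> * B)"
      using q_abs by auto
    show "integrable lborel (\<lambda>x. q x * mollify rho t v x)" if "s / 2 < t" "t < 2 * s" for t
      using that s by (intro integrable_supp_mult q loc_integrable_mollify v) auto
    show "((\<lambda>t. q x * mollify rho t v x) has_real_derivative q x * (LBINT z. kernel_lap t x z * v z)) (at t)"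
      if "s / 2 < t" "t < 2 * s" for t x
      using that s by (intro DERIV_cmult DERIV_mollify_scale v) auto
    show "\<bar>q x * (LBINT z. kernel_lap t x z * v z)\<bar> \<le> \<bar>q x\<bar> * B"
      if "s / 2 < t" "t < 2 * s" for t x
    proof (cases "norm x \<le> R")
      case True
      then show ?thesis
        unfolding B_def abs_mult using local_kernel_integral_bound[OF C[OF that] v True] by (intro mult_left_mono) auto
    next
      case False
      then have "q x = 0"
        using M(3)[of x] by simp
      then show ?thesis
        by simp
    qed
    have "local_kernel (kernel_lap s :: real ^ 'n \<Rightarrow> _) C (2 * s)"
      using C s by auto
    then have "integrable lborel (\<lambda>x. q x * (LBINT z. kernel_lap s x z * v z))"
      by (intro integrable_supp_mult[OF q] local_kernel_loc_integrable[OF _ v])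
    then show "(\<lambda>x. q x * (LBINT z. kernel_lap s x z * v z)) \<in> borel_measurable lborel"
      by auto
  qed (use s in auto)
qed

text \<open>The function \<open>s * kernel 1 s x\<close> is itself a test function, so the weak
  equation evaluates the scale derivative of \<open>mollify rho s v x\<close> exactly.\<close>

lemma kernel_lap_weak:
  assumes "weak_laplacian v f" "s > 0"
  shows "(LBINT z. kernel_lap s x z * v z) = s * mollify 1 s f x"
  using assms(1) kernel_in_test_functions[OF assms(2), of s 1 x]
  unfolding weak_laplacian_def kernel_lap_def mollify_def by (simp add: mult.assoc)

lemma kernel_lap_weak_ge:
  assumes "weak_laplacian_ge v f" "s > 0"
  shows "(LBINT z. kernel_lap s x z * v z) \<ge> s * mollify 1 s f x"
proof -
  have "\<forall>z. s * kernel 1 s x z \<ge> 0"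
    using kernel_nonneg[OF assms(2) bump_1_nonneg] less_imp_le[OF assms(2)] by (intro allI mult_nonneg_nonneg)
  then show ?thesis
    using assms(1) kernel_in_test_functions[OF assms(2), of s 1 x]
    unfolding weak_laplacian_ge_def kernel_lap_def mollify_def by (fastforce simp: mult.assoc)
qed

text \<open>By symmetry of the kernel and Fubini the Laplacian is moved onto \<open>\<phi>\<close>.
  Thus \<open>W\<close> needs no weak equation of its own, which is essential in Kato's inequality,
  where its Laplacian is what has to be estimated.\<close>

lemma integral_test_kernel_lap:
  assumes \<phi>: "\<phi> \<in> test_functions" and W: "loc_integrable W" and s: "s > 0"
  shows "(LBINT x. \<phi> x * (LBINT z. kernel_lap s x z * W z))
    = s * (LBINT x. laplacian \<phi> x * mollify 1 s W x)"
proof -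
  obtain C b where Cb: "local_kernel (kernel_lap s :: real ^ 'a \<Rightarrow> _) C b"
    using local_kernel_kernel_lap'[OF s] by blast
  obtain C' where C': "local_kernel (kernel 1 s :: real ^ 'a \<Rightarrow> _) C' s"
    using local_kernel_kernel[OF s] by blast
  have *: "weak_laplacian \<phi> (laplacian \<phi>)"
    by (rule weak_laplacian_classical[OF test_functionsD(1)[OF \<phi>]])
  have "(LBINT x. \<phi> x * (LBINT z. kernel_lap s x z * W z))
      = (LBINT z. (LBINT x. kernel_lap s x z * \<phi> x) * W z)"
    by (rule local_kernel_Fubini[OF Cb W test_functionsD(4)[OF \<phi>]])
  also have "\<dots> = (LBINT z. (s * (LBINT x. kernel 1 s x z * laplacian \<phi> x)) * W z)"
    using kernel_lap_weak[OF * s]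
    by (simp add: kernel_lap_commute[OF s, of _ "_ :: real ^ 'a"] mollify_def kernel_commute)
  also have "\<dots> = s * (LBINT z. (LBINT x. kernel 1 s x z * laplacian \<phi> x) * W z)"
    by (simp add: mult.assoc)
  also have "(LBINT z. (LBINT x. kernel 1 s x z * laplacian \<phi> x) * W z) = (LBINT x. laplacian \<phi> x * mollify 1 s W x)"
    unfolding mollify_def
    by (rule local_kernel_Fubini[OF C' W bounded_support_laplacian[OF \<phi>], symmetric])
  finally show ?thesis .
qed

lemma bump_mass_1_pos: "bump_mass TYPE('n::finite) 1 > 0"
proof -
  let ?S = "cball 0 (1 / 2) :: (real ^ 'n) set"
  note integrable_bump_norm[of 1, where ?'n = 'n]
  moreover have "integrable lborel (\<lambda>y. exp (- 2) * indicator ?S y :: real)"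
    by (simp add: integrable_indicator_cball)
  \<comment> \<open>For |y| at most 1 / 2 the quantity 1 / (1 - |y|^2) is at most 4 / 3, hence at
    most 2.\<close>
  moreover have "exp (- 2) * indicator ?S y \<le> bump 1 ((norm y)\<^sup>2)" for y
  proof (cases "norm y \<le> 1 / 2")
    case True
    then have "(norm y)\<^sup>2 \<le> 1 / 4"
      using power_mono[of "norm y" "1 / 2" 2] by (simp add: power2_eq_square)
    then have "(norm y)\<^sup>2 < 1" "1 / (1 - (norm y)\<^sup>2) \<le> 2"
      by (auto simp: field_simps)
    then show ?thesis
      by (simp add: bump_def indicator_def)
  qed (simp add: bump_1_nonneg)
  ultimately have "(LBINT y. exp (- 2) * indicator ?S y) \<le> bump_mass TYPE('n) 1"
    unfolding bump_mass_def by (intro integral_mono) auto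
  moreover have "(LBINT y. exp (- 2) * indicator ?S y) = exp (- 2) * measure lborel ?S"
    by simp
  moreover have "measure lborel ?S > 0"
    by simp
  ultimately show ?thesis
    by (smt (verit) exp_gt_zero mult_pos_pos)
qed

lemma bump_mass_rho_pos: "bump_mass TYPE('n::finite) rho > 0"
proof -
  have "bump_mass TYPE('n) 1 \<le> (LINT y|(lborel :: (real ^ 'n) measure). bump rho ((norm y)\<^sup>2) / 2)"
    unfolding bump_mass_def by (intro integral_mono bump_1_le_rho integrable_divide integrable_bump_norm) auto
  then show ?thesis
    using bump_mass_1_pos[where ?'n = 'n] by (simp add: bump_mass_def)
qed

lemma integral_kernel:
  fixes x :: "real ^ 'n"
  assumes "s > 0"
  shows "(LBINT z. kernel P s x z) = bump_mass TYPE('n) P"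
  using mollify_rescale[OF assms loc_integrable_1, of P x] by (simp add: mollify_def bump_mass_def)

subsection \<open>Kato's inequality\<close>

text \<open>If L were negative, h would be strictly decreasing on some (0, d). Since h tends to 0,
  its value at d / 3 is at most 0, and at d / 2 it is strictly negative, against
  nonnegativity.\<close>

lemma derivative_limit_nonneg:
  fixes h A :: "real \<Rightarrow> real"
  assumes h0: "(h \<longlongrightarrow> 0) (at_right 0)" and h: "\<And>s. s > 0 \<Longrightarrow> h s \<ge> 0"
    and h': "\<And>s. s > 0 \<Longrightarrow> (h has_real_derivative s * A s) (at s)"
    and A: "(A \<longlongrightarrow> L) (at_right 0)"
  shows "L \<ge> 0"
proof (rule ccontr)
  assume "\<not> L \<ge> 0"
  then have "eventually (\<lambda>s. A s < 0) (at_right 0)"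
    using order_tendstoD(2)[OF A, of 0] by simp
  then obtain d where d: "d > 0" "\<And>s. 0 < s \<Longrightarrow> s < d \<Longrightarrow> A s < 0"
    by (auto simp: eventually_at_right_field)
  have decr: "h t < h s" if "0 < s" "s < t" "t < d" for s t
  proof (rule DERIV_neg_imp_decreasing[OF that(2)])
    fix r assume "s \<le> r" "r \<le> t"
    then show "\<exists>y. (h has_real_derivative y) (at r) \<and> y < 0"
      using h'[of r] d(2)[of r] that by (intro exI[of _ "r * A r"]) (auto simp: mult_pos_neg)
  qed
  have "eventually (\<lambda>s. h (d / 3) \<le> h s) (at_right 0)"
    unfolding eventually_at_right_field using decr[of _ "d / 3"] d(1)
    by (intro exI[of _ "d / 3"]) (auto intro: less_imp_le)
  then have "h (d / 3) \<le> 0"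
    using tendsto_lowerbound[OF h0] by simp
  moreover have "h (d / 2) < h (d / 3)"
    using d(1) by (intro decr) auto
  ultimately show False
    using h[of "d / 2"] d(1) by simp
qed

text \<open>Mollifying at scale \<open>s\<close>, the subgradient inequality gives a nonnegative quantity \<open>h s\<close>
  that vanishes as \<open>s\<close> tends to 0, and its derivative divided by \<open>s\<close> converges to a positive
  multiple of the difference of the two sides. No smoothing of \<open>W\<close> is needed.\<close>

lemma Kato_inequality:
  fixes v f p :: "'i \<Rightarrow> real ^ 'n \<Rightarrow> real"
  assumes vf: "\<And>i. i \<in> I \<Longrightarrow> weak_laplacian (v i) (f i)" and W: "loc_integrable W"
    and p: "\<And>i. i \<in> I \<Longrightarrow> p i \<in> borel_measurable borel" "\<And>i x. i \<in> I \<Longrightarrow> \<bar>p i x\<bar> \<le> K"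
    and subgrad: "\<And>x y. W y \<ge> W x + (\<Sum>i\<in>I. p i x * (v i y - v i x))"
  shows "weak_laplacian_ge W (\<lambda>x. \<Sum>i\<in>I. p i x * f i x)"
  unfolding weak_laplacian_ge_def
proof (intro conjI ballI impI)
  have v: "loc_integrable (v i)" and f: "loc_integrable (f i)" if "i \<in> I" for i
    using vf[OF that] by (auto simp: weak_laplacian_def)
  show "loc_integrable W"
    by fact
  show "loc_integrable (\<lambda>x. \<Sum>i\<in>I. p i x * f i x)"
    using p f by (intro loc_integrable_sum loc_integrable_mult) auto
  fix \<phi> :: "real ^ 'n \<Rightarrow> real" assume \<phi>: "\<phi> \<in> test_functions" and \<phi>0: "\<forall>x. \<phi> x \<ge> 0"
  define c where "c = bump_mass TYPE('n) rho"
  \<comment> \<open>These weights are in general discontinuous, since the subgradients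
    \<open>p i\<close> are only Borel and bounded.\<close>
  define q where "q = (\<lambda>i x. p i x * \<phi> x)"
  have q: "bounded_support (q i)" if "i \<in> I" for i
    unfolding q_def using that p by (intro bounded_support_mult[OF _ _ test_functionsD(4)[OF \<phi>]]) auto
  have \<phi>b: "bounded_support \<phi>"
    using \<phi> by (rule test_functionsD)
  define h where "h = (\<lambda>s. (LBINT x. \<phi> x * mollify rho s W x) - c * (LBINT x. \<phi> x * W x)
    - (\<Sum>i\<in>I. (LBINT x. q i x * mollify rho s (v i) x) - c * (LBINT x. q i x * v i x)))"
  define A where "A = (\<lambda>s. (LBINT x. laplacian \<phi> x * mollify 1 s W x)
    - (\<Sum>i\<in>I. LBINT x. q i x * mollify 1 s (f i) x))"
  have h0: "(h \<longlongrightarrow> 0) (at_right 0)"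
  proof -
    have "(h \<longlongrightarrow> c * (LBINT x. \<phi> x * W x) - c * (LBINT x. \<phi> x * W x)
      - (\<Sum>i\<in>I. c * (LBINT x. q i x * v i x) - c * (LBINT x. q i x * v i x))) (at_right 0)"
      unfolding h_def c_def by (intro tendsto_intros mollify_tendsto_weakly W v q \<phi>b)
    then show ?thesis
      by simp
  qed
  have h_nonneg: "h s \<ge> 0" if s: "s > 0" for s
  proof -
    have int: "integrable lborel (\<lambda>x. \<phi> x * mollify rho s W x)" "integrable lborel (\<lambda>x. \<phi> x * W x)"
      "\<And>i. i \<in> I \<Longrightarrow> integrable lborel (\<lambda>x. q i x * mollify rho s (v i) x)"
      "\<And>i. i \<in> I \<Longrightarrow> integrable lborel (\<lambda>x. q i x * v i x)"
      by (intro integrable_supp_mult loc_integrable_mollify s W v q \<phi>b; assumption)+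
    have "has_bochner_integral lborel (\<lambda>x. \<phi> x * mollify rho s W x - c * (\<phi> x * W x)
      - (\<Sum>i\<in>I. q i x * mollify rho s (v i) x - c * (q i x * v i x))) (h s)"
      unfolding h_def
      by (intro has_bochner_integral_diff has_bochner_integral_sum has_bochner_integral_mult_right
          has_bochner_integral_integrable int)
    then have "h s = (LBINT x. \<phi> x * mollify rho s W x - c * (\<phi> x * W x)
      - (\<Sum>i\<in>I. q i x * mollify rho s (v i) x - c * (q i x * v i x)))"
      by (rule has_bochner_integral_integral_eq[symmetric])
    also have "\<dots> \<ge> 0"
    proof (rule integral_nonneg_AE, intro AE_I2)
      fix x
      have ik: "integrable lborel (\<lambda>z. kernel rho s x z * W z)" "integrable lborel (\<lambda>z. kernel rho s x z)"
        "\<And>i. i \<in> I \<Longrightarrow> integrable lborel (\<lambda>z. kernel rho s x z * v i z)"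
        using integrable_kernel_mult[OF s W] integrable_kernel_mult[OF s v] integrable_kernel_mult[OF s loc_integrable_1]
        by auto
      \<comment> \<open>The subgradient inequality at x is averaged over z. The kernel has mass c,
        which accounts for the factor c on the unmollified terms.\<close>
      have "0 \<le> (LBINT z. kernel rho s x z * (W z - W x - (\<Sum>i\<in>I. p i x * (v i z - v i x))))"
        using kernel_nonneg[OF s bump_rho_nonneg] subgrad
        by (intro integral_nonneg_AE AE_I2 mult_nonneg_nonneg) (auto simp: algebra_simps)
      also have "\<dots> = (LBINT z. kernel rho s x z * W z - W x * kernel rho s x z
          - (\<Sum>i\<in>I. p i x * (kernel rho s x z * v i z) - p i x * v i x * kernel rho s x z))"
        by (intro Bochner_Integration.integral_cong)
          (simp_all add: right_diff_distrib left_diff_distrib sum_distrib_left sum_subtractf mult_ac)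
      also have "\<dots> = (LBINT z. kernel rho s x z * W z) - W x * (LBINT z. kernel rho s x z)
          - (\<Sum>i\<in>I. p i x * (LBINT z. kernel rho s x z * v i z) - p i x * v i x * (LBINT z. kernel rho s x z))"
        by (intro has_bochner_integral_integral_eq has_bochner_integral_diff has_bochner_integral_sum
            has_bochner_integral_mult_right has_bochner_integral_integrable ik)
      also have "\<dots> = mollify rho s W x - c * W x - (\<Sum>i\<in>I. p i x * mollify rho s (v i) x - c * (p i x * v i x))"
        unfolding integral_kernel[OF s] c_def mollify_def by (simp add: mult_ac)
      finally have "0 \<le> \<phi> x * (mollify rho s W x - c * W x - (\<Sum>i\<in>I. p i x * mollify rho s (v i) x - c * (p i x * v i x)))"
        using \<phi>0 by simp
      then show "0 \<le> \<phi> x * mollify rho s W x - c * (\<phi> x * W x) - (\<Sum>i\<in>I. q i x * mollify rho s (v i) x - c * (q i x * v i x))"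
        by (simp add: q_def right_diff_distrib sum_distrib_left sum_subtractf mult_ac)
    qed
    finally show ?thesis .
  qed
  have h': "(h has_real_derivative s * A s) (at s)" if s: "s > 0" for s
  proof -
    have "(h has_real_derivative (LBINT x. \<phi> x * (LBINT z. kernel_lap s x z * W z)) - 0
        - (\<Sum>i\<in>I. (LBINT x. q i x * (LBINT z. kernel_lap s x z * v i z)) - 0)) (at s)"
      unfolding h_def by (intro DERIV_diff DERIV_sum DERIV_const DERIV_integral_mollify_scale s W v q \<phi>b)
    moreover have "(LBINT x. q i x * (LBINT z. kernel_lap s x z * v i z))
        = s * (LBINT x. q i x * mollify 1 s (f i) x)" if "i \<in> I" for i
      using kernel_lap_weak[OF vf[OF that] s] by (simp add: mult.left_commute)
    ultimately show ?thesis
      by (simp add: integral_test_kernel_lap[OF \<phi> W s] A_def right_diff_distrib sum_distrib_left)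
  qed
  \<comment> \<open>Here \<open>W\<close> is tested with the Laplacian of \<open>\<phi>\<close>
    while the \<open>v i\<close> contribute through their equations. The common factor
    \<open>bump_mass\<close> is positive and is divided out below.\<close>
  have A: "(A \<longlongrightarrow> bump_mass TYPE('n) 1 * (LBINT x. laplacian \<phi> x * W x)
      - (\<Sum>i\<in>I. bump_mass TYPE('n) 1 * (LBINT x. q i x * f i x))) (at_right 0)"
    unfolding A_def by (intro tendsto_intros mollify_tendsto_weakly W f q bounded_support_laplacian \<phi>)
  have "0 \<le> bump_mass TYPE('n) 1 * ((LBINT x. laplacian \<phi> x * W x) - (\<Sum>i\<in>I. LBINT x. q i x * f i x))"
    using derivative_limit_nonneg[OF h0 h_nonneg h' A] by (simp add: right_diff_distrib sum_distrib_left)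
  then have "(\<Sum>i\<in>I. LBINT x. q i x * f i x) \<le> (LBINT x. laplacian \<phi> x * W x)"
    using bump_mass_1_pos[where ?'n = 'n] by (simp add: zero_le_mult_iff)
  also have "(\<Sum>i\<in>I. LBINT x. q i x * f i x) = (LBINT x. (\<Sum>i\<in>I. q i x * f i x))"
    by (intro Bochner_Integration.integral_sum[symmetric] integrable_supp_mult q f)
  finally show "(LBINT x. \<phi> x * (\<Sum>i\<in>I. p i x * f i x)) \<le> (LBINT x. laplacian \<phi> x * W x)"
    by (simp add: q_def sum_distrib_left mult_ac)
qed

subsection \<open>Mean value inequalities\<close>

text \<open>Gronwall with the integrating factor exp(c s^2 / 2). No sign is imposed on
  \<open>c\<close> or \<open>F\<close>, so the lower bound below follows by applying it to -F with
  constant -K.\<close>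

lemma scale_growth:
  fixes F F' :: "real \<Rightarrow> real"
  assumes F: "\<And>s. s > 0 \<Longrightarrow> (F has_real_derivative F' s) (at s)"
    and F': "\<And>s. 0 < s \<Longrightarrow> s \<le> 1 \<Longrightarrow> F' s \<ge> - c * s * F s" and s: "0 < s" "s \<le> 1"
  shows "F s * exp (c * s\<^sup>2 / 2) \<le> F 1 * exp (c / 2)"
proof -
  have G: "((\<lambda>s. F s * exp (c * s\<^sup>2 / 2)) has_real_derivative (F' s + c * s * F s) * exp (c * s\<^sup>2 / 2)) (at s)" if "s > 0" for s
    using F[OF that] by (auto intro!: derivative_eq_intros simp: algebra_simps)
  have "F s * exp (c * s\<^sup>2 / 2) \<le> F 1 * exp (c * 1\<^sup>2 / 2)"
  proof (rule DERIV_nonneg_imp_nondecreasing[OF s(2)])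
    fix r assume r: "s \<le> r" "r \<le> 1"
    then have "(F' r + c * r * F r) * exp (c * r\<^sup>2 / 2) \<ge> 0"
      using F'[of r] s by (intro mult_nonneg_nonneg) auto
    then show "\<exists>y. ((\<lambda>s. F s * exp (c * s\<^sup>2 / 2)) has_real_derivative y) (at r) \<and> y \<ge> 0"
      using G[of r] r s by (intro exI[of _ "(F' r + c * r * F r) * exp (c * r\<^sup>2 / 2)"]) auto
  qed
  then show ?thesis
    by simp
qed

lemma scale_growth_upper:
  fixes F F' :: "real \<Rightarrow> real"
  assumes F: "\<And>s. s > 0 \<Longrightarrow> (F has_real_derivative F' s) (at s)" "\<And>s. s > 0 \<Longrightarrow> F s \<ge> 0" and K: "K \<ge> 0"
    and F': "\<And>s. 0 < s \<Longrightarrow> s \<le> 1 \<Longrightarrow> F' s \<ge> - K * s * F s" and s: "0 < s" "s \<le> 1"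
  shows "F s \<le> exp (K / 2) * F 1"
proof -
  have "F s * 1 \<le> F s * exp (K * s\<^sup>2 / 2)"
    using F(2) s K by (intro mult_left_mono) auto
  then show ?thesis
    using scale_growth[OF F(1) F' s] by (simp add: mult.commute)
qed

lemma scale_growth_lower:
  fixes F F' :: "real \<Rightarrow> real"
  assumes F: "\<And>s. s > 0 \<Longrightarrow> (F has_real_derivative F' s) (at s)" "\<And>s. s > 0 \<Longrightarrow> F s \<ge> 0" and K: "K \<ge> 0"
    and F': "\<And>s. 0 < s \<Longrightarrow> s \<le> 1 \<Longrightarrow> F' s \<le> K * s * F s" and s: "0 < s" "s \<le> 1"
  shows "exp (- K / 2) * F 1 \<le> F s"
proof -
  have "- F s * exp (- K * s\<^sup>2 / 2) \<le> - F 1 * exp (- K / 2)"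
    using F(1) F' s by (intro scale_growth[where F = "\<lambda>s. - F s" and F' = "\<lambda>s. - F' s"]) (auto intro!: derivative_intros)
  moreover have "F s * exp (- K * s\<^sup>2 / 2) \<le> F s * 1"
    using F(2) s K by (intro mult_left_mono) auto
  ultimately show ?thesis
    by (simp add: mult.commute)
qed

text \<open>The weak limit is tested with the indicator of the part of \<open>S\<close> where the
  claim fails, cut to a ball. This makes the integral of a nonnegative function nonpositive, so that
  set is null.\<close>

lemma AE_le_of_mollify_le:
  fixes w b :: "real ^ 'n \<Rightarrow> real"
  assumes w: "loc_integrable w" and b: "loc_integrable b" and S: "S \<in> sets borel"
    and le: "\<And>s x. 0 < s \<Longrightarrow> s \<le> 1 \<Longrightarrow> x \<in> S \<Longrightarrow> mollify P s w x \<le> b x"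
  shows "AE x in lborel. x \<in> S \<longrightarrow> bump_mass TYPE('n) P * w x \<le> b x"
proof -
  define c where "c = bump_mass TYPE('n) P"
  have [measurable]: "w \<in> borel_measurable borel" "b \<in> borel_measurable borel" "S \<in> sets borel"
    using w b S by measurable
  define T where "T n = S \<inter> {x. b x < c * w x} \<inter> cball 0 (real n)" for n
  have "AE x in lborel. indicator (T n) x * (c * w x - b x) = 0" for n
  proof -
    define q :: "real ^ 'n \<Rightarrow> real" where "q = indicator (T n)"
    have [measurable]: "cball 0 (real n) \<in> sets (borel :: (real ^ 'n) measure)"
      by simp
    have "q \<in> borel_measurable borel"
      unfolding q_def T_def by measurable
    then have q: "bounded_support q"
      by (rule bounded_supportI[of _ "real n" 1]) (auto simp: q_def T_def indicator_def)
    have int: "integrable lborel (\<lambda>x. q x * w x)" "integrable lborel (\<lambda>x. q x * b x)"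
      using integrable_supp_mult[OF q] w b by auto
    have ev: "eventually (\<lambda>s. (LBINT x. q x * mollify P s w x) \<le> (LBINT x. q x * b x)) (at_right 0)"
      unfolding eventually_at_right_field
    proof (intro exI[of _ 1] conjI allI impI)
      fix s :: real assume "0 < s" "s < 1"
      then show "(LBINT x. q x * mollify P s w x) \<le> (LBINT x. q x * b x)"
        using le[of s] int integrable_supp_mult[OF q loc_integrable_mollify[OF _ w]]
        by (intro integral_mono) (auto simp: q_def T_def indicator_def)
    qed simp
    have "c * (LBINT x. q x * w x) \<le> (LBINT x. q x * b x)"
      unfolding c_def by (rule tendsto_upperbound[OF mollify_tendsto_weakly[OF w q] ev]) simp
    then have "(LBINT x. q x * (c * w x - b x)) \<le> 0"
      using int by (simp add: right_diff_distrib mult.left_commute[of _ c])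
    moreover have nonneg: "q x * (c * w x - b x) \<ge> 0" for x
      by (auto simp: q_def T_def indicator_def)
    then have "(LBINT x. q x * (c * w x - b x)) \<ge> 0"
      by simp
    ultimately have "(LBINT x. q x * (c * w x - b x)) = 0"
      by simp
    moreover have "integrable lborel (\<lambda>x. q x * (c * w x - b x))"
      using int by (simp add: right_diff_distrib mult.left_commute[of _ c])
    ultimately show ?thesis
      using integral_nonneg_eq_0_iff_AE[of lborel "\<lambda>x. q x * (c * w x - b x)"] nonneg by (simp add: q_def)
  qed
  then have "AE x in lborel. \<forall>n. indicator (T n) x * (c * w x - b x) = 0"
    unfolding AE_all_countable by blast
  then show ?thesis
  proof eventually_elim
    fix x assume *: "\<forall>n. indicator (T n) x * (c * w x - b x) = 0"
    obtain n :: nat where "norm x \<le> real n"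
      using real_arch_simple by blast
    then show "x \<in> S \<longrightarrow> bump_mass TYPE('n) P * w x \<le> b x"
      using *[rule_format, of n] by (auto simp: T_def indicator_def c_def[symmetric] not_less[symmetric])
  qed
qed

lemma mollify_nonneg:
  assumes "s > 0" "\<And>t. t \<ge> 0 \<Longrightarrow> bump P t \<ge> 0" "\<And>x. w x \<ge> 0"
  shows "mollify P s w x \<ge> 0"
  unfolding mollify_def by (intro integral_nonneg_AE AE_I2 mult_nonneg_nonneg kernel_nonneg assms)

lemma mollify_1_le_rho:
  assumes s: "s > 0" and w: "loc_integrable w" "\<And>x. w x \<ge> 0"
  shows "mollify 1 s w x \<le> mollify rho s w x / 2"
proof -
  have "mollify 1 s w x \<le> (LBINT z. kernel rho s x z * w z / 2)"
    unfolding mollify_def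
  proof (rule integral_mono)
    fix z
    have "kernel 1 s x z \<le> kernel rho s x z / 2"
      using divide_right_mono[OF bump_1_le_rho[of "1 / s\<^sup>2 * (norm (z - x))\<^sup>2"], of "s ^ CARD('a)"] s
      by (simp add: kernel_def)
    then show "kernel 1 s x z * w z \<le> kernel rho s x z * w z / 2"
      using mult_right_mono[OF _ w(2)[of z]] by fastforce
  qed (use integrable_kernel_mult[OF s w(1)] in auto)
  then show ?thesis
    by (simp add: mollify_def)
qed

text \<open>The scale derivative at r is at least -M r \<open>mollify 1 r w x\<close>, hence at
  least -(M / 2) r \<open>mollify rho r w x\<close>. Integrating from s to 1 costs at most the
  factor exp(M / 4), uniformly as s tends to 0.\<close>

lemma subsolution_mean_value:
  fixes w :: "real ^ 'n \<Rightarrow> real"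
  assumes w: "weak_laplacian_ge w (\<lambda>x. - M * w x)" "\<And>x. w x \<ge> 0" and M: "M \<ge> 0"
  shows "AE x in lborel. bump_mass TYPE('n) rho * w x \<le> exp (M / 4) * mollify rho 1 w x"
proof -
  have li: "loc_integrable w"
    using w(1) by (simp add: weak_laplacian_ge_def)
  have "mollify rho s w x \<le> exp (M / 2 / 2) * mollify rho 1 w x" if "0 < s" "s \<le> 1" for s x
  proof (rule scale_growth_upper[OF DERIV_mollify_scale[OF _ li] mollify_nonneg _ _ that])
    fix r :: real assume r: "0 < r" "r \<le> 1"
    have "r * mollify 1 r w x \<le> r * (mollify rho r w x / 2)"
      using mollify_1_le_rho[OF r(1) li w(2)] r by (intro mult_left_mono) auto
    then have "M * (r * mollify 1 r w x) \<le> M * (r * (mollify rho r w x / 2))"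
      using M by (rule mult_left_mono)
    moreover have "mollify 1 r (\<lambda>x. - M * w x) x = - M * mollify 1 r w x"
      by (simp add: mollify_def mult.left_commute[of _ M])
    ultimately show "- (M / 2) * r * mollify rho r w x \<le> (LBINT z. kernel_lap r x z * w z)"
      using kernel_lap_weak_ge[OF w(1) r(1), of x] by (simp add: mult_ac)
  qed (use M w(2) bump_rho_nonneg in auto)
  moreover have "loc_integrable (\<lambda>x. exp (M / 4) * mollify rho 1 w x)"
    by (intro loc_integrable_cmult loc_integrable_mollify li) auto
  ultimately show ?thesis
    using AE_le_of_mollify_le[OF li, of "\<lambda>x. exp (M / 4) * mollify rho 1 w x" UNIV rho] by simp
qed

lemma continuous_mollify:
  fixes f :: "real ^ 'n \<Rightarrow> real"
  assumes s: "s > 0" and f: "loc_integrable f"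
  shows "continuous_on UNIV (mollify P s f)"
  unfolding continuous_on_sequentially
proof (intro allI ballI impI, elim conjE)
  fix X :: "nat \<Rightarrow> real ^ 'n" and a assume X: "X \<longlonglongrightarrow> a"
  obtain C where C: "local_kernel (kernel P s :: real ^ 'n \<Rightarrow> _) C s"
    using local_kernel_kernel[OF s] by blast
  obtain B where B: "\<And>n. norm (X n) \<le> B"
    using convergent_imp_Bseq[of X] X by (auto simp: Bseq_def convergent_def)
  have [measurable]: "f \<in> borel_measurable borel"
    using f by measurable
  have "(\<lambda>n. LBINT z. kernel P s (X n) z * f z) \<longlonglongrightarrow> (LBINT z. kernel P s a z * f z)"
  proof (rule integral_dominated_convergence)
    show "integrable lborel (\<lambda>z. C * (indicator (cball 0 (B + s)) z * \<bar>f z\<bar>))"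
      using loc_integrable_abs[OF f] by (auto simp: loc_integrable_def)
    show "AE z in lborel. norm (kernel P s (X n) z * f z) \<le> C * (indicator (cball 0 (B + s)) z * \<bar>f z\<bar>)" for n
    proof (intro AE_I2)
      fix z
      have "\<bar>kernel P s (X n) z\<bar> \<le> C * indicator (cball 0 (B + s)) z"
      proof (cases "norm z \<le> B + s")
        case False
        then have "norm (z - X n) > s"
          using norm_triangle_ineq2[of z "X n"] B[of n] by simp
        then show ?thesis
          using C by (simp add: local_kernel_def)
      qed (use C in \<open>simp add: local_kernel_def\<close>)
      then show "norm (kernel P s (X n) z * f z) \<le> C * (indicator (cball 0 (B + s)) z * \<bar>f z\<bar>)"
        by (simp add: abs_mult mult.assoc[symmetric] mult_right_mono)
    qed
    show "AE z in lborel. (\<lambda>n. kernel P s (X n) z * f z) \<longlonglongrightarrow> kernel P s a z * f z"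
      unfolding kernel_def using X
      by (intro AE_I2 tendsto_intros isCont_tendsto_compose[of _ "bump P"])
        (use continuous_on_bump[of UNIV P] in \<open>auto simp: continuous_on_eq_continuous_at\<close>)
    have "integrable lborel (\<lambda>z. kernel P s x z * f z)" for x
      by (rule integrable_kernel_mult[OF s f])
    then show "(\<lambda>z. kernel P s x z * f z) \<in> borel_measurable lborel" for x
      by auto
    then show "(\<lambda>z. kernel P s x z * f z) \<in> borel_measurable lborel" for x
      by auto
  qed
  then show "(mollify P s f \<circ> X) \<longlonglongrightarrow> mollify P s f a"
    by (simp add: o_def mollify_def)
qed

lemma mollify_rho_pos:
  fixes u :: "real ^ 'n \<Rightarrow> real"
  assumes u: "loc_integrable u" "\<And>x. u x \<ge> 0" "AE x in lborel. u x > 0"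
  shows "mollify rho 1 u x > 0"
proof (rule ccontr)
  assume "\<not> mollify rho 1 u x > 0"
  then have "(LBINT z. kernel rho 1 x z * u z) = 0"
    using mollify_nonneg[of 1 rho u x] bump_rho_nonneg u(2) by (simp add: mollify_def)
  moreover have "kernel rho 1 x z * u z \<ge> 0" for z
    by (intro mult_nonneg_nonneg kernel_nonneg bump_rho_nonneg u(2)) auto
  ultimately have "AE z in lborel. kernel rho 1 x z * u z = 0"
    using integrable_kernel_mult[of 1 u rho x] u(1) by (subst (asm) integral_nonneg_eq_0_iff_AE) auto
  with u(3) have "AE z in lborel. kernel rho 1 x z = 0"
    by eventually_elim auto
  then have "(LBINT z. kernel rho 1 x z) = (LINT z|(lborel :: (real ^ 'n) measure). 0)"
    by (intro integral_cong_AE) (auto simp: kernel_def)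
  then show False
    using integral_kernel[of 1 rho x] bump_mass_rho_pos[where ?'n = 'n] by simp
qed

text \<open>The mean value argument with reversed inequality bounds u from below by a multiple of
  its average at scale 1, a continuous positive function with a positive minimum on the ball. The
  hypothesis reaches to R + 1 because kernels of scale up to 1 are centred in the ball of radius
  R.\<close>

lemma positive_supersolution_bounded_below:
  fixes u f :: "real ^ 'n \<Rightarrow> real"
  assumes u: "weak_laplacian u f" "\<And>x. u x \<ge> 0" "AE x in lborel. u x > 0"
    and f: "AE x in lborel. norm x \<le> R + 1 \<longrightarrow> f x \<le> M * u x" and M: "M \<ge> 0" and R: "R \<ge> 0"
  shows "\<exists>m>0. AE x in lborel. norm x \<le> R \<longrightarrow> m \<le> u x"
proof -
  define c where "c = bump_mass TYPE('n) rho"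
  have c: "c > 0"
    unfolding c_def by (rule bump_mass_rho_pos)
  have li: "loc_integrable u" "loc_integrable f"
    using u(1) by (auto simp: weak_laplacian_def)
  have F: "exp (- (M / 2) / 2) * mollify rho 1 u x \<le> mollify rho s u x" if "0 < s" "s \<le> 1" "norm x \<le> R" for s x
  proof (rule scale_growth_lower[OF DERIV_mollify_scale[OF _ li(1)] mollify_nonneg _ _ that(1,2)])
    fix r :: real assume r: "0 < r" "r \<le> 1"
    have "mollify 1 r f x \<le> (LBINT z. M * (kernel 1 r x z * u z))"
      unfolding mollify_def
    proof (rule integral_mono_AE)
      show "AE z in lborel. kernel 1 r x z * f z \<le> M * (kernel 1 r x z * u z)"
        using f
      proof eventually_elim
        fix z assume fz: "norm z \<le> R + 1 \<longrightarrow> f z \<le> M * u z"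
        show "kernel 1 r x z * f z \<le> M * (kernel 1 r x z * u z)"
        proof (cases "norm z \<le> R + 1")
          case True
          then have "f z \<le> M * u z"
            using fz by simp
          from mult_left_mono[OF this kernel_nonneg[OF r(1) bump_1_nonneg, of x z]] show ?thesis
            by (simp add: mult_ac)
        next
          case False
          then have "norm (z - x) \<ge> r"
            using norm_triangle_ineq2[of z x] that(3) r by simp
          then show ?thesis
            using scaled_dist_ge_1[OF r(1), of z x] by (simp add: kernel_def bump_eq_0)
        qed
      qed
    qed (use integrable_kernel_mult[OF r(1)] li in auto)
    then have "mollify 1 r f x \<le> M * mollify 1 r u x"
      by (simp add: mollify_def)
    also have "\<dots> \<le> M * (mollify rho r u x / 2)"
      using M mollify_1_le_rho[OF r(1) li(1) u(2)] by (intro mult_left_mono) auto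
    finally have "r * mollify 1 r f x \<le> r * (M * (mollify rho r u x / 2))"
      using r by (intro mult_left_mono) auto
    then show "(LBINT z. kernel_lap r x z * u z) \<le> M / 2 * r * mollify rho r u x"
      using kernel_lap_weak[OF u(1) r(1), of x] by (simp add: mult_ac)
  qed (use M u(2) bump_rho_nonneg in auto)
  have neg: "mollify rho s (\<lambda>x. - u x) x = - mollify rho s u x" for s x
    by (simp add: mollify_def)
  \<comment> \<open>\<open>AE_le_of_mollify_le\<close> passes upper bounds to the limit, so the
    lower bound is fed in for \<open>- u\<close>.\<close>
  have "AE x in lborel. x \<in> cball 0 R \<longrightarrow> c * - u x \<le> - (exp (- (M / 2) / 2) * mollify rho 1 u x)"
    unfolding c_def
  proof (rule AE_le_of_mollify_le)
    show "loc_integrable (\<lambda>x. - u x)"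
      using loc_integrable_cmult[OF li(1), of "-1"] by simp
    show "loc_integrable (\<lambda>x. - (exp (- (M / 2) / 2) * mollify rho 1 u x))"
      using loc_integrable_cmult[OF loc_integrable_mollify[OF _ li(1), of 1 rho], of "- exp (- (M / 2) / 2)"] by simp
  qed (use F in \<open>auto simp: neg\<close>)
  moreover obtain m where m: "m > 0" "\<And>x. norm x \<le> R \<Longrightarrow> m \<le> mollify rho 1 u x"
  proof -
    have "continuous_on (cball 0 R) (mollify rho 1 u)"
      using continuous_on_subset[OF continuous_mollify[OF _ li(1)]] by auto
    then obtain y where "y \<in> cball 0 R" "\<And>x. x \<in> cball 0 R \<Longrightarrow> mollify rho 1 u y \<le> mollify rho 1 u x"
      using continuous_attains_inf[of "cball 0 R" "mollify rho 1 u"] R by auto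
    then show ?thesis
      using that[of "mollify rho 1 u y"] mollify_rho_pos[OF li(1) u(2,3)] by auto
  qed
  ultimately have "AE x in lborel. norm x \<le> R \<longrightarrow> exp (- (M / 2) / 2) * m / c \<le> u x"
  proof (elim AE_mp, intro AE_I2 impI)
    fix x assume "x \<in> cball 0 R \<longrightarrow> c * - u x \<le> - (exp (- (M / 2) / 2) * mollify rho 1 u x)" "norm x \<le> R"
    then have "exp (- (M / 2) / 2) * mollify rho 1 u x \<le> c * u x"
      by simp
    moreover have "exp (- (M / 2) / 2) * m \<le> exp (- (M / 2) / 2) * mollify rho 1 u x"
      using m(2)[OF \<open>norm x \<le> R\<close>] by simp
    ultimately have "exp (- (M / 2) / 2) * m \<le> c * u x"
      by linarith
    then show "exp (- (M / 2) / 2) * m / c \<le> u x"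
      using c by (simp add: divide_le_eq mult.commute)
  qed
  then show ?thesis
    using m(1) c by (intro exI[of _ "exp (- (M / 2) / 2) * m / c"]) auto
qed

subsection \<open>A comparison principle on the whole space\<close>

text \<open>Testing with the bump of scale s about 0 gives I(s / 2) \<le> D s^-2 I(s) for the
  integral I over balls. Iteration beats every polynomial growth rate, so I(s) tends to 0; being
  nonnegative and increasing, it vanishes.\<close>

lemma Liouville_growth:
  fixes W f :: "real ^ 'n \<Rightarrow> real"
  assumes W: "weak_laplacian_ge W f" "\<And>x. W x \<ge> 0" and f: "AE x in lborel. W x \<le> f x"
    and growth: "\<And>s. s \<ge> 1 \<Longrightarrow> (LBINT x. indicator (cball 0 s) x * W x) \<le> C * s ^ m"
  shows "AE x in lborel. W x = 0"
proof -
  have li: "loc_integrable W" "loc_integrable f"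
    using W(1) by (auto simp: weak_laplacian_ge_def)
  define I where "I = (\<lambda>s. LBINT x. indicator (cball 0 s) x * W x)"
  have int: "integrable lborel (\<lambda>x. indicator (cball 0 s) x * W x)" for s
    using li(1) by (auto simp: loc_integrable_def)
  have I_nonneg: "I s \<ge> 0" for s
    unfolding I_def using W(2) by simp
  have I_mono: "I s \<le> I t" if "s \<le> t" for s t
    unfolding I_def using that W(2) by (intro integral_mono int) (auto simp: indicator_def)
  obtain C0 where C0: "C0 > 0" "\<And>s x z. s > 0 \<Longrightarrow> \<bar>kernel_lap s (x :: real ^ 'n) z\<bar> \<le> C0 / s ^ (CARD('n) + 1)"
    using kernel_lap_bound by blast
  \<comment> \<open>C0 comes from the bound on the Laplacian of the test function; exp 2 comes from
    its lower bound exp(-2) s^-N on the ball of radius s / 2.\<close>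
  define D where "D = C0 * exp 2"
  have D: "D > 0"
    using C0 by (simp add: D_def)
  have step: "I (s / 2) \<le> D / s\<^sup>2 * I s" if s: "s > 0" for s
  proof -
    have "exp (- 2) / s ^ CARD('n) * I (s / 2) = (LBINT z. exp (- 2) / s ^ CARD('n) * (indicator (cball 0 (s / 2)) z * W z))"
      unfolding I_def by simp
    also have "\<dots> \<le> (LBINT z. kernel 1 s 0 z * W z)"
    proof (rule integral_mono)
      fix z :: "real ^ 'n"
      have "exp (- 2) / s ^ CARD('n) * indicator (cball 0 (s / 2)) z \<le> kernel 1 s 0 z"
      proof (cases "norm z \<le> s / 2")
        case True
        define t where "t = 1 / s\<^sup>2 * (norm z)\<^sup>2"
        have "t \<le> 1 / s\<^sup>2 * (s / 2)\<^sup>2"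
          unfolding t_def using True by (intro mult_left_mono power_mono) auto
        then have "t \<le> 1 / 4"
          using s by (simp add: power2_eq_square)
        then have "t < 1" "1 / (1 - t) \<le> 2"
          by (auto simp: field_simps)
        then have "exp (- 2) \<le> bump 1 t"
          by (simp add: bump_def)
        then show ?thesis
          using True divide_right_mono[of "exp (- 2)" "bump 1 t" "s ^ CARD('n)"] s by (simp add: kernel_def t_def)
      qed (use kernel_nonneg[OF s bump_1_nonneg] in simp)
      then show "exp (- 2) / s ^ CARD('n) * (indicator (cball 0 (s / 2)) z * W z) \<le> kernel 1 s 0 z * W z"
        using mult_right_mono[OF _ W(2)] by (simp only: mult.assoc[symmetric])
    qed (use int integrable_kernel_mult[OF s li(1)] in auto)
    also have "\<dots> \<le> (LBINT z. kernel 1 s 0 z * f z)"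
    proof (rule integral_mono_AE)
      show "AE z in lborel. kernel 1 s 0 z * W z \<le> kernel 1 s 0 z * f z"
        using f by eventually_elim (intro mult_left_mono kernel_nonneg[OF s bump_1_nonneg])
    qed (use integrable_kernel_mult[OF s] li in auto)
    finally have "s * (exp (- 2) / s ^ CARD('n) * I (s / 2)) \<le> s * mollify 1 s f 0"
      unfolding mollify_def using s by (intro mult_left_mono) auto
    also have "\<dots> \<le> (LBINT z. kernel_lap s 0 z * W z)"
      by (rule kernel_lap_weak_ge[OF W(1) s])
    also have "\<dots> \<le> (LBINT z. C0 / s ^ (CARD('n) + 1) * (indicator (cball 0 s) z * W z))"
    proof (rule integral_mono)
      obtain C b where "local_kernel (kernel_lap s :: real ^ 'n \<Rightarrow> _) C b"
        using local_kernel_kernel_lap'[OF s] by blast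
      then show "integrable lborel (\<lambda>z. kernel_lap s 0 z * W z)"
        by (intro integrable_supp_mult[OF _ li(1)] local_kernel_bounded_support)
      fix z :: "real ^ 'n"
      have "kernel_lap s 0 z \<le> C0 / s ^ (CARD('n) + 1) * indicator (cball 0 s) z"
        using kernel_lap_eq_0[OF s, of z 0] C0(2)[OF s, of 0 z] by (auto simp: indicator_def abs_le_iff not_le)
      then show "kernel_lap s 0 z * W z \<le> C0 / s ^ (CARD('n) + 1) * (indicator (cball 0 s) z * W z)"
        using mult_right_mono[OF _ W(2)] by (simp only: mult.assoc[symmetric])
    qed (use int in auto)
    also have "\<dots> = C0 / s ^ (CARD('n) + 1) * I s"
      by (simp add: I_def)
    finally have "s * (exp (- 2) / s ^ CARD('n) * I (s / 2)) \<le> C0 / s ^ (CARD('n) + 1) * I s" .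
    then have "(exp 2 * s ^ CARD('n) / s) * (s * (exp (- 2) / s ^ CARD('n) * I (s / 2)))
        \<le> (exp 2 * s ^ CARD('n) / s) * (C0 / s ^ (CARD('n) + 1) * I s)"
      using s by (intro mult_left_mono) auto
    then show ?thesis
      using s by (simp add: D_def exp_minus power2_eq_square field_simps)
  qed
  have decay: "\<exists>C\<ge>0. \<forall>s\<ge>1. I s \<le> C * s ^ m / s ^ k" for k
  proof (induction k)
    case 0
    have "I s \<le> \<bar>C\<bar> * s ^ m" if "s \<ge> 1" for s
      unfolding I_def using that by (intro order_trans[OF growth[OF that]] mult_right_mono) auto
    then show ?case
      by (intro exI[of _ "\<bar>C\<bar>"]) auto
  next
    case (Suc k)
    then obtain C where C: "C \<ge> 0" "\<And>s. s \<ge> 1 \<Longrightarrow> I s \<le> C * s ^ m / s ^ k"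
      by blast
    \<comment> \<open>One application at 2 s: the factor 2^m pays for replacing s by 2 s in the
      growth term, and only one of the two gained powers of s is kept, which is enough.\<close>
    have "I s \<le> (D * C * 2 ^ m) * s ^ m / s ^ Suc k" if s: "s \<ge> 1" for s
    proof -
      have "I s \<le> D / (2 * s)\<^sup>2 * I (2 * s)"
        using step[of "2 * s"] s by simp
      also have "\<dots> \<le> D / s * (C * 2 ^ m * s ^ m / s ^ k)"
      proof (rule mult_mono)
        show "D / (2 * s)\<^sup>2 \<le> D / s"
          using s D by (intro divide_left_mono) (auto simp: power2_eq_square)
        have "I (2 * s) \<le> C * (2 * s) ^ m / (2 * s) ^ k"
          using C(2)[of "2 * s"] s by simp
        also have "\<dots> \<le> C * (2 * s) ^ m / s ^ k"
          using s C(1) by (intro divide_left_mono power_mono mult_nonneg_nonneg) auto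
        finally show "I (2 * s) \<le> C * 2 ^ m * s ^ m / s ^ k"
          by (simp add: power_mult_distrib mult.assoc)
      qed (use s D I_nonneg in auto)
      finally show ?thesis
        by (simp add: mult_ac)
    qed
    then show ?case
      using C(1) D by (intro exI[of _ "D * C * 2 ^ m"]) auto
  qed
  obtain C' where C': "C' \<ge> 0" "\<And>s. s \<ge> 1 \<Longrightarrow> I s \<le> C' * s ^ m / s ^ Suc m"
    using decay[of "Suc m"] by blast
  have I0: "I s = 0" for s
  proof (rule antisym[OF field_le_epsilon I_nonneg])
    fix e :: real assume e: "e > 0"
    define t where "t = max (max s 1) (C' / e)"
    have t: "t \<ge> 1" "t \<ge> s" "t \<ge> C' / e"
      by (auto simp: t_def)
    have "I s \<le> C' * t ^ m / t ^ Suc m"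
      using I_mono[OF t(2)] C'(2)[OF t(1)] by simp
    also have "\<dots> = C' / t"
      using t(1) by simp
    also have "\<dots> \<le> e"
      using t(1,3) e by (simp add: field_simps)
    finally show "I s \<le> 0 + e"
      by simp
  qed
  have "AE x in lborel. indicator (cball 0 (real n)) x * W x = 0" for n
    using I0[of "real n"] int[of "real n"] W(2) unfolding I_def
    by (subst (asm) integral_nonneg_eq_0_iff_AE) auto
  then have "AE x in lborel. \<forall>n. indicator (cball 0 (real n)) x * W x = 0"
    unfolding AE_all_countable by blast
  then show ?thesis
  proof eventually_elim
    fix x assume *: "\<forall>n. indicator (cball 0 (real n)) x * W x = 0"
    obtain n :: nat where "norm x \<le> real n"
      using real_arch_simple by blast
    then show "W x = 0"
      using *[rule_format, of n] by simp
  qed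
qed

text \<open>Since |u| \<le> 1 + u^2, square integrability leaves only multiples of the volume of the
  ball, of order s^N.\<close>

lemma L2_ball_growth:
  fixes u v :: "real ^ 'n \<Rightarrow> real"
  assumes u: "integrable lborel (\<lambda>x. (u x)\<^sup>2)" and v: "loc_integrable v"
    and bound: "\<And>x. v x \<le> \<bar>u x\<bar> + K" and K: "K \<ge> 0"
  shows "\<exists>C. \<forall>s\<ge>1. (LBINT x. indicator (cball 0 s) x * max 0 (v x)) \<le> C * s ^ CARD('n)"
proof -
  have li: "loc_integrable (\<lambda>x. max 0 (v x))"
    using v by (intro loc_integrable_bound[OF v]) (auto intro!: exI[of _ 1])
  define V where "V = measure lborel (cball 0 1 :: (real ^ 'n) set)"
  define U where "U = (LBINT x. (u x)\<^sup>2)"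
  have "U \<ge> 0"
    by (simp add: U_def)
  have "(LBINT x. indicator (cball 0 s) x * max 0 (v x)) \<le> (U + (1 + K) * V) * s ^ CARD('n)" if s: "s \<ge> 1" for s
  proof -
    have "(LBINT x. indicator (cball 0 s) x * max 0 (v x)) \<le> (LBINT x. (u x)\<^sup>2 + (1 + K) * indicator (cball 0 s) x)"
    proof (rule integral_mono)
      fix x
      have "\<bar>u x\<bar> \<le> 1 + (u x)\<^sup>2"
        using sum_squares_bound[of "\<bar>u x\<bar>" 1] by (simp add: power2_eq_square)
      then have "max 0 (v x) \<le> (u x)\<^sup>2 + (1 + K)"
        using bound[of x] K by (auto simp: max_def intro: add_nonneg_nonneg)
      then show "indicator (cball 0 s) x * max 0 (v x) \<le> (u x)\<^sup>2 + (1 + K) * indicator (cball 0 s) x"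
        by (auto simp: indicator_def)
    qed (use li u integrable_indicator_cball[of 0 s] in \<open>auto simp: loc_integrable_def\<close>)
    also have "\<dots> = U + (1 + K) * measure lborel (cball 0 s :: (real ^ 'n) set)"
      using u by (simp add: U_def integrable_indicator_cball)
    also have "measure lborel (cball 0 s :: (real ^ 'n) set) = V * s ^ CARD('n)"
      unfolding V_def using s by (simp add: content_cball)
    also have "U + (1 + K) * (V * s ^ CARD('n)) \<le> U * s ^ CARD('n) + (1 + K) * (V * s ^ CARD('n))"
      using mult_left_mono[OF one_le_power[OF s] \<open>U \<ge> 0\<close>] by simp
    finally show ?thesis
      by (simp add: algebra_simps)
  qed
  then show ?thesis
    by blast
qed

text \<open>The positive part of \<open>v\<close> satisfies the hypotheses of the Liouville lemma:
  it vanishes in the ball, its Laplacian dominates it outside, and the bound in terms of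
  \<open>u\<close> and \<open>K\<close> controls its growth.\<close>

lemma weak_comparison:
  fixes v f :: "real ^ 'n \<Rightarrow> real"
  assumes v: "weak_laplacian v f" and inner: "AE x in lborel. norm x \<le> R \<longrightarrow> v x \<le> 0"
    and outer: "AE x in lborel. norm x > R \<longrightarrow> v x > 0 \<longrightarrow> v x \<le> f x"
    and u: "integrable lborel (\<lambda>x. (u x)\<^sup>2)" "\<And>x. v x \<le> \<bar>u x\<bar> + K" "K \<ge> 0"
  shows "AE x in lborel. v x \<le> 0"
proof -
  have li: "loc_integrable v" "loc_integrable f"
    using v by (auto simp: weak_laplacian_def)
  have [measurable]: "v \<in> borel_measurable borel"
    using li by measurable
  have li': "loc_integrable (\<lambda>x. max 0 (v x))"
    by (rule loc_integrable_bound[OF li(1)]) (auto intro!: exI[of _ 1])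
  \<comment> \<open>Scalar Kato inequality, phrased with a one-element index set. The indicator of
    positivity is a subgradient of the positive part; at 0 it takes the value 0.\<close>
  have "weak_laplacian_ge (\<lambda>x. max 0 (v x)) (\<lambda>x. \<Sum>i\<in>{()}. indicator {x. v x > 0} x * f x)"
  proof (rule Kato_inequality[where v = "\<lambda>_. v" and K = 1])
    show "max 0 (v x) + (\<Sum>i\<in>{()}. indicator {x. v x > 0} x * (v y - v x)) \<le> max 0 (v y)" for x y
      by (auto simp: indicator_def)
  qed (use v li' in \<open>auto simp: indicator_def\<close>)
  then have "weak_laplacian_ge (\<lambda>x. max 0 (v x)) (\<lambda>x. indicator {x. v x > 0} x * f x)"
    by simp
  moreover have "AE x in lborel. max 0 (v x) \<le> indicator {x. v x > 0} x * f x"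
    using inner outer by eventually_elim (auto simp: indicator_def not_le not_less)
  moreover obtain C where "\<And>s. s \<ge> 1 \<Longrightarrow> (LBINT x. indicator (cball 0 s) x * max 0 (v x)) \<le> C * s ^ CARD('n)"
    using L2_ball_growth[OF u(1) li(1) u(2,3)] by blast
  ultimately have "AE x in lborel. max 0 (v x) = 0"
    by (intro Liouville_growth) auto
  then show ?thesis
    by eventually_elim auto
qed

subsection \<open>Radial barriers\<close>

text \<open>At t = |x|^2 this is a substitute for 1 / |x| that is smooth at the origin, so the
  barriers are C^2 on the whole space.\<close>

definition inv_sqrt1 :: "real \<Rightarrow> real" where
  "inv_sqrt1 t = 1 / sqrt (1 + t)"

lemma inv_sqrt1_bounds:
  assumes "t \<ge> 0"
  shows "inv_sqrt1 t > 0" "inv_sqrt1 t \<le> 1" "(inv_sqrt1 t)\<^sup>2 = 1 / (1 + t)"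
  using assms by (auto simp: inv_sqrt1_def power_divide)

lemma DERIV_inv_sqrt1:
  assumes "t \<ge> 0"
  shows "(inv_sqrt1 has_real_derivative (- (inv_sqrt1 t ^ 3) / 2)) (at t)"
proof -
  have "sqrt (1 + t) * sqrt (1 + t) = 1 + t" "sqrt (1 + t) > 0"
    using assms by auto
  then show ?thesis
    unfolding inv_sqrt1_def using assms
    by (auto intro!: derivative_eq_intros simp: power3_eq_cube field_simps)
qed

text \<open>The exponent has the logarithmic correction that produces the power of \<open>|x|\<close> in the
  asymptotics; the last term perturbs the Laplacian by \<open>2 * \<sigma> / |x|\<close>, which dominates the
  remaining errors of order \<open>1 / |x|\<^sup>2\<close> and makes the function a strict sub- or supersolution
  according to the sign of \<open>\<sigma>\<close>.\<close>

definition barrier_exponent :: "real \<Rightarrow> real \<Rightarrow> real \<Rightarrow> real" where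
  "barrier_exponent a \<sigma> t = a / 2 * ln (1 + t) - t / 2 + \<sigma> * inv_sqrt1 t"

definition barrier :: "real \<Rightarrow> real \<Rightarrow> real ^ 'n \<Rightarrow> real" where
  "barrier a \<sigma> x = exp (barrier_exponent a \<sigma> ((norm x)\<^sup>2))"

context
  fixes a \<sigma> :: real
begin

definition barrier_exponent' :: "real \<Rightarrow> real" where
  "barrier_exponent' t = a / 2 * (inv_sqrt1 t)\<^sup>2 - 1 / 2 - \<sigma> / 2 * (inv_sqrt1 t) ^ 3"

definition barrier_exponent'' :: "real \<Rightarrow> real" where
  "barrier_exponent'' t = - a / 2 * (inv_sqrt1 t) ^ 4 + 3 * \<sigma> / 4 * (inv_sqrt1 t) ^ 5"

lemma DERIV_barrier_exponent:
  assumes "t \<ge> 0"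
  shows "(barrier_exponent a \<sigma> has_real_derivative barrier_exponent' t) (at t)"
proof -
  have "((\<lambda>t. a / 2 * ln (1 + t) - t / 2) has_real_derivative a / 2 * (1 / (1 + t)) - 1 / 2) (at t)"
    using assms by (auto intro!: derivative_eq_intros simp: field_simps)
  from DERIV_add[OF this DERIV_cmult[OF DERIV_inv_sqrt1[OF assms], of \<sigma>]] show ?thesis
    by (simp add: barrier_exponent_def[abs_def] barrier_exponent'_def inv_sqrt1_bounds(3)[OF assms])
qed

lemma DERIV_barrier_exponent':
  assumes "t \<ge> 0"
  shows "(barrier_exponent' has_real_derivative barrier_exponent'' t) (at t)"
  unfolding barrier_exponent'_def[abs_def] barrier_exponent''_def
  using assms
  by (auto intro!: derivative_eq_intros DERIV_inv_sqrt1 simp: power2_eq_square power3_eq_cube eval_nat_numeral algebra_simps)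

text \<open>The exponential of the exponent and its first two derivatives in t, indexed as
  \<open>Ck_compose\<close> expects. From index 2 on the entry is constantly the second derivative;
  only indices up to 2 are used as derivatives.\<close>

definition barrier_jet :: "nat \<Rightarrow> real \<Rightarrow> real" where
  "barrier_jet i t = exp (barrier_exponent a \<sigma> t) *
     (if i = 0 then 1 else if i = 1 then barrier_exponent' t else (barrier_exponent' t)\<^sup>2 + barrier_exponent'' t)"

lemma DERIV_barrier_jet:
  assumes "i < 2" "t \<ge> 0"
  shows "(barrier_jet i has_real_derivative barrier_jet (Suc i) t) (at t)"
proof -
  consider "i = 0" | "i = 1"
    using assms(1) by linarith
  then show ?thesis
  proof cases
    case 1
    have "((\<lambda>t. exp (barrier_exponent a \<sigma> t)) has_real_derivative exp (barrier_exponent a \<sigma> t) * barrier_exponent' t) (at t)"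
      by (auto intro!: derivative_eq_intros DERIV_barrier_exponent assms(2))
    with 1 show ?thesis
      by (simp add: barrier_jet_def[abs_def])
  next
    case 2
    have "((\<lambda>t. exp (barrier_exponent a \<sigma> t) * barrier_exponent' t) has_real_derivative
        exp (barrier_exponent a \<sigma> t) * ((barrier_exponent' t)\<^sup>2 + barrier_exponent'' t)) (at t)"
      by (auto intro!: derivative_eq_intros DERIV_barrier_exponent DERIV_barrier_exponent' assms(2)
          simp: power2_eq_square algebra_simps)
    with 2 show ?thesis
      by (simp add: barrier_jet_def[abs_def])
  qed
qed

lemma Ck_barrier: "Ck 2 (barrier a \<sigma> :: real ^ 'n \<Rightarrow> real)"
proof -
  have "Ck 2 (\<lambda>x :: real ^ 'n. barrier_jet 0 ((norm x)\<^sup>2))"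
  proof (rule Ck_compose[where G = barrier_jet and h = "\<lambda>x :: real ^ 'n. (norm x)\<^sup>2"])
    show "Ck 2 (\<lambda>x :: real ^ 'n. (norm x)\<^sup>2)"
      using Ck_norm_diff_sq[of 2 1 0] by simp
    have "continuous_on {0..} inv_sqrt1" "continuous_on {0..} (barrier_exponent a \<sigma>)"
      using DERIV_inv_sqrt1 DERIV_barrier_exponent
      by (auto intro!: continuous_at_imp_continuous_on DERIV_isCont)
    then have "continuous_on {0..} (barrier_jet 2)"
      unfolding barrier_jet_def[abs_def] barrier_exponent'_def barrier_exponent''_def
      by (auto intro!: continuous_intros)
    then show "continuous_on UNIV (\<lambda>x :: real ^ 'n. barrier_jet 2 ((norm x)\<^sup>2))"
      by (rule continuous_on_compose2) (auto intro!: continuous_intros)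
  qed (simp add: DERIV_barrier_jet)
  then show ?thesis
    by (simp add: barrier_jet_def barrier_def[abs_def])
qed

text \<open>The identity t y^2 = 1 - y^2 removes t from every term but the leading one. What remains
  is t - 2 a - N, the correction 2 \<sigma> y of order 1 / |x|, and an error of order y^2.\<close>

lemma laplacian_barrier:
  fixes x :: "real ^ 'n"
  defines "t \<equiv> (norm x)\<^sup>2" and "y \<equiv> inv_sqrt1 ((norm x)\<^sup>2)"
  shows "laplacian (barrier a \<sigma>) x = barrier a \<sigma> x * (t - 2 * a - CARD('n) + 2 * \<sigma> * y
    + y\<^sup>2 * ((2 + CARD('n)) * (a - \<sigma> * y) + (1 - y\<^sup>2) * ((a - \<sigma> * y)\<^sup>2 - 2 * a + 3 * \<sigma> * y)))"
proof -
  have "laplacian (\<lambda>x :: real ^ 'n. 1 * barrier_jet 0 (1 * (norm (x - 0))\<^sup>2)) x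
      = 1 * (2 * 1 * real CARD('n) * barrier_jet 1 (1 * (norm (x - 0))\<^sup>2) + 4 * 1 * (1 * (norm (x - 0))\<^sup>2) * barrier_jet 2 (1 * (norm (x - 0))\<^sup>2))"
    by (rule laplacian_radial[where G = "barrier_jet 0" and G' = "barrier_jet 1" and G'' = "barrier_jet 2"])
      (use DERIV_barrier_jet[of 0] DERIV_barrier_jet[of 1] in \<open>simp_all add: numeral_2_eq_2\<close>)
  then have "laplacian (barrier a \<sigma>) x = 2 * CARD('n) * barrier_jet 1 t + 4 * t * barrier_jet 2 t"
    by (simp add: barrier_jet_def[of 0] barrier_def[abs_def] t_def)
  then have 1: "laplacian (barrier a \<sigma>) x = barrier a \<sigma> x * (2 * CARD('n) * barrier_exponent' t
      + 4 * t * ((barrier_exponent' t)\<^sup>2 + barrier_exponent'' t))"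
    by (simp add: barrier_jet_def barrier_def t_def algebra_simps)
  have ty: "t * y\<^sup>2 = 1 - y\<^sup>2"
  proof -
    have "t \<ge> 0" "1 + t > 0"
      by (auto simp: t_def add_pos_nonneg)
    then show ?thesis
      using inv_sqrt1_bounds(3)[of t] by (simp add: y_def t_def[symmetric] field_simps)
  qed
  have yt: "inv_sqrt1 t = y"
    by (simp add: t_def y_def)
  \<comment> \<open>With b the first derivative of the exponent is -1/2 + y^2 b / 2. Its square
    contributes the cross term -2 t y^2 b = -2 b + 2 y^2 b, the source of -2 a + 2 \<sigma>
    y.\<close>
  define b where "b = a - \<sigma> * y"
  have h': "barrier_exponent' t = - 1 / 2 + y\<^sup>2 * b / 2"
    by (simp add: barrier_exponent'_def b_def yt power2_eq_square power3_eq_cube algebra_simps)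
  have h'': "barrier_exponent'' t = y\<^sup>2 * y\<^sup>2 * (- a / 2 + 3 * \<sigma> * y / 4)"
    by (simp add: barrier_exponent''_def yt eval_nat_numeral algebra_simps)
  have "4 * t * ((barrier_exponent' t)\<^sup>2 + barrier_exponent'' t)
      = t - 2 * (t * y\<^sup>2) * b + (t * y\<^sup>2) * y\<^sup>2 * b\<^sup>2 + (t * y\<^sup>2) * y\<^sup>2 * (- 2 * a + 3 * \<sigma> * y)"
    unfolding h' h'' by (simp add: power2_eq_square field_simps)
  then have "2 * CARD('n) * barrier_exponent' t + 4 * t * ((barrier_exponent' t)\<^sup>2 + barrier_exponent'' t)
      = - CARD('n) + CARD('n) * y\<^sup>2 * b + t - 2 * (1 - y\<^sup>2) * b + (1 - y\<^sup>2) * y\<^sup>2 * b\<^sup>2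
        + (1 - y\<^sup>2) * y\<^sup>2 * (- 2 * a + 3 * \<sigma> * y)"
    unfolding ty h' by (simp add: algebra_simps)
  also have "\<dots> = t - 2 * a - CARD('n) + 2 * \<sigma> * y
    + y\<^sup>2 * ((2 + CARD('n)) * b + (1 - y\<^sup>2) * (b\<^sup>2 - 2 * a + 3 * \<sigma> * y))"
    by (simp add: b_def algebra_simps power2_eq_square)
  finally show ?thesis
    unfolding 1 b_def by simp
qed

end

lemma barrier_pos: "barrier a \<sigma> x > 0"
  by (simp add: barrier_def)

lemma laplacian_barrier_bound:
  fixes \<sigma> :: real
  assumes "\<bar>\<sigma>\<bar> \<le> 1"
  shows "\<exists>C\<ge>0. \<forall>x :: real ^ 'n. let y = inv_sqrt1 ((norm x)\<^sup>2) in
    \<bar>laplacian (barrier a \<sigma>) x - barrier a \<sigma> x * ((norm x)\<^sup>2 - 2 * a - CARD('n) + 2 * \<sigma> * y)\<bar>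
      \<le> C * y\<^sup>2 * barrier a \<sigma> x"
proof -
  \<comment> \<open>Bounds the bracket multiplying y^2 in \<open>laplacian_barrier\<close> term by
    term, using |\<sigma> y| \<le> 1 and |1 - y^2| \<le> 1.\<close>
  define C where "C = (2 + real CARD('n)) * (\<bar>a\<bar> + 1) + ((\<bar>a\<bar> + 1)\<^sup>2 + 2 * \<bar>a\<bar> + 3)"
  have "C \<ge> 0"
    unfolding C_def by (intro add_nonneg_nonneg mult_nonneg_nonneg) auto
  have "\<bar>laplacian (barrier a \<sigma>) x - barrier a \<sigma> x * ((norm x)\<^sup>2 - 2 * a - CARD('n) + 2 * \<sigma> * y)\<bar> \<le> C * y\<^sup>2 * barrier a \<sigma> x"
    if y: "y = inv_sqrt1 ((norm x)\<^sup>2)" for x :: "real ^ 'n" and y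
  proof -
    have y01: "0 < y" "y \<le> 1"
      using inv_sqrt1_bounds[of "(norm x)\<^sup>2"] by (auto simp: y)
    have \<sigma>y: "\<bar>\<sigma> * y\<bar> \<le> 1"
      using mult_mono[OF assms y01(2)] y01 by (simp add: abs_mult)
    then have b: "\<bar>a - \<sigma> * y\<bar> \<le> \<bar>a\<bar> + 1"
      by linarith
    then have b2: "(a - \<sigma> * y)\<^sup>2 \<le> (\<bar>a\<bar> + 1)\<^sup>2"
      using abs_le_square_iff[of "a - \<sigma> * y" "\<bar>a\<bar> + 1"] by simp
    define E where "E = (2 + CARD('n)) * (a - \<sigma> * y) + (1 - y\<^sup>2) * ((a - \<sigma> * y)\<^sup>2 - 2 * a + 3 * \<sigma> * y)"
    have "0 \<le> y\<^sup>2" "y\<^sup>2 \<le> 1"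
      using y01 by (auto simp: power_le_one)
    then have y2: "\<bar>1 - y\<^sup>2\<bar> \<le> 1"
      by linarith
    have "\<bar>(a - \<sigma> * y)\<^sup>2 - 2 * a + 3 * \<sigma> * y\<bar> \<le> (\<bar>a\<bar> + 1)\<^sup>2 + 2 * \<bar>a\<bar> + 3"
    proof -
      have "\<bar>(a - \<sigma> * y)\<^sup>2\<bar> \<le> (\<bar>a\<bar> + 1)\<^sup>2"
        using b2 by simp
      then show ?thesis
        using \<sigma>y unfolding mult.assoc by linarith
    qed
    then have "\<bar>(1 - y\<^sup>2) * ((a - \<sigma> * y)\<^sup>2 - 2 * a + 3 * \<sigma> * y)\<bar> \<le> 1 * ((\<bar>a\<bar> + 1)\<^sup>2 + 2 * \<bar>a\<bar> + 3)"
      unfolding abs_mult using y2 by (intro mult_mono) auto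
    moreover have "\<bar>(2 + real CARD('n)) * (a - \<sigma> * y)\<bar> \<le> (2 + real CARD('n)) * (\<bar>a\<bar> + 1)"
      unfolding abs_mult using b by (intro mult_mono) auto
    ultimately have "\<bar>E\<bar> \<le> C"
      unfolding C_def E_def by (intro order_trans[OF abs_triangle_ineq] add_mono) auto
    then have *: "(barrier a \<sigma> x * y\<^sup>2) * \<bar>E\<bar>
        \<le> (barrier a \<sigma> x * y\<^sup>2) * C"
      using barrier_pos[of a \<sigma> x] by (intro mult_left_mono) auto
    have "laplacian (barrier a \<sigma>) x - barrier a \<sigma> x * ((norm x)\<^sup>2 - 2 * a - CARD('n) + 2 * \<sigma> * y)
        = (barrier a \<sigma> x * y\<^sup>2) * E"
      unfolding laplacian_barrier y[symmetric] E_def by (simp add: distrib_left mult.assoc)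
    then show ?thesis
      using * barrier_pos[of a \<sigma> x] by (simp add: abs_mult mult_ac)
  qed
  then show ?thesis
    using \<open>C \<ge> 0\<close> by (intro exI[of _ C]) (auto simp: Let_def)
qed

lemma barrier_bounded:
  assumes "\<bar>\<sigma>\<bar> \<le> 1"
  shows "\<exists>K\<ge>0. \<forall>x :: real ^ 'n. barrier a \<sigma> x \<le> K"
proof -
  have "barrier_exponent a \<sigma> t \<le> 1 / 2 + \<bar>a\<bar> / 2 * ln (\<bar>a\<bar> + 1) + 1" if t: "t \<ge> 0" for t
  proof -
    \<comment> \<open>The tangent bound ln(1 + t) \<le> (1 + t) / k + ln k, with k above |a|, makes
      the logarithmic term at most (1 + t) / 2 plus a constant. The term -t / 2 of the exponent
      cancels its growth.\<close>
    define k where "k = \<bar>a\<bar> + 1"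
    have k: "k > 0" "\<bar>a\<bar> / k \<le> 1"
      by (auto simp: k_def)
    have "ln (1 + t) - ln k \<le> (1 + t) / k - 1"
      using ln_le_minus_one[of "(1 + t) / k"] ln_div[of "1 + t" k] t k by simp
    then have ln: "ln (1 + t) \<le> (1 + t) / k + ln k"
      by simp
    have "a / 2 * ln (1 + t) \<le> \<bar>a\<bar> / 2 * ln (1 + t)"
      using t by (intro mult_right_mono) auto
    also have "\<dots> \<le> \<bar>a\<bar> / 2 * ((1 + t) / k + ln k)"
      using ln by (intro mult_left_mono) auto
    also have "\<dots> = (\<bar>a\<bar> / k) * ((1 + t) / 2) + \<bar>a\<bar> / 2 * ln k"
      by (simp add: distrib_left add_divide_distrib)
    also have "\<dots> \<le> 1 * ((1 + t) / 2) + \<bar>a\<bar> / 2 * ln k"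
      using k t by (intro add_right_mono mult_right_mono) auto
    finally have 1: "a / 2 * ln (1 + t) \<le> (1 + t) / 2 + \<bar>a\<bar> / 2 * ln k"
      by simp
    have "\<bar>\<sigma> * inv_sqrt1 t\<bar> \<le> 1"
      using mult_mono[OF assms, of "inv_sqrt1 t" 1] inv_sqrt1_bounds[OF t] by (simp add: abs_mult)
    then show ?thesis
      unfolding barrier_exponent_def using 1 by (simp add: k_def abs_le_iff add_divide_distrib)
  qed
  then have "barrier a \<sigma> x \<le> exp (1 / 2 + \<bar>a\<bar> / 2 * ln (\<bar>a\<bar> + 1) + 1)" for x :: "real ^ 'n"
    by (simp add: barrier_def)
  then show ?thesis
    by (intro exI[of _ "exp (1 / 2 + \<bar>a\<bar> / 2 * ln (\<bar>a\<bar> + 1) + 1)"]) auto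
qed

text \<open>For t = |x|^2 at least 1, replacing ln t by ln(1 + t) changes the exponent by at most
  (|a| / 2) ln 2, and the \<sigma> term adds at most 1.\<close>

lemma barrier_comparable:
  assumes "\<bar>\<sigma>\<bar> \<le> 1"
  shows "\<exists>c>0. \<exists>C>0. \<forall>x :: real ^ 'n. norm x \<ge> 1 \<longrightarrow>
    c * (norm x powr a * exp (- (norm x)\<^sup>2 / 2)) \<le> barrier a \<sigma> x \<and>
    barrier a \<sigma> x \<le> C * (norm x powr a * exp (- (norm x)\<^sup>2 / 2))"
proof -
  have "exp (- (\<bar>a\<bar> / 2 * ln 2 + 1)) * (norm x powr a * exp (- (norm x)\<^sup>2 / 2)) \<le> barrier a \<sigma> x \<and>
      barrier a \<sigma> x \<le> exp (\<bar>a\<bar> / 2 * ln 2 + 1) * (norm x powr a * exp (- (norm x)\<^sup>2 / 2))"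
    if x: "norm x \<ge> 1" for x :: "real ^ 'n"
  proof -
    define t where "t = (norm x)\<^sup>2"
    have t: "t \<ge> 1"
      using x by (simp add: t_def)
    have lnx: "ln (norm x) = ln t / 2"
      using x by (simp add: t_def ln_realpow)
    have "ln (1 + t) - ln t = ln ((1 + t) / t)"
      using t by (simp add: ln_div)
    also have "\<dots> \<le> ln 2"
      using t by (subst ln_le_cancel_iff) (auto simp: field_simps)
    finally have "ln (1 + t) - ln t \<le> ln 2" .
    moreover have "ln (1 + t) - ln t \<ge> 0"
      using t by simp
    ultimately have *: "\<bar>a / 2 * (ln (1 + t) - ln t)\<bar> \<le> \<bar>a\<bar> / 2 * ln 2"
      unfolding abs_mult by (intro mult_mono) auto
    have **: "\<bar>\<sigma> * inv_sqrt1 t\<bar> \<le> 1"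
      using mult_mono[OF assms, of "inv_sqrt1 t" 1] inv_sqrt1_bounds[of t] t by (simp add: abs_mult)
    have e: "\<bar>barrier_exponent a \<sigma> t - (a * (ln t / 2) - t / 2)\<bar> \<le> \<bar>a\<bar> / 2 * ln 2 + 1"
    proof -
      have "barrier_exponent a \<sigma> t - (a * (ln t / 2) - t / 2) = a / 2 * (ln (1 + t) - ln t) + \<sigma> * inv_sqrt1 t"
        by (simp add: barrier_exponent_def right_diff_distrib)
      then show ?thesis
        using * ** by linarith
    qed
    have "norm x powr a * exp (- (norm x)\<^sup>2 / 2) = exp (a * (ln t / 2) - t / 2)"
      using x unfolding powr_def lnx t_def[symmetric] by (auto simp: exp_add[symmetric])
    then show ?thesis
      unfolding barrier_def t_def[symmetric] using e by (simp add: exp_add[symmetric] abs_le_iff)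
  qed
  then show ?thesis
    by (intro exI[of _ "exp (- (\<bar>a\<bar> / 2 * ln 2 + 1))"] conjI exI[of _ "exp (\<bar>a\<bar> / 2 * ln 2 + 1)"]) auto
qed

subsection \<open>From weak solutions to the weak Laplacian\<close>

lemma integrable_scaleR_L2:
  fixes u :: "'a \<Rightarrow> real" and g :: "'a \<Rightarrow> 'b::euclidean_space"
  assumes [measurable]: "u \<in> borel_measurable M" "g \<in> borel_measurable M"
    and "integrable M (\<lambda>x. (u x)\<^sup>2)" "integrable M (\<lambda>x. (norm (g x))\<^sup>2)"
  shows "integrable M (\<lambda>x. u x *\<^sub>R g x)"
proof (rule Bochner_Integration.integrable_bound)
  show "integrable M (\<lambda>x. (u x)\<^sup>2 + (norm (g x))\<^sup>2)"
    using assms by auto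
  show "AE x in M. norm (u x *\<^sub>R g x) \<le> norm ((u x)\<^sup>2 + (norm (g x))\<^sup>2)"
  proof (intro AE_I2)
    fix x
    have "2 * \<bar>u x\<bar> * norm (g x) \<le> (u x)\<^sup>2 + (norm (g x))\<^sup>2"
      using sum_squares_bound[of "\<bar>u x\<bar>" "norm (g x)"] by simp
    moreover have "0 \<le> \<bar>u x\<bar> * norm (g x)"
      by simp
    ultimately show "norm (u x *\<^sub>R g x) \<le> norm ((u x)\<^sup>2 + (norm (g x))\<^sup>2)"
      unfolding norm_scaleR real_norm_def by linarith
  qed
qed measurable

lemma lebesgue_borel_measurable:
  "f \<in> borel_measurable borel \<Longrightarrow> f \<in> borel_measurable lebesgue"
  by (intro measurable_completion) simp

lemma bounded_support_lebesgue:
  assumes "bounded_support q"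
  shows "q \<in> borel_measurable lebesgue" "integrable lebesgue (\<lambda>x. (q x)\<^sup>2)"
proof -
  have q: "q \<in> borel_measurable borel"
    using assms by measurable
  then show "q \<in> borel_measurable lebesgue"
    by (rule lebesgue_borel_measurable)
  have "loc_integrable q"
    using integrable_supp_mult[OF assms loc_integrable_1] by (intro integrable_loc_integrable) simp
  then have "integrable lborel (\<lambda>x. q x * q x)"
    by (rule integrable_supp_mult[OF assms])
  then show "integrable lebesgue (\<lambda>x. (q x)\<^sup>2)"
    using q by (subst integrable_completion) (auto simp: power2_eq_square)
qed

lemma gradient_test_function_lebesgue:
  assumes \<phi>: "\<phi> \<in> test_functions"
  shows "gradient \<phi> \<in> borel_measurable lebesgue" "integrable lebesgue (\<lambda>x. (norm (gradient \<phi> x))\<^sup>2)"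
proof -
  have "continuous_on UNIV (\<lambda>x. gradient \<phi> x $ j)" for j
    using test_functionsD(2)[OF test_functionsD(3)[OF \<phi>]] .
  then have "continuous_on UNIV (\<lambda>x. \<chi> j. gradient \<phi> x $ j)"
    by (rule continuous_on_vec_lambda)
  then show "gradient \<phi> \<in> borel_measurable lebesgue"
    by (intro lebesgue_borel_measurable borel_measurable_continuous_onI) simp
  have "integrable lebesgue (\<lambda>x. \<Sum>j\<in>UNIV. (gradient \<phi> x $ j)\<^sup>2)"
    using bounded_support_lebesgue(2)[OF test_functionsD(4)[OF test_functionsD(3)[OF \<phi>]]] by simp
  then show "integrable lebesgue (\<lambda>x. (norm (gradient \<phi> x))\<^sup>2)"
    by (simp add: power2_norm_eq_inner inner_vec_def power2_eq_square[symmetric])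
qed

text \<open>The defining identity of the weak gradient is tested with each partial derivative of
  \<open>\<phi>\<close>; its j-th component for the j-th derivative is summed over j.\<close>

lemma has_H1_gradient_laplacian:
  fixes u :: "real ^ 'n \<Rightarrow> real"
  assumes H1: "has_H1_gradient u G" and \<phi>: "\<phi> \<in> test_functions"
  shows "integrable lebesgue (\<lambda>x. G x \<bullet> gradient \<phi> x)"
    and "(LINT x|lebesgue. G x \<bullet> gradient \<phi> x) = - (LINT x|lebesgue. u x * laplacian \<phi> x)"
proof -
  have u: "u \<in> borel_measurable lebesgue" "integrable lebesgue (\<lambda>x. (u x)\<^sup>2)"
    and G: "G \<in> borel_measurable lebesgue" "integrable lebesgue (\<lambda>x. (norm (G x))\<^sup>2)"
    using H1 by (auto simp: has_H1_gradient_def Lp_def)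
  define \<psi> where "\<psi> = (\<lambda>j x. gradient \<phi> x $ j)"
  have \<psi>: "\<psi> j \<in> test_functions" for j
    unfolding \<psi>_def by (rule test_functionsD[OF \<phi>])
  have int_G: "integrable lebesgue (\<lambda>x. \<psi> j x *\<^sub>R G x)" for j
    by (intro integrable_scaleR_L2 G bounded_support_lebesgue test_functionsD(4)[OF \<psi>])
  have int_u: "integrable lebesgue (\<lambda>x. u x *\<^sub>R gradient (\<psi> j) x)" for j
    by (intro integrable_scaleR_L2 u gradient_test_function_lebesgue \<psi>)
  have int_Gj: "integrable lebesgue (\<lambda>x. \<psi> j x * G x $ j)" for j
    using integrable_bounded_linear[OF bounded_linear_vec_nth[of j] int_G[of j]] by simp
  have int_uj: "integrable lebesgue (\<lambda>x. u x * gradient (\<psi> j) x $ j)" for j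
    using integrable_bounded_linear[OF bounded_linear_vec_nth[of j] int_u[of j]] by simp
  have eq: "(LINT x|lebesgue. u x * gradient (\<psi> j) x $ j) = - (LINT x|lebesgue. \<psi> j x * G x $ j)" for j
  proof -
    have "(LINT x|lebesgue. u x *\<^sub>R gradient (\<psi> j) x) $ j = (- (LINT x|lebesgue. \<psi> j x *\<^sub>R G x)) $ j"
      using H1 \<psi> by (simp add: has_H1_gradient_def)
    then show ?thesis
      using integral_bounded_linear[OF bounded_linear_vec_nth[of j] int_G[of j]]
        integral_bounded_linear[OF bounded_linear_vec_nth[of j] int_u[of j]] by simp
  qed
  have inner: "G x \<bullet> gradient \<phi> x = (\<Sum>j\<in>UNIV. \<psi> j x * G x $ j)" for x
    by (simp add: inner_vec_def \<psi>_def mult.commute)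
  show "integrable lebesgue (\<lambda>x. G x \<bullet> gradient \<phi> x)"
    unfolding inner using int_Gj by simp
  have "(LINT x|lebesgue. G x \<bullet> gradient \<phi> x) = (\<Sum>j\<in>UNIV. - (LINT x|lebesgue. u x * gradient (\<psi> j) x $ j))"
    unfolding inner using int_Gj by (simp add: eq)
  also have "\<dots> = - (LINT x|lebesgue. (\<Sum>j\<in>UNIV. u x * gradient (\<psi> j) x $ j))"
    using int_uj by (simp add: sum_negf)
  also have "\<dots> = - (LINT x|lebesgue. u x * laplacian \<phi> x)"
    by (simp add: laplacian_def sum_distrib_left \<psi>_def)
  finally show "(LINT x|lebesgue. G x \<bullet> gradient \<phi> x) = - (LINT x|lebesgue. u x * laplacian \<phi> x)" .
qed

text \<open>Truncation at 0 makes the representative nonnegative at every point, not just almost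
  everywhere, which the mean value lemmas require of their functions.\<close>

lemma positive_borel_representative:
  fixes u :: "'a::euclidean_space \<Rightarrow> real"
  assumes u: "u \<in> borel_measurable lebesgue" and pos: "AE x in lebesgue. u x > 0"
  shows "\<exists>v\<in>borel_measurable borel. (\<forall>x. v x \<ge> 0) \<and> (AE x in lborel. v x > 0) \<and> (AE x in lebesgue. u x = v x)"
proof -
  obtain g where g: "g \<in> borel_measurable lborel" "AE x in lborel. u x = g x"
    using completion_ex_borel_measurable_real[OF u] by blast
  have pos': "AE x in lborel. u x > 0"
    using pos by (simp add: AE_completion_iff)
  show ?thesis
  proof (intro bexI conjI allI)
    show "AE x in lborel. max 0 (g x) > 0"
      using g(2) pos' by eventually_elim auto
    have "AE x in lborel. u x = max 0 (g x)"
      using g(2) pos' by eventually_elim auto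
    then show "AE x in lebesgue. u x = max 0 (g x)"
      by (rule AE_completion)
  qed (use g(1) in auto)
qed

text \<open>With this potential the system reads Laplacian of v_i =
  \<open>coefficient B \<omega> v i\<close> times v_i: a linear equation whose potential depends on
  the solution.\<close>

definition coefficient ::
    "real ^ 'k ^ 'k \<Rightarrow> ('k::finite \<Rightarrow> real) \<Rightarrow> ('k \<Rightarrow> real ^ 'n \<Rightarrow> real) \<Rightarrow> 'k \<Rightarrow> real ^ 'n \<Rightarrow> real" where
  "coefficient B \<omega> v i x = (norm x)\<^sup>2 - \<omega> i + (\<Sum>j\<in>UNIV. B $ i $ j * (v j x)\<^sup>2)"

text \<open>The single passage from Lebesgue to Borel functions and from the gradient form of the
  equation to the distributional Laplacian.\<close>

lemma weak_solution_representative: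
  fixes B :: "real ^ 'k ^ 'k" and \<omega> :: "'k::finite \<Rightarrow> real" and u :: "'k \<Rightarrow> real ^ 'n \<Rightarrow> real"
  assumes energy: "u \<in> energy_space" and pos: "\<And>i. AE x in lebesgue. u i x > 0"
    and sol: "weak_solution B \<omega> u"
  shows "\<exists>v. \<forall>i. v i \<in> borel_measurable borel \<and> (\<forall>x. v i x \<ge> 0) \<and> (AE x in lborel. v i x > 0) \<and>
    (AE x in lebesgue. u i x = v i x) \<and> integrable lborel (\<lambda>x. (v i x)\<^sup>2) \<and>
    integrable lborel (\<lambda>x. (v i x)\<^sup>2 * (norm x)\<^sup>2) \<and>
    weak_laplacian (v i) (\<lambda>x. coefficient B \<omega> v i x * v i x)"
proof -
  have um: "u i \<in> borel_measurable lebesgue" and u2: "integrable lebesgue (\<lambda>x. (u i x)\<^sup>2)"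
    and u4: "integrable lebesgue (\<lambda>x. (u i x) ^ 4)" and ux: "integrable lebesgue (\<lambda>x. (u i x)\<^sup>2 * (norm x)\<^sup>2)" for i
    using energy by (auto simp: energy_space_def H1_def has_H1_gradient_def Lp_def)
  have "\<exists>v. \<forall>i. v i \<in> borel_measurable borel \<and> (\<forall>x. v i x \<ge> 0) \<and> (AE x in lborel. v i x > 0) \<and> (AE x in lebesgue. u i x = v i x)"
    using positive_borel_representative[OF um pos] by (intro choice) blast
  then obtain v where vm: "\<And>i. v i \<in> borel_measurable borel" and v0: "\<And>i x. v i x \<ge> 0"
    and vpos: "\<And>i. AE x in lborel. v i x > 0" and uv: "\<And>i. AE x in lebesgue. u i x = v i x"
    by blast
  note [measurable] = vm um
  have uv_all: "AE x in lebesgue. \<forall>i. u i x = v i x"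
    using uv by (intro AE_finite_allI[of UNIV, simplified]) auto
  have transfer: "integrable lborel g" "integral\<^sup>L lebesgue f = integral\<^sup>L lborel g"
    if "integrable lebesgue f" "g \<in> borel_measurable borel" "AE x in lebesgue. f x = g x" for f g :: "real ^ 'n \<Rightarrow> real"
  proof -
    have g: "g \<in> borel_measurable lebesgue"
      by (rule lebesgue_borel_measurable[OF that(2)])
    show "integrable lborel g"
      using integrable_cong_AE_imp[OF that(1) g that(3)] that(2) by (simp add: integrable_completion)
    show "integral\<^sup>L lebesgue f = integral\<^sup>L lborel g"
      using integral_cong_AE[OF borel_measurable_integrable[OF that(1)] g that(3)] that(2) by (simp add: integral_completion)
  qed
  have v2: "integrable lborel (\<lambda>x. (v i x)\<^sup>2)" and v4: "integrable lborel (\<lambda>x. (v i x) ^ 4)"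
    and vx: "integrable lborel (\<lambda>x. (v i x)\<^sup>2 * (norm x)\<^sup>2)" for i
    by (rule transfer(1)[OF u2[of i]] transfer(1)[OF u4[of i]] transfer(1)[OF ux[of i]]; use uv[of i] in \<open>auto elim!: eventually_mono\<close>)+
  \<comment> \<open>This is where L^4 enters: v_i and v_j^2 are both square integrable, so the cubic
    terms are integrable.\<close>
  have prod_int: "integrable lborel (\<lambda>x. v i x *\<^sub>R (v j x)\<^sup>2)" for i j
    using v2[of i] v4[of j] by (intro integrable_scaleR_L2) (auto simp: power_mult[symmetric])
  have prod_int_u: "integrable lebesgue (\<lambda>x. u i x *\<^sub>R (u j x)\<^sup>2)" for i j
    using u2[of i] u4[of j] by (intro integrable_scaleR_L2) (auto simp: power_mult[symmetric])
  have li: "loc_integrable (v i)" for i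
  proof (rule loc_integrable_bound)
    show "loc_integrable (\<lambda>x. 1 + (v i x)\<^sup>2)"
      by (intro loc_integrable_add loc_integrable_1 integrable_loc_integrable v2)
    have "\<bar>v i x\<bar> \<le> 1 * \<bar>1 + (v i x)\<^sup>2\<bar>" for x
      using sum_squares_bound[of "v i x" 1] v0[of i x] by simp
    then show "\<exists>M. \<forall>x. norm x \<le> R \<longrightarrow> \<bar>v i x\<bar> \<le> M * \<bar>1 + (v i x)\<^sup>2\<bar>" for R
      by blast
  qed (fact vm)
  have coeff: "coefficient B \<omega> v i x * v i x = ((norm x)\<^sup>2 - \<omega> i) * v i x + (\<Sum>j\<in>UNIV. B $ i $ j * (v i x *\<^sub>R (v j x)\<^sup>2))" for i x
    by (simp add: coefficient_def algebra_simps sum_distrib_left)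
  have li': "loc_integrable (\<lambda>x. coefficient B \<omega> v i x * v i x)" for i
    unfolding coeff
    by (intro loc_integrable_add loc_integrable_continuous_mult loc_integrable_sum
        loc_integrable_cmult integrable_loc_integrable prod_int li continuous_intros)
  have wl: "weak_laplacian (v i) (\<lambda>x. coefficient B \<omega> v i x * v i x)" for i
    unfolding weak_laplacian_def
  proof (intro conjI ballI li li')
    let ?S = "\<lambda>x. \<Sum>j\<in>UNIV. B $ i $ j * (u j x)\<^sup>2"
    fix \<phi> :: "real ^ 'n \<Rightarrow> real" assume \<phi>: "\<phi> \<in> test_functions"
    obtain G where G: "has_H1_gradient (u i) G" and eq:
      "(LINT x|lebesgue. G x \<bullet> gradient \<phi> x + (norm x)\<^sup>2 * u i x * \<phi> x + u i x * ?S x * \<phi> x)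
        = (LINT x|lebesgue. \<omega> i * u i x * \<phi> x)"
      using sol \<phi> unfolding weak_solution_def by blast
    have \<phi>b: "bounded_support \<phi>" and \<phi>c: "continuous_on UNIV \<phi>"
      using test_functionsD[OF \<phi>] by auto
    obtain R where R: "\<And>x. norm x > R \<Longrightarrow> \<phi> x = 0"
      using test_functionsD(5)[OF \<phi>] by blast
    have u_int: "integrable lebesgue (\<lambda>x. u i x * q x)" if "bounded_support q" for q
      using integrable_scaleR_L2[OF um[of i] bounded_support_lebesgue(1)[OF that] u2[of i]] bounded_support_lebesgue(2)[OF that]
      by simp
    have x2\<phi>: "bounded_support (\<lambda>x. (norm x)\<^sup>2 * \<phi> x)"
      by (rule bounded_support_continuous[of _ R]) (auto intro!: continuous_intros \<phi>c simp: R)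
    have int1: "integrable lebesgue (\<lambda>x. (norm x)\<^sup>2 * u i x * \<phi> x)"
      using u_int[OF x2\<phi>] by (simp add: mult_ac)
    obtain R' M where M: "\<And>x. \<bar>\<phi> x\<bar> \<le> M * indicator (cball 0 R') x" "M > 0"
      using bounded_supportE[OF \<phi>b] by metis
    have M': "\<bar>\<phi> x\<bar> \<le> M" for x
      by (rule order_trans[OF M(1)]) (use M(2) in \<open>auto simp: indicator_def\<close>)
    have int2: "integrable lebesgue (\<lambda>x. u i x * ?S x * \<phi> x)"
    proof (rule Bochner_Integration.integrable_bound)
      have "integrable lebesgue (\<lambda>x. \<Sum>j\<in>UNIV. B $ i $ j * (u i x *\<^sub>R (u j x)\<^sup>2))"
        using prod_int_u by (intro Bochner_Integration.integrable_sum integrable_mult_right) auto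
      then show "integrable lebesgue (\<lambda>x. (u i x * ?S x) * M)"
        by (intro integrable_mult_left) (simp add: sum_distrib_left mult_ac)
      show "(\<lambda>x. u i x * ?S x * \<phi> x) \<in> borel_measurable lebesgue"
        using bounded_support_lebesgue(1)[OF \<phi>b] by measurable
      show "AE x in lebesgue. norm (u i x * ?S x * \<phi> x) \<le> norm ((u i x * ?S x) * M)"
        using M' M(2) by (intro AE_I2) (auto simp: abs_mult intro!: mult_left_mono)
    qed
    have int3: "integrable lebesgue (\<lambda>x. \<omega> i * u i x * \<phi> x)"
      using integrable_mult_right[OF u_int[OF \<phi>b], of "\<omega> i"] by (simp add: mult_ac)
    have intL: "integrable lebesgue (\<lambda>x. u i x * laplacian \<phi> x)"
      by (rule u_int[OF bounded_support_laplacian[OF \<phi>]])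
    have intC: "integrable lebesgue (\<lambda>x. \<phi> x * (coefficient B \<omega> u i x * u i x))"
    proof -
      have "integrable lebesgue (\<lambda>x. (norm x)\<^sup>2 * u i x * \<phi> x + u i x * ?S x * \<phi> x - \<omega> i * u i x * \<phi> x)"
        using int1 int2 int3 by auto
      then show ?thesis
        by (simp add: coefficient_def algebra_simps)
    qed
    have "(LINT x|lebesgue. \<phi> x * (coefficient B \<omega> u i x * u i x))
        = (LINT x|lebesgue. (norm x)\<^sup>2 * u i x * \<phi> x + u i x * ?S x * \<phi> x - \<omega> i * u i x * \<phi> x)"
      by (intro Bochner_Integration.integral_cong) (auto simp: coefficient_def algebra_simps)
    also have "\<dots> = (LINT x|lebesgue. (norm x)\<^sup>2 * u i x * \<phi> x) + (LINT x|lebesgue. u i x * ?S x * \<phi> x)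
        - (LINT x|lebesgue. \<omega> i * u i x * \<phi> x)"
      by (intro has_bochner_integral_integral_eq has_bochner_integral_diff has_bochner_integral_add has_bochner_integral_integrable int1 int2 int3)
    also have "\<dots> = - (LINT x|lebesgue. G x \<bullet> gradient \<phi> x)"
    proof -
      have "(LINT x|lebesgue. \<omega> i * u i x * \<phi> x) = (LINT x|lebesgue. G x \<bullet> gradient \<phi> x) + (LINT x|lebesgue. (norm x)\<^sup>2 * u i x * \<phi> x)
          + (LINT x|lebesgue. u i x * ?S x * \<phi> x)"
        unfolding eq[symmetric]
        by (intro has_bochner_integral_integral_eq has_bochner_integral_add has_bochner_integral_integrable
            int1 int2 has_H1_gradient_laplacian(1)[OF G \<phi>])
      then show ?thesis
        by simp
    qed
    also have "\<dots> = (LINT x|lebesgue. u i x * laplacian \<phi> x)"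
      using has_H1_gradient_laplacian(2)[OF G \<phi>] by simp
    also have "\<dots> = (LBINT x. laplacian \<phi> x * v i x)"
    proof (rule transfer(2)[OF intL])
      have [measurable]: "laplacian \<phi> \<in> borel_measurable borel"
        using bounded_support_laplacian[OF \<phi>] by measurable
      show "(\<lambda>x. laplacian \<phi> x * v i x) \<in> borel_measurable borel"
        by measurable
    qed (use uv[of i] in \<open>auto elim!: eventually_mono\<close>)
    also have "(LINT x|lebesgue. \<phi> x * (coefficient B \<omega> u i x * u i x)) = (LBINT x. \<phi> x * (coefficient B \<omega> v i x * v i x))"
    proof (rule transfer(2)[OF intC])
      have [measurable]: "\<phi> \<in> borel_measurable borel"
        using \<phi>b by measurable
      show "(\<lambda>x. \<phi> x * (coefficient B \<omega> v i x * v i x)) \<in> borel_measurable borel"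
        unfolding coefficient_def by measurable
      show "AE x in lebesgue. \<phi> x * (coefficient B \<omega> u i x * u i x) = \<phi> x * (coefficient B \<omega> v i x * v i x)"
        using uv_all by eventually_elim (simp add: coefficient_def)
    qed
    finally show "(LBINT x. laplacian \<phi> x * v i x) = (LBINT x. \<phi> x * (coefficient B \<omega> v i x * v i x))" ..
  qed
  show ?thesis
    using vm v0 vpos uv v2 vx wl by blast
qed

subsection \<open>A priori decay\<close>

lemma weak_laplacian_ge_mono:
  assumes "weak_laplacian_ge w f" "loc_integrable g" "\<And>x. g x \<le> f x"
  shows "weak_laplacian_ge w g"
  unfolding weak_laplacian_ge_def
proof (intro conjI ballI impI)
  show "loc_integrable w" "loc_integrable g"
    using assms by (auto simp: weak_laplacian_ge_def)
  fix \<phi> :: "real ^ 'a \<Rightarrow> real" assume \<phi>: "\<phi> \<in> test_functions" "\<forall>x. \<phi> x \<ge> 0"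
  have "(LBINT x. \<phi> x * g x) \<le> (LBINT x. \<phi> x * f x)"
    using assms \<phi> integrable_supp_mult[OF test_functionsD(4)[OF \<phi>(1)]]
    by (intro integral_mono mult_left_mono) (auto simp: weak_laplacian_ge_def)
  then show "(LBINT x. \<phi> x * g x) \<le> (LBINT x. laplacian \<phi> x * w x)"
    using assms(1) \<phi> by (force simp: weak_laplacian_ge_def)
qed

text \<open>Cauchy-Schwarz. At a = 0 the quotients are 0 by the convention for division, and the
  zero vector is indeed a subgradient of the norm there.\<close>

lemma norm_subgradient:
  fixes a b :: "real ^ 'k"
  shows "norm a + (\<Sum>i\<in>UNIV. a $ i / norm a * (b $ i - a $ i)) \<le> norm b"
proof (cases "a = 0")
  case False
  have "(\<Sum>i\<in>UNIV. a $ i / norm a * (b $ i - a $ i)) = (a \<bullet> (b - a)) / norm a"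
    by (simp add: inner_vec_def sum_divide_distrib)
  also have "\<dots> \<le> (norm a * norm b - norm a * norm a) / norm a"
    using norm_cauchy_schwarz[of a b]
    by (intro divide_right_mono) (auto simp: inner_diff_right power2_norm_eq_inner[symmetric] power2_eq_square)
  also have "\<dots> = norm b - norm a"
    using False by (simp add: field_simps)
  finally show ?thesis
    by simp
qed simp

text \<open>Positive semidefiniteness enters only here: it discards the interaction terms in the
  inequality for the Euclidean norm of the solution vector.\<close>

lemma norm_subsolution:
  fixes B :: "real ^ 'k ^ 'k" and \<omega> :: "'k::finite \<Rightarrow> real" and v :: "'k \<Rightarrow> real ^ 'n \<Rightarrow> real"
  assumes B: "positive_semidefinite B"
    and v: "\<And>i. weak_laplacian (v i) (\<lambda>x. coefficient B \<omega> v i x * v i x)"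
  shows "weak_laplacian_ge (\<lambda>x. norm (\<chi> i. v i x)) (\<lambda>x. - (\<Sum>i\<in>UNIV. \<bar>\<omega> i\<bar>) * norm (\<chi> i. v i x))"
proof -
  define w where "w = (\<lambda>x. norm (\<chi> i. v i x))"
  have w: "norm (\<chi> i. v i x) = w x" for x
    by (simp add: w_def)
  \<comment> \<open>A crude bound for all |\<omega> i|; the nonnegative |x|^2 is dropped as well.
    The mean value inequality only needs some finite lower bound on the potential.\<close>
  define M where "M = (\<Sum>i\<in>UNIV. \<bar>\<omega> i\<bar>)"
  have li: "loc_integrable (v i)" for i
    using v by (simp add: weak_laplacian_def)
  have vm[measurable]: "v i \<in> borel_measurable borel" for i
    using li[of i] by measurable
  have w_sqrt: "w = (\<lambda>x. sqrt (\<Sum>i\<in>UNIV. (v i x)\<^sup>2))"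
    by (simp add: w_def norm_vec_def L2_set_def)
  have [measurable]: "w \<in> borel_measurable borel"
    unfolding w_sqrt by measurable
  have wl: "loc_integrable w"
  proof (rule loc_integrable_bound)
    show "loc_integrable (\<lambda>x. \<Sum>i\<in>UNIV. \<bar>v i x\<bar>)"
      by (intro loc_integrable_sum loc_integrable_abs li)
    show "\<exists>M. \<forall>x. norm x \<le> R \<longrightarrow> \<bar>w x\<bar> \<le> M * \<bar>\<Sum>i\<in>UNIV. \<bar>v i x\<bar>\<bar>" for R
      using norm_le_l1_cart[of "\<chi> i. v i _"] by (intro exI[of _ 1]) (auto simp: w_def)
  qed measurable
  have comp: "\<bar>v i x / w x\<bar> \<le> 1" for i x
    using component_le_norm_cart[of "\<chi> i. v i x" i] by (auto simp: w_def divide_le_eq)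
  have "weak_laplacian_ge w (\<lambda>x. \<Sum>i\<in>UNIV. v i x / w x * (coefficient B \<omega> v i x * v i x))"
  proof (rule Kato_inequality[where v = v and p = "\<lambda>i x. v i x / w x" and f = "\<lambda>i x. coefficient B \<omega> v i x * v i x" and K = 1])
    show "w x + (\<Sum>i\<in>UNIV. v i x / w x * (v i y - v i x)) \<le> w y" for x y
      using norm_subgradient[of "\<chi> i. v i x" "\<chi> i. v i y"] by (simp add: w_def)
  qed (use comp v wl in auto)
  then show ?thesis
    unfolding w M_def[symmetric]
  proof (rule weak_laplacian_ge_mono)
    show "loc_integrable (\<lambda>x. - M * w x)"
      by (rule loc_integrable_cmult[OF wl])
    fix x
    have w2: "(\<Sum>i\<in>UNIV. (v i x)\<^sup>2) = (w x)\<^sup>2"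
      by (simp add: w_sqrt sum_nonneg)
    \<comment> \<open>The subgradient v_i / w contributes one factor v_i and the equation another,
      so the interactions form the quadratic form of \<open>B\<close> at the vector of
      squares.\<close>
    have "0 \<le> (\<Sum>i\<in>UNIV. (v i x)\<^sup>2 * (\<Sum>j\<in>UNIV. B $ i $ j * (v j x)\<^sup>2))"
      using B[unfolded positive_semidefinite_def, rule_format, of "\<chi> i. (v i x)\<^sup>2"]
      by (simp add: inner_vec_def matrix_vector_mult_def)
    moreover have "(\<Sum>i\<in>UNIV. (v i x)\<^sup>2 * (- M)) \<le> (\<Sum>i\<in>UNIV. (v i x)\<^sup>2 * ((norm x)\<^sup>2 - \<omega> i))"
    proof (intro sum_mono mult_left_mono)
      fix i
      have "\<bar>\<omega> i\<bar> \<le> M"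
        unfolding M_def by (intro member_le_sum) auto
      then show "- M \<le> (norm x)\<^sup>2 - \<omega> i"
        using zero_le_power2[of "norm x"] by linarith
    qed auto
    ultimately have "- M * (w x)\<^sup>2 \<le> (\<Sum>i\<in>UNIV. (v i x)\<^sup>2 * coefficient B \<omega> v i x)"
      unfolding coefficient_def w2[symmetric] by (simp add: distrib_left sum.distrib sum_distrib_right sum_distrib_left mult.commute)
    then have "- M * (w x)\<^sup>2 / w x \<le> (\<Sum>i\<in>UNIV. (v i x)\<^sup>2 * coefficient B \<omega> v i x) / w x"
      by (rule divide_right_mono) (simp add: w_def)
    then show "- M * w x \<le> (\<Sum>i\<in>UNIV. v i x / w x * (coefficient B \<omega> v i x * v i x))"
      by (cases "w x = 0") (simp_all add: power2_eq_square sum_divide_distrib mult_ac)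
  qed
qed

text \<open>On the support of the kernel 1 + |x| is at most 2 + |z|. The product k (2 + |z|) w is
  then split as k^2 + ((2 + |z|) w)^2, and k^2 \<le> C k has integral bounded independently of
  x.\<close>

lemma mollify_rho_decay:
  fixes w :: "real ^ 'n \<Rightarrow> real"
  assumes w: "loc_integrable w" "\<And>x. w x \<ge> 0" and int: "integrable lborel (\<lambda>x. (2 + norm x)\<^sup>2 * (w x)\<^sup>2)"
  shows "\<exists>A\<ge>0. \<forall>x. (1 + norm x) * mollify rho 1 w x \<le> A"
proof -
  have [measurable]: "w \<in> borel_measurable borel"
    using w(1) by measurable
  obtain C where C: "local_kernel (kernel rho 1 :: real ^ 'n \<Rightarrow> _) C 1"
    using local_kernel_kernel[of 1] by auto
  have k0: "kernel rho 1 x z \<ge> 0" for x z :: "real ^ 'n"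
    by (intro kernel_nonneg bump_rho_nonneg) auto
  have kC: "kernel rho 1 x z \<le> C" for x z :: "real ^ 'n"
    using C abs_ge_self order_trans unfolding local_kernel_def by blast
  define A where "A = C * bump_mass TYPE('n) rho + (LBINT x. (2 + norm x)\<^sup>2 * (w x)\<^sup>2)"
  have "(1 + norm x) * mollify rho 1 w x \<le> A" for x
  proof -
    have ik: "integrable lborel (\<lambda>z. kernel rho 1 x z)"
      using integrable_kernel_mult[OF _ loc_integrable_1, of 1 rho x] by simp
    have "(1 + norm x) * mollify rho 1 w x = (LBINT z. (1 + norm x) * (kernel rho 1 x z * w z))"
      by (simp add: mollify_def)
    also have "\<dots> \<le> (LBINT z. C * kernel rho 1 x z + (2 + norm z)\<^sup>2 * (w z)\<^sup>2)"
    proof (rule integral_mono)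
      show "integrable lborel (\<lambda>z. (1 + norm x) * (kernel rho 1 x z * w z))"
        using integrable_kernel_mult[OF _ w(1), of 1 rho x] by auto
      show "integrable lborel (\<lambda>z. C * kernel rho 1 x z + (2 + norm z)\<^sup>2 * (w z)\<^sup>2)"
        using ik int by auto
      fix z
      have "(1 + norm x) * (kernel rho 1 x z * w z) \<le> kernel rho 1 x z * ((2 + norm z) * w z)"
      proof (cases "norm (z - x) > 1")
        case True
        then have "kernel rho 1 x z = 0"
          using C by (simp add: local_kernel_def)
        then show ?thesis
          by simp
      next
        case False
        then have "1 + norm x \<le> 2 + norm z"
          using norm_triangle_ineq2[of x z] by (simp add: norm_minus_commute)
        then have "(1 + norm x) * (kernel rho 1 x z * w z) \<le> (2 + norm z) * (kernel rho 1 x z * w z)"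
          using k0 w(2) by (intro mult_right_mono) auto
        then show ?thesis
          by (simp add: mult_ac)
      qed
      also have "\<dots> \<le> (kernel rho 1 x z)\<^sup>2 + ((2 + norm z) * w z)\<^sup>2"
      proof -
        have "0 \<le> kernel rho 1 x z * ((2 + norm z) * w z)"
          by (intro mult_nonneg_nonneg k0 w(2)) auto
        then show ?thesis
          using sum_squares_bound[of "kernel rho 1 x z" "(2 + norm z) * w z"] by linarith
      qed
      also have "(kernel rho 1 x z)\<^sup>2 \<le> C * kernel rho 1 x z"
        unfolding power2_eq_square using kC k0 by (intro mult_right_mono)
      finally show "(1 + norm x) * (kernel rho 1 x z * w z) \<le> C * kernel rho 1 x z + (2 + norm z)\<^sup>2 * (w z)\<^sup>2"
        by (simp add: power_mult_distrib)
    qed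
    also have "\<dots> = A"
      using ik int integral_kernel[of 1 rho x] by (simp add: A_def)
    finally show ?thesis .
  qed
  moreover have "A \<ge> 0"
  proof -
    have "(1 + norm (0 :: real ^ 'n)) * mollify rho 1 w 0 \<ge> 0"
      using mollify_nonneg[OF _ bump_rho_nonneg w(2), of 1] by simp
    then show ?thesis
      using calculation[of 0] by linarith
  qed
  ultimately show ?thesis
    by blast
qed

text \<open>The mean value inequality at unit scale turns the second moment into the pointwise bound
  (1 + |x|) w \<le> A. The squared form is what the potential of each component will need.\<close>

lemma subsolution_decay:
  fixes w :: "real ^ 'n \<Rightarrow> real"
  assumes w: "weak_laplacian_ge w (\<lambda>x. - M * w x)" "\<And>x. w x \<ge> 0" and M: "M \<ge> 0"
    and int: "integrable lborel (\<lambda>x. (w x)\<^sup>2)" "integrable lborel (\<lambda>x. (w x)\<^sup>2 * (norm x)\<^sup>2)"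
  shows "\<exists>A\<ge>0. AE x in lborel. w x \<le> A \<and> (w x)\<^sup>2 \<le> A\<^sup>2 / (1 + (norm x)\<^sup>2)"
proof -
  have li: "loc_integrable w"
    using w(1) by (simp add: weak_laplacian_ge_def)
  have [measurable]: "w \<in> borel_measurable borel"
    using li by measurable
  have "integrable lborel (\<lambda>x. (2 + norm x)\<^sup>2 * (w x)\<^sup>2)"
  proof (rule Bochner_Integration.integrable_bound)
    show "integrable lborel (\<lambda>x. 8 * (w x)\<^sup>2 + 2 * ((w x)\<^sup>2 * (norm x)\<^sup>2))"
      using int by auto
    show "AE x in lborel. norm ((2 + norm x)\<^sup>2 * (w x)\<^sup>2) \<le> norm (8 * (w x)\<^sup>2 + 2 * ((w x)\<^sup>2 * (norm x)\<^sup>2))"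
    proof (intro AE_I2)
      fix x :: "real ^ 'n"
      have "(2 + norm x)\<^sup>2 \<le> 8 + 2 * (norm x)\<^sup>2"
        using sum_squares_bound[of 2 "norm x"] by (simp add: power2_sum)
      then have "(2 + norm x)\<^sup>2 * (w x)\<^sup>2 \<le> (8 + 2 * (norm x)\<^sup>2) * (w x)\<^sup>2"
        by (rule mult_right_mono) simp
      then show "norm ((2 + norm x)\<^sup>2 * (w x)\<^sup>2) \<le> norm (8 * (w x)\<^sup>2 + 2 * ((w x)\<^sup>2 * (norm x)\<^sup>2))"
        by (simp add: algebra_simps)
    qed
  qed measurable
  then obtain A where A: "A \<ge> 0" "\<And>x. (1 + norm x) * mollify rho 1 w x \<le> A"
    using mollify_rho_decay[OF li w(2)] by blast
  define c where "c = bump_mass TYPE('n) rho"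
  have c: "c > 0"
    unfolding c_def by (rule bump_mass_rho_pos)
  define A' where "A' = exp (M / 4) * A / c"
  have "A' \<ge> 0"
    using A c by (simp add: A'_def)
  moreover have "AE x in lborel. w x \<le> A' \<and> (w x)\<^sup>2 \<le> A'\<^sup>2 / (1 + (norm x)\<^sup>2)"
    using subsolution_mean_value[OF w M]
  proof eventually_elim
    fix x assume "bump_mass TYPE('n) rho * w x \<le> exp (M / 4) * mollify rho 1 w x"
    then have "w x \<le> exp (M / 4) * mollify rho 1 w x / c"
      using c by (simp add: c_def[symmetric] pos_le_divide_eq mult.commute)
    then have "(1 + norm x) * w x \<le> (1 + norm x) * (exp (M / 4) * mollify rho 1 w x / c)"
      by (rule mult_left_mono) simp
    also have "\<dots> = exp (M / 4) / c * ((1 + norm x) * mollify rho 1 w x)"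
      by simp
    also have "\<dots> \<le> exp (M / 4) / c * A"
      using c A(2) by (intro mult_left_mono) auto
    finally have *: "(1 + norm x) * w x \<le> A'"
      by (simp add: A'_def)
    have "1 * w x \<le> (1 + norm x) * w x"
      using w(2) by (intro mult_right_mono) auto
    then have 1: "w x \<le> A'"
      using * by simp
    have "((1 + norm x) * w x)\<^sup>2 \<le> A'\<^sup>2"
      using * w(2)[of x] by (intro power_mono) auto
    moreover have "(1 + (norm x)\<^sup>2) * (w x)\<^sup>2 \<le> ((1 + norm x) * w x)\<^sup>2"
      unfolding power_mult_distrib by (intro mult_right_mono) (auto simp: power2_sum)
    ultimately have "(1 + (norm x)\<^sup>2) * (w x)\<^sup>2 \<le> A'\<^sup>2"
      by linarith
    moreover have "1 + (norm x)\<^sup>2 > 0"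
      by (simp add: add_pos_nonneg)
    ultimately show "w x \<le> A' \<and> (w x)\<^sup>2 \<le> A'\<^sup>2 / (1 + (norm x)\<^sup>2)"
      using 1 by (simp add: pos_le_divide_eq mult.commute)
  qed
  ultimately show ?thesis
    by blast
qed

subsection \<open>Comparison with the barriers\<close>

text \<open>The margin 2 y, with y of size 1 / |x|, dominates both the Laplacian error of order y^2
  and the perturbation \<open>V\<close>, which is at most K y^2. Taking \<open>V\<close> as a number
  lets the inequality be used at almost every point.\<close>

lemma barrier_differential_inequality:
  fixes \<omega> K :: real
  assumes K: "K \<ge> 0"
  defines "a \<equiv> (\<omega> - real CARD('n)) / 2"
  shows "\<exists>R\<ge>1. \<forall>(x :: real ^ 'n) V. norm x > R \<longrightarrow> \<bar>V\<bar> \<le> K / (1 + (norm x)\<^sup>2) \<longrightarrow>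
    1 \<le> (norm x)\<^sup>2 - \<omega> + V \<and>
    laplacian (barrier a (-1)) x \<le> ((norm x)\<^sup>2 - \<omega> + V) * barrier a (-1) x \<and>
    ((norm x)\<^sup>2 - \<omega> + V) * barrier a 1 x \<le> laplacian (barrier a 1) x"
proof -
  define p q :: "real ^ 'n \<Rightarrow> real" where pq: "p = barrier a (-1)" "q = barrier a 1"
  have p0: "p x \<ge> 0" "q x \<ge> 0" for x
    by (simp_all add: pq less_imp_le barrier_pos)
  obtain C1 where C1: "C1 \<ge> 0" "\<And>(x :: real ^ 'n). let y = inv_sqrt1 ((norm x)\<^sup>2) in
    \<bar>laplacian q x - q x * ((norm x)\<^sup>2 - 2 * a - CARD('n) + 2 * 1 * y)\<bar> \<le> C1 * y\<^sup>2 * q x"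
    using laplacian_barrier_bound[of 1 a, where ?'n = 'n] unfolding pq by auto
  obtain C2 where C2: "C2 \<ge> 0" "\<And>(x :: real ^ 'n). let y = inv_sqrt1 ((norm x)\<^sup>2) in
    \<bar>laplacian p x - p x * ((norm x)\<^sup>2 - 2 * a - CARD('n) + 2 * (-1) * y)\<bar> \<le> C2 * y\<^sup>2 * p x"
    using laplacian_barrier_bound[of "-1" a, where ?'n = 'n] unfolding pq by auto
  \<comment> \<open>Outside this radius y \<le> 1 / R gives (C + K) y \<le> 1, well within the
    margin 2. Also |x|^2 \<ge> R keeps |x|^2 - \<omega> + V above 1, as the Liouville lemma
    demands.\<close>
  define R where "R = 1 + (C1 + C2 + K) + \<bar>\<omega>\<bar>"
  have R: "R \<ge> 1"
    using C1 C2 K by (simp add: R_def)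
  have "1 \<le> (norm x)\<^sup>2 - \<omega> + V \<and>
    laplacian p x \<le> ((norm x)\<^sup>2 - \<omega> + V) * p x \<and>
    ((norm x)\<^sup>2 - \<omega> + V) * q x \<le> laplacian q x"
    if x: "norm x > R" and V: "\<bar>V\<bar> \<le> K / (1 + (norm x)\<^sup>2)" for x :: "real ^ 'n" and V
  proof -
    define t y where "t = (norm x)\<^sup>2" and "y = inv_sqrt1 t"
    have t: "t \<ge> R"
    proof -
      have "R * 1 \<le> norm x * norm x"
        using x R by (intro mult_mono) auto
      then show ?thesis
        by (simp add: t_def power2_eq_square)
    qed
    have y: "0 < y" "y \<le> 1" "y\<^sup>2 = 1 / (1 + t)"
      using inv_sqrt1_bounds[of t] t R by (auto simp: y_def)
    have V': "\<bar>V\<bar> \<le> K * y\<^sup>2"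
      using V by (simp add: y t_def)
    have "K * y\<^sup>2 \<le> K * 1"
      using K y by (intro mult_left_mono power_le_one) auto
    then have 1: "1 \<le> t - \<omega> + V"
      using V' t C1 C2 unfolding R_def by linarith
    have small: "(C + K) * y\<^sup>2 \<le> 2 * y" if C: "C \<ge> 0" "C \<le> C1 + C2" for C
    proof -
      have "y \<le> 1 / R"
      proof -
        have "R \<le> sqrt (1 + t)"
        proof (rule real_le_rsqrt)
          have "R\<^sup>2 \<le> (norm x)\<^sup>2"
            using x R by (intro power_mono) auto
          then show "R\<^sup>2 \<le> 1 + t"
            by (simp add: t_def)
        qed
        then show ?thesis
          unfolding y_def inv_sqrt1_def using R by (intro divide_left_mono mult_pos_pos) linarith+
      qed
      then have "(C + K) * y \<le> R * (1 / R)"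
        using C K C1 C2 R y by (intro mult_mono) (auto simp: R_def)
      then have "(C + K) * y \<le> 2"
        using R by simp
      then have "(C + K) * y * y \<le> 2 * y"
        using y by (intro mult_right_mono) auto
      then show ?thesis
        by (simp add: power2_eq_square)
    qed
    have tw: "t - 2 * a - CARD('n) = t - \<omega>"
      by (simp add: a_def field_simps)
    have "laplacian p x \<le> p x * (t - \<omega> + 2 * (-1) * y) + C2 * y\<^sup>2 * p x"
      using C2(2)[of x, folded t_def, folded y_def] unfolding Let_def tw abs_le_iff by linarith
    also have "\<dots> = p x * (t - \<omega> - 2 * y + C2 * y\<^sup>2)"
      by (simp add: algebra_simps)
    also have "\<dots> \<le> p x * (t - \<omega> + V)"
    proof (rule mult_left_mono)
      show "t - \<omega> - 2 * y + C2 * y\<^sup>2 \<le> t - \<omega> + V"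
        using small[of C2] V' C1(1) C2(1) unfolding distrib_right by linarith
    qed (rule p0)
    finally have 2: "laplacian p x \<le> (t - \<omega> + V) * p x"
      by (simp add: mult.commute)
    have "q x * (t - \<omega> + V) \<le> q x * (t - \<omega> + 2 * y - C1 * y\<^sup>2)"
    proof (rule mult_left_mono)
      show "t - \<omega> + V \<le> t - \<omega> + 2 * y - C1 * y\<^sup>2"
        using small[of C1] V' C1(1) C2(1) unfolding distrib_right by linarith
    qed (rule p0)
    also have "\<dots> = q x * (t - \<omega> + 2 * 1 * y) - C1 * y\<^sup>2 * q x"
      by (simp add: algebra_simps)
    also have "\<dots> \<le> laplacian q x"
      using C1(2)[of x, folded t_def, folded y_def] unfolding Let_def tw abs_le_iff by linarith
    finally have 3: "(t - \<omega> + V) * q x \<le> laplacian q x"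
      by (simp add: mult.commute)
    show ?thesis
      using 1 2 3 by (simp add: t_def)
  qed
  then show ?thesis
    unfolding pq using R by blast
qed

text \<open>The potential \<open>c\<close> is treated as given, so the argument is linear; the
  coupling is felt only through the bound on \<open>c\<close>.\<close>

lemma solution_asymptotics:
  fixes u c :: "real ^ 'n \<Rightarrow> real"
  assumes u: "weak_laplacian u (\<lambda>x. c x * u x)" "\<And>x. u x \<ge> 0" "AE x in lborel. u x > 0"
    and u2: "integrable lborel (\<lambda>x. (u x)\<^sup>2)" and bounded: "AE x in lborel. u x \<le> A"
    and c: "AE x in lborel. \<bar>c x - ((norm x)\<^sup>2 - \<omega>)\<bar> \<le> K / (1 + (norm x)\<^sup>2)" and K: "K \<ge> 0"
  shows "comparable_at_infinity u (\<lambda>x. norm x powr ((\<omega> - real CARD('n)) / 2) * exp (- (norm x)\<^sup>2 / 2))"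
proof -
  define a where "a = (\<omega> - real CARD('n)) / 2"
  define b where "b = (\<lambda>x :: real ^ 'n. norm x powr a * exp (- (norm x)\<^sup>2 / 2))"
  define p q :: "real ^ 'n \<Rightarrow> real" where pq: "p = barrier a (-1)" "q = barrier a 1"
  have p0: "p x > 0" for x
    by (simp add: pq barrier_pos)
  have wl: "weak_laplacian p (laplacian p)" "weak_laplacian q (laplacian q)"
    unfolding pq by (rule weak_laplacian_classical[OF Ck_barrier])+
  obtain R where R: "R \<ge> 1" and ineq: "\<And>x V. norm x > R \<Longrightarrow> \<bar>V\<bar> \<le> K / (1 + (norm x)\<^sup>2) \<Longrightarrow>
    1 \<le> (norm x)\<^sup>2 - \<omega> + V \<and>
    laplacian p x \<le> ((norm x)\<^sup>2 - \<omega> + V) * p x \<and>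
    ((norm x)\<^sup>2 - \<omega> + V) * q x \<le> laplacian q x"
    using barrier_differential_inequality[OF K, of \<omega>, where ?'n = 'n] unfolding a_def pq by blast
  define Q where "Q x \<longleftrightarrow> 1 \<le> c x \<and> laplacian p x \<le> c x * p x \<and> c x * q x \<le> laplacian q x" for x
  have cR: "AE x in lborel. norm x > R \<longrightarrow> Q x"
    using c
  proof eventually_elim
    fix x assume "\<bar>c x - ((norm x)\<^sup>2 - \<omega>)\<bar> \<le> K / (1 + (norm x)\<^sup>2)"
    then show "norm x > R \<longrightarrow> Q x"
      using ineq[of x "c x - ((norm x)\<^sup>2 - \<omega>)"] by (simp add: Q_def)
  qed
  have upper: "\<exists>\<kappa>>0. AE x in lborel. u x \<le> \<kappa> * p x"
  proof -
    have "continuous_on (cball 0 R) p"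
      unfolding pq by (rule continuous_on_subset[OF Ck_continuous[OF Ck_barrier]]) auto
    then obtain z where z: "\<And>x. x \<in> cball 0 R \<Longrightarrow> p z \<le> p x"
      using continuous_attains_inf[OF compact_cball, of 0 R p] R
      by (metis cball_eq_empty less_le_not_le not_one_le_zero order_trans)
    \<comment> \<open>As z minimises \<open>p\<close> on the ball, this makes \<kappa> p at least
      |A| + 1 there, which exceeds u.\<close>
    define \<kappa> where "\<kappa> = (\<bar>A\<bar> + 1) / p z"
    have \<kappa>: "\<kappa> > 0"
      unfolding \<kappa>_def by (intro divide_pos_pos p0) auto
    have "AE x in lborel. 1 * u x + (- \<kappa>) * p x \<le> 0"
    proof (rule weak_comparison[OF weak_laplacian_linear[OF u(1) wl(1)] _ _ u2])
      show "AE x in lborel. norm x \<le> R \<longrightarrow> 1 * u x + - \<kappa> * p x \<le> 0"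
        using bounded
      proof (eventually_elim, intro impI)
        fix x assume x: "u x \<le> A" "norm x \<le> R"
        have "\<bar>A\<bar> + 1 = \<kappa> * p z"
          using p0[of z] by (simp add: \<kappa>_def)
        also have "\<dots> \<le> \<kappa> * p x"
          using \<kappa> z[of x] x by (intro mult_left_mono) auto
        finally show "1 * u x + - \<kappa> * p x \<le> 0"
          using x by simp
      qed
      show "AE x in lborel. norm x > R \<longrightarrow> 1 * u x + - \<kappa> * p x > 0 \<longrightarrow>
          1 * u x + - \<kappa> * p x \<le> 1 * (c x * u x) + - \<kappa> * laplacian p x"
        using cR
      proof (eventually_elim, intro impI)
        fix x assume *: "norm x > R \<longrightarrow> Q x" "norm x > R" "1 * u x + - \<kappa> * p x > 0"
        \<comment> \<open>Where the difference is positive, c \<ge> 1 and the supersolution property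
          of \<open>p\<close> give that its Laplacian is at least c times the difference, hence at
          least the difference itself.\<close>
        have "1 * (1 * u x + - \<kappa> * p x) \<le> c x * (1 * u x + - \<kappa> * p x)"
          using * by (intro mult_right_mono) (auto simp: Q_def)
        moreover have "\<kappa> * laplacian p x \<le> \<kappa> * (c x * p x)"
          using * \<kappa> by (intro mult_left_mono) (auto simp: Q_def)
        ultimately show "1 * u x + - \<kappa> * p x \<le> 1 * (c x * u x) + - \<kappa> * laplacian p x"
          by (simp add: algebra_simps)
      qed
      show "1 * u x + - \<kappa> * p x \<le> \<bar>u x\<bar> + 0" for x
        using mult_pos_pos[OF \<kappa> p0[of x]] by simp
    qed simp
    then have "AE x in lborel. u x \<le> \<kappa> * p x"
      by eventually_elim simp
    then show ?thesis
      using \<kappa> by blast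
  qed
  have lower: "\<exists>\<kappa>>0. AE x in lborel. \<kappa> * q x \<le> u x"
  proof -
    \<comment> \<open>An upper bound for \<open>c\<close> on the ball of radius R + 1, the enlarged
      ball needed for the lower bound of u.\<close>
    define M where "M = (R + 1)\<^sup>2 + \<bar>\<omega>\<bar> + K"
    have "AE x in lborel. norm x \<le> R + 1 \<longrightarrow> c x * u x \<le> M * u x"
      using c
    proof (eventually_elim, intro impI)
      fix x assume x: "\<bar>c x - ((norm x)\<^sup>2 - \<omega>)\<bar> \<le> K / (1 + (norm x)\<^sup>2)" "norm x \<le> R + 1"
      have "K / (1 + (norm x)\<^sup>2) \<le> K"
        using K mult_left_mono[of 1 "1 + (norm x)\<^sup>2" K] by (simp add: divide_le_eq add_pos_nonneg)
      moreover have "(norm x)\<^sup>2 \<le> (R + 1)\<^sup>2"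
        using x R by (intro power_mono) auto
      ultimately have "c x \<le> M"
        using x(1) unfolding M_def by linarith
      then show "c x * u x \<le> M * u x"
        using u(2) by (intro mult_right_mono)
    qed
    moreover have "M \<ge> 0" "R \<ge> 0"
      using K R by (simp_all add: M_def)
    ultimately obtain m where m: "m > 0" "AE x in lborel. norm x \<le> R \<longrightarrow> m \<le> u x"
      using positive_supersolution_bounded_below[OF u] by blast
    obtain L where L: "L \<ge> 0" "\<And>x. q x \<le> L"
      using barrier_bounded[of 1 a] unfolding pq by auto
    \<comment> \<open>This makes \<kappa> q at most m, which is at most u inside the ball; L + 1
      keeps the denominator positive.\<close>
    define \<kappa> where "\<kappa> = m / (L + 1)"
    have \<kappa>: "\<kappa> > 0"
      using m L by (simp add: \<kappa>_def)
    have \<kappa>m: "\<kappa> * q x \<le> m" for x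
    proof -
      have "\<kappa> * q x \<le> \<kappa> * (L + 1)"
        using \<kappa> L(2)[of x] by (intro mult_left_mono) auto
      also have "\<dots> = m"
        using L by (simp add: \<kappa>_def)
      finally show ?thesis .
    qed
    have "AE x in lborel. \<kappa> * q x + (- 1) * u x \<le> 0"
    proof (rule weak_comparison[OF weak_laplacian_linear[OF wl(2) u(1)] _ _ u2])
      show "AE x in lborel. norm x \<le> R \<longrightarrow> \<kappa> * q x + - 1 * u x \<le> 0"
        using m(2)
      proof (eventually_elim, intro impI)
        fix x assume "norm x \<le> R \<longrightarrow> m \<le> u x" "norm x \<le> R"
        then show "\<kappa> * q x + - 1 * u x \<le> 0"
          using \<kappa>m[of x] by simp
      qed
      show "AE x in lborel. norm x > R \<longrightarrow> \<kappa> * q x + - 1 * u x > 0 \<longrightarrow>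
          \<kappa> * q x + - 1 * u x \<le> \<kappa> * laplacian q x + - 1 * (c x * u x)"
        using cR
      proof (eventually_elim, intro impI)
        fix x assume *: "norm x > R \<longrightarrow> Q x" "norm x > R" "\<kappa> * q x + - 1 * u x > 0"
        have "1 * (\<kappa> * q x + - 1 * u x) \<le> c x * (\<kappa> * q x + - 1 * u x)"
          using * by (intro mult_right_mono) (auto simp: Q_def)
        moreover have "\<kappa> * (c x * q x) \<le> \<kappa> * laplacian q x"
          using * \<kappa> by (intro mult_left_mono) (auto simp: Q_def)
        ultimately show "\<kappa> * q x + - 1 * u x \<le> \<kappa> * laplacian q x + - 1 * (c x * u x)"
          by (simp add: algebra_simps)
      qed
      \<comment> \<open>Here the barrier is the positive term, so its bound m serves as the constant
        in the growth condition; in the upper comparison the constant was 0.\<close>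
      show "\<kappa> * q x + - 1 * u x \<le> \<bar>u x\<bar> + m" for x
        using \<kappa>m[of x] u(2)[of x] by simp
    qed (use m in simp)
    then have "AE x in lborel. \<kappa> * q x \<le> u x"
      by eventually_elim simp
    then show ?thesis
      using \<kappa> by blast
  qed
  obtain \<kappa>1 where \<kappa>1: "\<kappa>1 > 0" "AE x in lborel. \<kappa>1 * q x \<le> u x"
    using lower by blast
  obtain \<kappa>2 where \<kappa>2: "\<kappa>2 > 0" "AE x in lborel. u x \<le> \<kappa>2 * p x"
    using upper by blast
  obtain d1 where d1: "d1 > 0" "\<And>x. norm x \<ge> 1 \<Longrightarrow> d1 * b x \<le> q x"
    using barrier_comparable[of 1 a, where ?'n = 'n] unfolding b_def pq by auto
  obtain d2 where d2: "d2 > 0" "\<And>x. norm x \<ge> 1 \<Longrightarrow> p x \<le> d2 * b x"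
    using barrier_comparable[of "-1" a, where ?'n = 'n] unfolding b_def pq by auto
  have "AE x in lborel. 1 \<le> norm x \<longrightarrow> (\<kappa>1 * d1) * b x \<le> u x \<and> u x \<le> (\<kappa>2 * d2) * b x"
    using \<kappa>1(2) \<kappa>2(2)
  proof eventually_elim
    fix x assume *: "\<kappa>1 * q x \<le> u x" "u x \<le> \<kappa>2 * p x"
    show "1 \<le> norm x \<longrightarrow> (\<kappa>1 * d1) * b x \<le> u x \<and> u x \<le> (\<kappa>2 * d2) * b x"
      using order_trans[OF mult_left_mono[OF d1(2)[of x] less_imp_le[OF \<kappa>1(1)]] *(1)]
        order_trans[OF *(2) mult_left_mono[OF d2(2)[of x] less_imp_le[OF \<kappa>2(1)]]]
      by (simp add: mult.assoc)
  qed
  then have "AE x in lebesgue. 1 \<le> norm x \<longrightarrow> (\<kappa>1 * d1) * b x \<le> u x \<and> u x \<le> (\<kappa>2 * d2) * b x"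
    by (rule AE_completion)
  then show ?thesis
    unfolding comparable_at_infinity_def b_def[unfolded a_def, symmetric]
    using \<kappa>1(1) \<kappa>2(1) d1(1) d2(1) by (intro exI[of _ "\<kappa>1 * d1"] conjI exI[of _ "\<kappa>2 * d2"] exI[of _ 1]) auto
qed

lemma comparable_at_infinity_AE_cong:
  assumes uv: "AE x in lebesgue. u x = v x" and v: "comparable_at_infinity v b"
  shows "comparable_at_infinity u b"
proof -
  obtain C1 C2 R where C: "C1 > 0" "C2 > 0"
    and ae: "AE x in lebesgue. R \<le> norm x \<longrightarrow> C1 * b x \<le> v x \<and> v x \<le> C2 * b x"
    using v unfolding comparable_at_infinity_def by blast
  have "AE x in lebesgue. R \<le> norm x \<longrightarrow> C1 * b x \<le> u x \<and> u x \<le> C2 * b x"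
    using ae uv by eventually_elim simp
  with C show ?thesis
    unfolding comparable_at_infinity_def by blast
qed

theorem proposition8p15:
  fixes B :: "real ^ 'k ^ 'k"
    and \<omega> :: "'k::finite \<Rightarrow> real"
    and u :: "'k \<Rightarrow> real ^ 'n::finite \<Rightarrow> real"
  assumes "transpose B = B"
    and "positive_semidefinite B"
    and "u \<in> energy_space"
    and "\<forall>i. AE x in lebesgue. u i x > 0"
    and "weak_solution B \<omega> u"
  shows "\<forall>i. comparable_at_infinity (u i)
           (\<lambda>x. norm x powr ((\<omega> i - real CARD('n)) / 2) * exp (- (norm x)\<^sup>2 / 2))"
proof
  fix i
  obtain v where v: "\<forall>i. v i \<in> borel_measurable borel \<and> (\<forall>x. v i x \<ge> 0) \<and> (AE x in lborel. v i x > 0) \<and>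
    (AE x in lebesgue. u i x = v i x) \<and> integrable lborel (\<lambda>x. (v i x)\<^sup>2) \<and>
    integrable lborel (\<lambda>x. (v i x)\<^sup>2 * (norm x)\<^sup>2) \<and>
    weak_laplacian (v i) (\<lambda>x. coefficient B \<omega> v i x * v i x)"
    using weak_solution_representative[OF assms(3) assms(4)[rule_format] assms(5)] ..
  have v0: "v i x \<ge> 0" for i x
    using v by blast
  have vpos: "AE x in lborel. v i x > 0" and uv: "AE x in lebesgue. u i x = v i x"
    and v2: "integrable lborel (\<lambda>x. (v i x)\<^sup>2)" and vx: "integrable lborel (\<lambda>x. (v i x)\<^sup>2 * (norm x)\<^sup>2)"
    and wl: "weak_laplacian (v i) (\<lambda>x. coefficient B \<omega> v i x * v i x)" for i
    using v by blast+
  define w where "w = (\<lambda>x. norm (\<chi> i. v i x))"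
  have w2: "(w x)\<^sup>2 = (\<Sum>i\<in>UNIV. (v i x)\<^sup>2)" for x
    by (simp add: w_def norm_vec_def L2_set_def sum_nonneg)
  have "\<exists>A\<ge>0. AE x in lborel. w x \<le> A \<and> (w x)\<^sup>2 \<le> A\<^sup>2 / (1 + (norm x)\<^sup>2)"
  proof (rule subsolution_decay)
    show "weak_laplacian_ge w (\<lambda>x. - (\<Sum>i\<in>UNIV. \<bar>\<omega> i\<bar>) * w x)"
      unfolding w_def by (rule norm_subsolution[OF assms(2) wl])
    show "integrable lborel (\<lambda>x. (w x)\<^sup>2)" "integrable lborel (\<lambda>x. (w x)\<^sup>2 * (norm x)\<^sup>2)"
      unfolding w2 sum_distrib_right using v2 vx by auto
  qed (auto simp: w_def sum_nonneg)
  then obtain A where A: "A \<ge> 0" "AE x in lborel. w x \<le> A \<and> (w x)\<^sup>2 \<le> A\<^sup>2 / (1 + (norm x)\<^sup>2)"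
    by blast
  \<comment> \<open>The interactions in row i are at most \<beta> w^2, hence at most \<beta> A^2 /
    (1 + |x|^2); this is the constant K of \<open>solution_asymptotics\<close>.\<close>
  define \<beta> where "\<beta> = (\<Sum>j\<in>UNIV. \<bar>B $ i $ j\<bar>)"
  have "comparable_at_infinity (v i) (\<lambda>x. norm x powr ((\<omega> i - real CARD('n)) / 2) * exp (- (norm x)\<^sup>2 / 2))"
  proof (rule solution_asymptotics[OF wl v0 vpos v2])
    show "AE x in lborel. v i x \<le> A"
      using A(2)
    proof eventually_elim
      fix x assume "w x \<le> A \<and> (w x)\<^sup>2 \<le> A\<^sup>2 / (1 + (norm x)\<^sup>2)"
      then show "v i x \<le> A"
        using component_le_norm_cart[of "\<chi> i. v i x" i] unfolding w_def by simp linarith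
    qed
    show "AE x in lborel. \<bar>coefficient B \<omega> v i x - ((norm x)\<^sup>2 - \<omega> i)\<bar> \<le> \<beta> * A\<^sup>2 / (1 + (norm x)\<^sup>2)"
      using A(2)
    proof eventually_elim
      fix x assume x: "w x \<le> A \<and> (w x)\<^sup>2 \<le> A\<^sup>2 / (1 + (norm x)\<^sup>2)"
      have "\<bar>\<Sum>j\<in>UNIV. B $ i $ j * (v j x)\<^sup>2\<bar> \<le> (\<Sum>j\<in>UNIV. \<bar>B $ i $ j\<bar> * (w x)\<^sup>2)"
      proof (rule order_trans[OF sum_abs], rule sum_mono)
        fix j
        have "(v j x)\<^sup>2 \<le> (w x)\<^sup>2"
          unfolding w2 by (intro member_le_sum) auto
        then show "\<bar>B $ i $ j * (v j x)\<^sup>2\<bar> \<le> \<bar>B $ i $ j\<bar> * (w x)\<^sup>2"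
          by (simp add: abs_mult mult_left_mono)
      qed
      also have "\<dots> = \<beta> * (w x)\<^sup>2"
        by (simp add: \<beta>_def sum_distrib_right)
      also have "\<dots> \<le> \<beta> * (A\<^sup>2 / (1 + (norm x)\<^sup>2))"
        using x by (intro mult_left_mono) (auto simp: \<beta>_def sum_nonneg)
      finally show "\<bar>coefficient B \<omega> v i x - ((norm x)\<^sup>2 - \<omega> i)\<bar> \<le> \<beta> * A\<^sup>2 / (1 + (norm x)\<^sup>2)"
        by (simp add: coefficient_def)
    qed
    show "\<beta> * A\<^sup>2 \<ge> 0"
      by (simp add: \<beta>_def sum_nonneg)
  qed
  then show "comparable_at_infinity (u i) (\<lambda>x. norm x powr ((\<omega> i - real CARD('n)) / 2) * exp (- (norm x)\<^sup>2 / 2))"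
    by (rule comparable_at_infinity_AE_cong[OF uv])
qed

end
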